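(* Let $\Omega\subset\mathbb{R}^N$ ($N\ge 2$) be a bounded domain, $s_1\in(0,1)$, $p\in(1,2)$ and $s_p\in\left(0,\frac{p-1}{p}\right]$. Suppose that $u$ is a locally bounded weak solution of $(-\Delta_1)^{s_1}u+(-\Delta_p)^{s_p}u=0$ in $\Omega$. Then $u\in W^{\sigma,q}_{\mathrm{loc}}(\Omega)$ for any $q\ge p$ and any $\sigma$ with $s_p\le\sigma<\frac{s_pp}{p-1}$. Moreover, there exist constants $C$ and $\kappa$ depending on $N,p,q,s_1,s_p,\sigma$ such that for any ball $B_R\equiv B_R(x_0)\subset\subset\Omega$ with $R\in(0,1)$ and any $r\in(0,R)$, \[ [u]^q_{W^{\sigma,q}(B_r)}\le \frac{C\left(\mathcal{T}+[u]_{W^{s_p,p}(B_R)}+1\right)^q}{(R-r)^{\kappa}},\qquad \mathcal{T}:=\|u\|_{L^\infty(B_R(x_0))}+\mathrm{Tail}(u;x_0,R). \]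
   Context: For $\gamma\in(0,1)$, $q\ge1$ and an open set $U$, $[w]_{W^{\gamma,q}(U)}:=\left(\int_U\int_U\frac{|w(x)-w(y)|^q}{|x-y|^{N+\gamma q}}dxdy\right)^{1/q}$ and $W^{\gamma,q}(U)=\{w\in L^q(U):[w]_{W^{\gamma,q}(U)}<\infty\}$; $W^{\gamma,q}_{\mathrm{loc}}(\Omega)$ means $w\in W^{\gamma,q}(B)$ for every ball $B\subset\subset\Omega$. The tail space $L^{p-1}_{s_pp}(\mathbb{R}^N)$ consists of $w\in L^p_{\mathrm{loc}}(\mathbb{R}^N)$ with $\int_{\mathbb{R}^N}\frac{|w|^{p-1}}{(1+|x|)^{N+s_pp}}dx<\infty$, and $\mathrm{Tail}(u;x_0,R):=\left(R^{s_pp}\int_{\mathbb{R}^N\setminus B_R(x_0)}\frac{|u|^{p-1}}{|x-x_0|^{N+s_pp}}dx\right)^{1/(p-1)}$. A weak solution is a function $u\in W^{s_1,1}_{\mathrm{loc}}(\Omega)\cap W^{s_p,p}_{\mathrm{loc}}(\Omega)\cap L^{p-1}_{s_pp}(\mathbb{R}^N)$ for which there exists $Z\in L^\infty(\mathbb{R}^N\times\mathbb{R}^N)$ with $Z(x,y)\in\mathrm{sgn}(u(x)-u(y))$ (where $\mathrm{sgn}(t)=\{t/|t|\}$ for $t\ne0$ and $\mathrm{sgn}(0)=[-1,1]$) such that for every $\varphi\in W^{s_1,1}_0(\Omega)\cap W^{s_p,p}_0(\Omega)$, \[0=\int_{\mathbb{R}^N}\int_{\mathbb{R}^N}Z\frac{\varphi(x)-\varphi(y)}{|x-y|^{N+s_1}}dxdy+\int_{\mathbb{R}^N}\int_{\mathbb{R}^N}\frac{|u(x)-u(y)|^{p-2}(u(x)-u(y))(\varphi(x)-\varphi(y))}{|x-y|^{N+s_pp}}dxdy.\]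 Locally bounded means $u\in L^\infty(B)$ for every ball $B\subset\subset\Omega$. *)

theory Defs
  imports "HOL-Analysis.Analysis" "HOL-Probability.Essential_Supremum"
begin

definition gagliardo_int :: "real \<Rightarrow> real \<Rightarrow> 'a::euclidean_space set \<Rightarrow> ('a \<Rightarrow> real) \<Rightarrow> ennreal" where
  "gagliardo_int \<gamma> q U w =
     (\<integral>\<^sup>+ z. indicator (U \<times> U) z *
        ennreal (\<bar>w (fst z) - w (snd z)\<bar> powr q
                 / norm (fst z - snd z) powr (real DIM('a) + \<gamma> * q)) \<partial>(lebesgue \<Otimes>\<^sub>M lebesgue))"

text \<open>The Gagliardo seminorm [w]_{W^{gamma,q}(U)} (meaningful when the integral is finite).\<close>
definition gagliardo_seminorm :: "real \<Rightarrow> real \<Rightarrow> 'a::euclidean_space set \<Rightarrow> ('a \<Rightarrow> real) \<Rightarrow> real" where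
  "gagliardo_seminorm \<gamma> q U w = enn2real (gagliardo_int \<gamma> q U w) powr (1 / q)"

definition in_Lq :: "real \<Rightarrow> 'a::euclidean_space set \<Rightarrow> ('a \<Rightarrow> real) \<Rightarrow> bool" where
  "in_Lq q U w \<longleftrightarrow> w \<in> borel_measurable lebesgue \<and> set_integrable lebesgue U (\<lambda>x. \<bar>w x\<bar> powr q)"

definition in_W :: "real \<Rightarrow> real \<Rightarrow> 'a::euclidean_space set \<Rightarrow> ('a \<Rightarrow> real) \<Rightarrow> bool" where
  "in_W \<gamma> q U w \<longleftrightarrow> in_Lq q U w \<and> gagliardo_int \<gamma> q U w < \<infinity>"

definition in_W_loc :: "real \<Rightarrow> real \<Rightarrow> 'a::euclidean_space set \<Rightarrow> ('a \<Rightarrow> real) \<Rightarrow> bool" where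
  "in_W_loc \<gamma> q \<Omega> w \<longleftrightarrow> (\<forall>x r. 0 < r \<and> cball x r \<subseteq> \<Omega> \<longrightarrow> in_W \<gamma> q (ball x r) w)"

definition in_W0 :: "real \<Rightarrow> real \<Rightarrow> 'a::euclidean_space set \<Rightarrow> ('a \<Rightarrow> real) \<Rightarrow> bool" where
  "in_W0 \<gamma> q \<Omega> w \<longleftrightarrow> in_W \<gamma> q UNIV w \<and> (AE x in lebesgue. x \<notin> \<Omega> \<longrightarrow> w x = 0)"

definition in_tail_space :: "real \<Rightarrow> real \<Rightarrow> ('a::euclidean_space \<Rightarrow> real) \<Rightarrow> bool" where
  "in_tail_space p sp w \<longleftrightarrow>
     w \<in> borel_measurable lebesgue \<and>
     (\<forall>K. compact K \<longrightarrow> set_integrable lebesgue K (\<lambda>x. \<bar>w x\<bar> powr p)) \<and>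
     integrable lebesgue (\<lambda>x. \<bar>w x\<bar> powr (p - 1) / (1 + norm x) powr (real DIM('a) + sp * p))"

definition Tail :: "real \<Rightarrow> real \<Rightarrow> ('a::euclidean_space \<Rightarrow> real) \<Rightarrow> 'a \<Rightarrow> real \<Rightarrow> real" where
  "Tail p sp u x0 R =
     (R powr (sp * p) *
      (LINT x : (- ball x0 R) | lebesgue. \<bar>u x\<bar> powr (p - 1) / norm (x - x0) powr (real DIM('a) + sp * p)))
     powr (1 / (p - 1))"

definition Linf_norm :: "'a::euclidean_space set \<Rightarrow> ('a \<Rightarrow> real) \<Rightarrow> real" where
  "Linf_norm U u = real_of_ereal (esssup (restrict_space lebesgue U) (\<lambda>x. ereal \<bar>u x\<bar>))"

definition locally_bounded :: "'a::euclidean_space set \<Rightarrow> ('a \<Rightarrow> real) \<Rightarrow> bool" where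
  "locally_bounded \<Omega> u \<longleftrightarrow> u \<in> borel_measurable lebesgue \<and>
     (\<forall>x r. 0 < r \<and> cball x r \<subseteq> \<Omega> \<longrightarrow> (\<exists>M. AE y in lebesgue. y \<in> ball x r \<longrightarrow> \<bar>u y\<bar> \<le> M))"

definition in_sgn :: "real \<Rightarrow> real \<Rightarrow> bool" where
  "in_sgn z t \<longleftrightarrow> (if t = 0 then \<bar>z\<bar> \<le> 1 else z = sgn t)"

definition weak_solution :: "real \<Rightarrow> real \<Rightarrow> real \<Rightarrow> 'a::euclidean_space set \<Rightarrow> ('a \<Rightarrow> real) \<Rightarrow> bool" where
  "weak_solution s1 sp p \<Omega> u \<longleftrightarrow>
     in_W_loc s1 1 \<Omega> u \<and> in_W_loc sp p \<Omega> u \<and> in_tail_space p sp u \<and>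
     (\<exists>Z :: 'a \<times> 'a \<Rightarrow> real.
        Z \<in> borel_measurable (lebesgue \<Otimes>\<^sub>M lebesgue) \<and>
        (\<exists>M. AE z in lebesgue \<Otimes>\<^sub>M lebesgue. \<bar>Z z\<bar> \<le> M) \<and>
        (AE z in lebesgue \<Otimes>\<^sub>M lebesgue. in_sgn (Z z) (u (fst z) - u (snd z))) \<and>
        (\<forall>\<phi>. in_W0 s1 1 \<Omega> \<phi> \<and> in_W0 sp p \<Omega> \<phi> \<and>
           integrable (lebesgue \<Otimes>\<^sub>M lebesgue)
             (\<lambda>z. Z z * (\<phi> (fst z) - \<phi> (snd z)) / norm (fst z - snd z) powr (real DIM('a) + s1)) \<and>
           integrable (lebesgue \<Otimes>\<^sub>M lebesgue)
             (\<lambda>z. \<bar>u (fst z) - u (snd z)\<bar> powr (p - 2) * (u (fst z) - u (snd z)) * (\<phi> (fst z) - \<phi> (snd z))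
                  / norm (fst z - snd z) powr (real DIM('a) + sp * p))
           \<longrightarrow>
           (\<integral>z. Z z * (\<phi> (fst z) - \<phi> (snd z)) / norm (fst z - snd z) powr (real DIM('a) + s1)
              \<partial>(lebesgue \<Otimes>\<^sub>M lebesgue))
         + (\<integral>z. \<bar>u (fst z) - u (snd z)\<bar> powr (p - 2) * (u (fst z) - u (snd z)) * (\<phi> (fst z) - \<phi> (snd z))
                  / norm (fst z - snd z) powr (real DIM('a) + sp * p) \<partial>(lebesgue \<Otimes>\<^sub>M lebesgue))
           = 0))"

end

theory Submission
  imports Defs
begin

text \<open>
  Write \<open>w x = u (x + h) - u x\<close> and \<open>g t = |t|^(q - p) t\<close>. Testing the equation with \<open>\<eta> g(w)\<close>, \<open>\<eta>\<close> a
  cutoff, and with its translate by \<open>-h\<close>, and subtracting, the contribution of the 1-Laplacian is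
  nonnegative up to cutoff errors, because \<open>Z\<close> is a monotone selection of \<open>sgn\<close>. Since \<open>s1 < 1\<close> and
  \<open>sp p \<le> p - 1 < 1\<close>, both kernels become integrable near the diagonal after multiplication by
  \<open>|x - y|\<close>, so that the sup norm and the tail of \<open>u\<close> bound all error terms by the integral of
  \<open>|w|^(q + 1 - p)\<close>. This controls the integral of
  \<open>(|a| + |b|)^(p - 2) |a - b|^(q + 2 - p) / |x - y|^(N + sp p)\<close>, where \<open>a = u (x + h) - u (y + h)\<close> and
  \<open>b = u x - u y\<close>, and pointwise interpolation with the integrand of the \<open>W^(\<sigma>, q)\<close> seminorm removes the
  degenerate weight. The resulting fractional estimate for \<open>w\<close> bounds second differences of \<open>u\<close>, hence
  first differences, and \<open>\<sigma>\<close> improves to any exponent below \<open>(sp p + \<sigma> (q + 3 - 2p)) / (q + 2 - p)\<close>.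
  This affine contraction has the fixed point \<open>sp p / (p - 1)\<close>; the iteration starts from
  \<open>\<sigma> = sp p / q\<close>, where the seminorm is finite because \<open>u\<close> is bounded.
\<close>

section \<open>Lebesgue measure and translations\<close>

text \<open>Testing is tied to one shift \<open>h\<close>: the equation controls the fractional
  regularity of \<open>w = diff h u\<close> for that same \<open>h\<close>, so what is learnt about
  \<open>u\<close> is a bound on \<open>diff h (diff h u)\<close>, and the passage back to first
  differences requires an order below 1. The condition \<open>sp \<le> (p - 1) / p\<close> says that
  the limit \<open>sp p / (p - 1)\<close> is at most 1, so every order met in the iteration stays
  below 1. Origin of the new exponent: with \<open>\<delta> = q + 1 - p\<close> the Caccioppoli
  bound is of size \<open>|h|^(\<sigma> \<delta>)\<close>. Interpolation with weight
  \<open>l = q / (q + 2 - p)\<close> gives \<open>w\<close> the order \<open>\<theta>\<close>, where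
  \<open>\<theta> q = l sp p + (1 - l) \<sigma> q\<close>, together with the factor
  \<open>|h|^(\<sigma> \<delta> l)\<close>; the two powers of \<open>|h|\<close> add up to the new
  exponent times \<open>q\<close>. The two operators have different homogeneity. Therefore a single
  number \<open>M \<ge> 1\<close> dominates sup norm, tail and seminorm, and the contribution of the
  bounded \<open>Z\<close> is absorbed by \<open>M^(p - 1) \<ge> 1\<close>; this is the origin of
  the summand 1 in the estimate.\<close>

abbreviation leb2 :: "('a::euclidean_space \<times> 'a) measure"
  where "leb2 \<equiv> lebesgue \<Otimes>\<^sub>M lebesgue"

text \<open>Needed for Fubini on \<open>leb2\<close>. A countable cover for \<open>lborel\<close>
  serves again, because completion does not change the measure of Borel sets.\<close>

lemma sigma_finite_lebesgue: "sigma_finite_measure (lebesgue :: 'a::euclidean_space measure)"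
proof
  obtain A :: "'a set set" where A: "countable A" "A \<subseteq> sets lborel" "(\<Union>A) = space lborel"
      "\<forall>a\<in>A. emeasure lborel a \<noteq> \<infinity>"
    using lborel.sigma_finite_countable by blast
  have "\<forall>a\<in>A. emeasure (lebesgue :: 'a measure) a \<noteq> \<infinity>"
  proof
    fix a assume "a \<in> A"
    then have "a \<in> sets lborel" "emeasure lborel a \<noteq> \<infinity>" using A(2,4) by blast+
    then show "emeasure lebesgue a \<noteq> \<infinity>" by simp
  qed
  moreover have "A \<subseteq> sets lebesgue" "(\<Union>A) = space lebesgue"
    using A(2) by blast (simp only: A(3) space_completion)
  ultimately show "\<exists>A. countable A \<and> A \<subseteq> sets (lebesgue :: 'a measure) \<and>
      \<Union> A = space lebesgue \<and> (\<forall>a\<in>A. emeasure lebesgue a \<noteq> \<infinity>)"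
    using A(1) by blast
qed

interpretation leb: sigma_finite_measure "lebesgue :: 'a::euclidean_space measure"
  by (rule sigma_finite_lebesgue)

interpretation leb_pair: pair_sigma_finite
  "lebesgue :: 'a::euclidean_space measure" "lebesgue :: 'a measure" ..

lemma id_measurable_lebesgue_borel: "(\<lambda>x. x) \<in> borel_measurable lebesgue"
  using measurable_completion[OF measurable_ident_sets[OF sets_lborel]] by (simp add: id_def)

lemma fst_borel_measurable_leb2 [measurable]: "fst \<in> borel_measurable leb2"
  using measurable_compose[OF measurable_fst id_measurable_lebesgue_borel] .

lemma snd_borel_measurable_leb2 [measurable]: "snd \<in> borel_measurable leb2"
  using measurable_compose[OF measurable_snd id_measurable_lebesgue_borel] .

lemma translation_measurable_lebesgue [measurable]: "(\<lambda>x. x + h) \<in> lebesgue \<rightarrow>\<^sub>M lebesgue"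
  using lebesgue_affine_measurable[of "\<lambda>_. 1" h] by (simp add: euclidean_representation add.commute)

lemma fst_translation_measurable_leb2 [measurable]: "(\<lambda>z. fst z + h) \<in> leb2 \<rightarrow>\<^sub>M lebesgue"
  using measurable_compose[OF measurable_fst translation_measurable_lebesgue] .

lemma snd_translation_measurable_leb2 [measurable]: "(\<lambda>z. snd z + h) \<in> leb2 \<rightarrow>\<^sub>M lebesgue"
  using measurable_compose[OF measurable_snd translation_measurable_lebesgue] .

text \<open>The affine change of variables with every stretching factor equal to 1, so that the
  Jacobian density is 1.\<close>

lemma distr_translation_lebesgue:
  fixes h :: "'a::euclidean_space"
  shows "distr lebesgue lebesgue (\<lambda>x. x + h) = lebesgue"
proof -
  have "lebesgue = density (distr lebesgue lebesgue (\<lambda>x. h + (\<Sum>j\<in>Basis. (1 * (x \<bullet> j)) *\<^sub>R j)))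
      (\<lambda>_. ennreal (\<Prod>j\<in>(Basis::'a set). \<bar>1\<bar>))"
    by (rule lebesgue_affine_euclidean) simp
  then show ?thesis
    by (simp add: euclidean_representation add.commute density_1)
qed

lemma nn_integral_translation:
  fixes h :: "'a::euclidean_space"
  assumes f: "f \<in> borel_measurable lebesgue"
  shows "(\<integral>\<^sup>+x. f (x + h) \<partial>lebesgue) = (\<integral>\<^sup>+x. f x \<partial>lebesgue)"
  using nn_integral_distr[OF translation_measurable_lebesgue[of h], of f] f
  unfolding distr_translation_lebesgue by simp

lemma distr_translation_leb2:
  fixes h k :: "'a::euclidean_space"
  shows "distr leb2 leb2 (\<lambda>z. (fst z + h, snd z + k)) = leb2"
proof -
  have "distr lebesgue lebesgue (\<lambda>x. x + h) \<Otimes>\<^sub>M distr lebesgue lebesgue (\<lambda>x. x + k)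
      = distr leb2 leb2 (\<lambda>(x, y). (x + h, y + k))"
    by (rule pair_measure_distr)
      (auto simp: distr_translation_lebesgue leb.sigma_finite_measure_axioms)
  then show ?thesis
    by (simp add: distr_translation_lebesgue case_prod_unfold)
qed

lemma pair_translation_measurable_leb2 [measurable]:
  "(\<lambda>z. (fst z + h, snd z + k)) \<in> leb2 \<rightarrow>\<^sub>M leb2"
  by (intro measurable_Pair) auto

lemma nn_integral_leb2_translation:
  fixes h k :: "'a::euclidean_space"
  assumes f: "f \<in> borel_measurable leb2"
  shows "(\<integral>\<^sup>+z. f (fst z + h, snd z + k) \<partial>leb2) = (\<integral>\<^sup>+z. f z \<partial>leb2)"
  using nn_integral_distr[OF pair_translation_measurable_leb2[of h k], of f] f
  unfolding distr_translation_leb2 by simp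

lemma integrable_leb2_translation:
  fixes h k :: "'a::euclidean_space" and f :: "_ \<Rightarrow> real"
  assumes f: "integrable leb2 f"
  shows "integrable leb2 (\<lambda>z. f (fst z + h, snd z + k))"
  by (rule integrable_distr[OF pair_translation_measurable_leb2])
    (unfold distr_translation_leb2, rule f)

lemma integral_leb2_translation:
  fixes h k :: "'a::euclidean_space" and f :: "_ \<Rightarrow> real"
  assumes f: "f \<in> borel_measurable leb2"
  shows "(\<integral>z. f (fst z + h, snd z + k) \<partial>leb2) = (\<integral>z. f z \<partial>leb2)"
  using integral_distr[OF pair_translation_measurable_leb2[of h k] f]
  unfolding distr_translation_leb2 by simp

lemma AE_translation:
  fixes h :: "'a::euclidean_space"
  assumes "AE x in lebesgue. P x"
  shows "AE x in lebesgue. P (x + h)"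
  by (rule AE_distrD[OF translation_measurable_lebesgue])
    (unfold distr_translation_lebesgue, rule assms)

lemma AE_leb2_translation:
  fixes h k :: "'a::euclidean_space"
  assumes "AE z in leb2. P z"
  shows "AE z in leb2. P (fst z + h, snd z + k)"
  by (rule AE_distrD[OF pair_translation_measurable_leb2])
    (unfold distr_translation_leb2, rule assms)

text \<open>A null set times the whole space is null because \<open>0 * \<infinity> = 0\<close>.
  This carries pointwise bounds on \<open>u\<close> over to pairs.\<close>

lemma AE_leb2_fst:
  assumes "AE x in (lebesgue :: 'a::euclidean_space measure). P x"
  shows "AE z in (leb2 :: ('a \<times> 'a) measure). P (fst z)"
proof -
  obtain S where N: "S \<in> null_sets lebesgue" and S: "\<And>x. \<not> P x \<Longrightarrow> x \<in> S"
    using AE_E3[OF assms] by (metis DiffI UNIV_I space_completion space_lborel space_borel)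
  have "emeasure (leb2 :: ('a \<times> 'a) measure) (S \<times> UNIV) = 0"
    by (subst leb.emeasure_pair_measure_Times) (use N in \<open>auto dest: null_setsD1\<close>)
  moreover have "S \<times> UNIV \<in> sets (leb2 :: ('a \<times> 'a) measure)"
    by (rule pair_measureI) (use N in auto)
  ultimately have "S \<times> UNIV \<in> null_sets (leb2 :: ('a \<times> 'a) measure)" by blast
  then show ?thesis
    by (rule AE_I') (use S in \<open>auto simp: space_pair_measure\<close>)
qed

lemma AE_leb2_snd:
  assumes "AE x in (lebesgue :: 'a::euclidean_space measure). P x"
  shows "AE z in (leb2 :: ('a \<times> 'a) measure). P (snd z)"
proof -
  obtain S where N: "S \<in> null_sets lebesgue" and S: "\<And>x. \<not> P x \<Longrightarrow> x \<in> S"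
    using AE_E3[OF assms] by (metis DiffI UNIV_I space_completion space_lborel space_borel)
  have "emeasure (leb2 :: ('a \<times> 'a) measure) (UNIV \<times> S) = 0"
    by (subst leb.emeasure_pair_measure_Times) (use N in \<open>auto dest: null_setsD1\<close>)
  moreover have "UNIV \<times> S \<in> sets (leb2 :: ('a \<times> 'a) measure)"
    by (rule pair_measureI) (use N in auto)
  ultimately have "UNIV \<times> S \<in> null_sets (leb2 :: ('a \<times> 'a) measure)" by blast
  then show ?thesis
    by (rule AE_I') (use S in \<open>auto simp: space_pair_measure\<close>)
qed

lemma pred_in_ball [measurable (raw)]:
  fixes c :: "'b::euclidean_space"
  shows
  "f \<in> borel_measurable M \<Longrightarrow> Measurable.pred M (\<lambda>x. f x \<in> ball c r)"
  unfolding mem_ball by measurable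

section \<open>Integrals of singular kernels\<close>

lemma emeasure_lebesgue_ball:
  fixes c :: "'a::euclidean_space"
  assumes "0 \<le> r"
  shows "emeasure lebesgue (ball c r) = ennreal (unit_ball_vol (real DIM('a)) * r powr real DIM('a))"
  using assms by (cases "r = 0") (auto simp: emeasure_ball powr_realpow)

lemma ball_in_lebesgue [measurable, simp]: "ball c r \<in> sets lebesgue" "ball c r \<in> sets borel"
  by auto

lemma ennreal_le_suminf: "(f :: nat \<Rightarrow> ennreal) k \<le> suminf f"
  using sum_le_suminf[of f "{k}"] by simp

text \<open>Dyadic balls replace polar coordinates: on the shell between the radii
  \<open>\<rho> k / 2\<close> and \<open>\<rho> k\<close> the kernel is at most \<open>c k\<close>,
  so it lies below a series of multiples of ball indicators, whose integrals form a geometric series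
  of ratio \<open>2^(\<beta> - N) < 1\<close>.\<close>

lemma near_kernel_bound_aux:
  fixes \<beta> :: real
  assumes "\<beta> < real DIM('a)"
  shows "(\<integral>\<^sup>+ h. indicator (ball 0 2) (h :: 'a::euclidean_space) * ennreal (1 / norm h powr \<beta>) \<partial>lebesgue) < \<infinity>"
proof -
  define N where "N = real DIM('a)"
  define \<rho> where "\<rho> k = (2::real) / 2 ^ k" for k :: nat
  define c where "c k = 2 powr \<bar>\<beta>\<bar> / \<rho> k powr \<beta>" for k
  define V where "V = unit_ball_vol N"
  have \<rho>: "\<rho> k > 0" for k by (simp add: \<rho>_def)
  have le: "indicator (ball 0 2) h * ennreal (1 / norm h powr \<beta>)
      \<le> (\<Sum>k. ennreal (c k) * indicator (ball 0 (\<rho> k)) h)" for h :: 'a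
  proof (cases "h \<in> ball 0 2 \<and> h \<noteq> 0")
    case True
    then have h: "0 < norm h" "norm h < 2" by auto
    obtain n where n: "\<rho> n \<le> norm h"
    proof -
      obtain n where "2 / norm h < 2 ^ n" using real_arch_pow[of 2 "2 / norm h"] by auto
      then have "\<rho> n < norm h" using h by (simp add: \<rho>_def field_simps)
      then show ?thesis using that less_imp_le by blast
    qed
    \<comment> \<open>The first radius not exceeding \<open>norm h\<close>. It is not
      \<open>\<rho> 0 = 2\<close>, and its predecessor \<open>k\<close> labels the shell of
      \<open>h\<close>.\<close>
    define m where "m = (LEAST n. \<rho> n \<le> norm h)"
    have m: "\<rho> m \<le> norm h" unfolding m_def by (rule LeastI[of _ n]) (rule n)
    have "m \<noteq> 0" using m h by (auto simp: \<rho>_def intro: ccontr)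
    then obtain k where k: "m = Suc k" by (cases m) auto
    have "\<not> \<rho> k \<le> norm h" using not_less_Least[of k "\<lambda>n. \<rho> n \<le> norm h"] k m_def by auto
    then have k1: "norm h < \<rho> k" by simp
    have k2: "\<rho> k / 2 \<le> norm h" using m by (simp add: k \<rho>_def)
    define t where "t = norm h / \<rho> k"
    have t: "1/2 \<le> t" "t < 1" using k1 k2 \<rho>[of k] by (auto simp: t_def field_simps)
    have eq1: "1 / norm h powr \<beta> = (1 / t powr \<beta>) / \<rho> k powr \<beta>"
      using \<rho>[of k] by (simp add: t_def powr_divide)
    \<comment> \<open>The absolute value covers both signs of \<open>\<beta>\<close>: exponents such
      as \<open>\<beta> - q\<close>, to which the bound is applied later, can be negative.\<close>
    have le1: "1 / t powr \<beta> \<le> 2 powr \<bar>\<beta>\<bar>"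
    proof -
      have "1 / t powr \<beta> = (1 / t) powr \<beta>" by (simp add: powr_divide)
      also have "\<dots> \<le> (1 / t) powr \<bar>\<beta>\<bar>" using t by (intro powr_mono) auto
      also have "\<dots> \<le> 2 powr \<bar>\<beta>\<bar>" using t by (intro powr_mono2) (auto simp: field_simps)
      finally show ?thesis .
    qed
    have "1 / norm h powr \<beta> \<le> c k"
      unfolding c_def eq1 by (rule divide_right_mono[OF le1]) simp
    then have "indicator (ball 0 2) h * ennreal (1 / norm h powr \<beta>)
        \<le> ennreal (c k) * indicator (ball 0 (\<rho> k)) h"
      using True k1 by (simp add: ennreal_leI)
    also have "\<dots> \<le> (\<Sum>k. ennreal (c k) * indicator (ball 0 (\<rho> k)) h)"
      by (rule ennreal_le_suminf)
    finally show ?thesis .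
  qed auto
  have ck: "c k * (V * \<rho> k powr N) = (2 powr \<bar>\<beta>\<bar> * V * 2 powr (N - \<beta>)) * ((1 / 2) powr (N - \<beta>)) ^ k" for k
  proof -
    have "c k * (V * \<rho> k powr N) = 2 powr \<bar>\<beta>\<bar> * V * \<rho> k powr (N - \<beta>)"
      by (simp add: c_def powr_diff)
    also have "\<rho> k powr (N - \<beta>) = 2 powr (N - \<beta>) * ((1 / 2) powr (N - \<beta>)) ^ k"
    proof -
      have "(2 ^ k) powr (N - \<beta>) = (2 powr (N - \<beta>)) ^ k"
        using powr_powr_swap[of 2 "real k" "N - \<beta>"] by (simp add: powr_realpow)
      then show ?thesis by (simp add: \<rho>_def powr_divide power_divide)
    qed
    finally show ?thesis by simp
  qed
  have "(\<integral>\<^sup>+ h. indicator (ball 0 2) (h :: 'a) * ennreal (1 / norm h powr \<beta>) \<partial>lebesgue)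
      \<le> (\<integral>\<^sup>+ h. (\<Sum>k. ennreal (c k) * indicator (ball 0 (\<rho> k)) (h :: 'a)) \<partial>lebesgue)"
    by (rule nn_integral_mono) (rule le)
  also have "\<dots> = (\<Sum>k. ennreal (c k) * emeasure lebesgue (ball (0 :: 'a) (\<rho> k)))"
    by (subst nn_integral_suminf) (auto simp: nn_integral_cmult nn_integral_indicator simp del: emeasure_completion)
  also have "\<dots> = (\<Sum>k. ennreal (c k * (V * \<rho> k powr N)))"
    using \<rho> by (intro suminf_cong)
      (simp add: emeasure_lebesgue_ball less_imp_le N_def V_def c_def del: emeasure_completion flip: ennreal_mult)
  also have "\<dots> = (\<Sum>k. ennreal ((2 powr \<bar>\<beta>\<bar> * V * 2 powr (N - \<beta>)) * ((1 / 2) powr (N - \<beta>)) ^ k))"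
    unfolding ck ..
  also have "\<dots> < \<infinity>"
  proof -
    have "(1 / 2) powr (N - \<beta>) < (1 :: real)"
      using powr_less_mono'[of "1/2" 0 "N - \<beta>"] assms by (simp add: N_def)
    then have "summable (\<lambda>k. (2 powr \<bar>\<beta>\<bar> * V * 2 powr (N - \<beta>)) * ((1 / 2) powr (N - \<beta>)) ^ k)"
      by (intro summable_mult summable_geometric) auto
    then show ?thesis
      by (subst suminf_ennreal2) (auto simp: V_def N_def)
  qed
  finally show ?thesis .
qed

text \<open>The same comparison with growing balls of radius \<open>2^k\<close>: each shell is
  bounded by the kernel at its inner radius, and the ratio is now
  \<open>2^(N - \<beta>)\<close>.\<close>

lemma far_kernel_bound_aux:
  fixes \<beta> :: real
  assumes "real DIM('a) < \<beta>"
  shows "(\<integral>\<^sup>+ h. indicator {h. 1 \<le> norm h} (h :: 'a::euclidean_space) * ennreal (1 / norm h powr \<beta>) \<partial>lebesgue) < \<infinity>"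
proof -
  define N where "N = real DIM('a)"
  define \<rho> where "\<rho> k = (2::real) ^ k" for k :: nat
  define V where "V = unit_ball_vol N"
  have \<rho>: "\<rho> k > 0" for k by (simp add: \<rho>_def)
  have le: "indicator {h. 1 \<le> norm h} h * ennreal (1 / norm h powr \<beta>)
      \<le> (\<Sum>k. ennreal (1 / \<rho> k powr \<beta>) * indicator (ball 0 (\<rho> (Suc k))) h)" for h :: 'a
  proof (cases "1 \<le> norm h")
    case True
    obtain n where n: "norm h < \<rho> n"
      using real_arch_pow[of 2 "norm h"] by (auto simp: \<rho>_def)
    define m where "m = (LEAST n. norm h < \<rho> n)"
    have m: "norm h < \<rho> m" unfolding m_def by (rule LeastI[of _ n]) (rule n)
    have "m \<noteq> 0" using m True by (auto simp: \<rho>_def intro: ccontr)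
    then obtain k where k: "m = Suc k" by (cases m) auto
    have "\<not> norm h < \<rho> k" using not_less_Least[of k "\<lambda>n. norm h < \<rho> n"] k m_def by auto
    then have "1 / norm h powr \<beta> \<le> 1 / \<rho> k powr \<beta>"
      using \<rho>[of k] assms by (intro divide_left_mono powr_mono2 mult_pos_pos) auto
    then have "indicator {h. 1 \<le> norm h} h * ennreal (1 / norm h powr \<beta>)
        \<le> ennreal (1 / \<rho> k powr \<beta>) * indicator (ball 0 (\<rho> (Suc k))) h"
      using True m k by (simp add: ennreal_leI)
    also have "\<dots> \<le> (\<Sum>k. ennreal (1 / \<rho> k powr \<beta>) * indicator (ball 0 (\<rho> (Suc k))) h)"
      by (rule ennreal_le_suminf)
    finally show ?thesis .
  qed auto
  have ck: "1 / \<rho> k powr \<beta> * (V * \<rho> (Suc k) powr N) = (V * 2 powr N) * ((1 / 2) powr (\<beta> - N)) ^ k" for k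
  proof -
    have "1 / \<rho> k powr \<beta> * (V * \<rho> (Suc k) powr N) = V * 2 powr N * \<rho> k powr (N - \<beta>)"
      by (simp add: powr_diff \<rho>_def powr_mult)
    also have "\<rho> k powr (N - \<beta>) = ((1 / 2) powr (\<beta> - N)) ^ k"
    proof -
      have "(1 / 2) powr (\<beta> - N) = 2 powr (N - \<beta>)" by (simp add: powr_divide powr_diff)
      moreover have "(2 ^ k) powr (N - \<beta>) = (2 powr (N - \<beta>)) ^ k"
        using powr_powr_swap[of 2 "real k" "N - \<beta>"] by (simp add: powr_realpow)
      ultimately show ?thesis by (simp add: \<rho>_def)
    qed
    finally show ?thesis by simp
  qed
  have "(\<integral>\<^sup>+ h. indicator {h. 1 \<le> norm h} (h :: 'a) * ennreal (1 / norm h powr \<beta>) \<partial>lebesgue)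
      \<le> (\<integral>\<^sup>+ h. (\<Sum>k. ennreal (1 / \<rho> k powr \<beta>) * indicator (ball 0 (\<rho> (Suc k))) (h :: 'a)) \<partial>lebesgue)"
    by (rule nn_integral_mono) (rule le)
  also have "\<dots> = (\<Sum>k. ennreal (1 / \<rho> k powr \<beta>) * emeasure lebesgue (ball (0 :: 'a) (\<rho> (Suc k))))"
    by (subst nn_integral_suminf) (auto simp: nn_integral_cmult nn_integral_indicator simp del: emeasure_completion)
  also have "\<dots> = (\<Sum>k. ennreal (1 / \<rho> k powr \<beta> * (V * \<rho> (Suc k) powr N)))"
  proof (intro suminf_cong)
    fix k
    show "ennreal (1 / \<rho> k powr \<beta>) * emeasure lebesgue (ball (0 :: 'a) (\<rho> (Suc k)))
      = ennreal (1 / \<rho> k powr \<beta> * (V * \<rho> (Suc k) powr N))"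
    proof -
      have "emeasure lebesgue (ball (0 :: 'a) (\<rho> (Suc k))) = ennreal (V * \<rho> (Suc k) powr N)"
        using emeasure_lebesgue_ball[of "\<rho> (Suc k)" "0 :: 'a"] \<rho>[of "Suc k"]
        unfolding N_def V_def by (simp del: emeasure_completion)
      then show ?thesis
        by (simp only:) (rule ennreal_mult[symmetric], auto simp: V_def N_def)
    qed
  qed
  also have "\<dots> = (\<Sum>k. ennreal ((V * 2 powr N) * ((1 / 2) powr (\<beta> - N)) ^ k))"
    unfolding ck ..
  also have "\<dots> < \<infinity>"
  proof -
    have "(1 / 2) powr (\<beta> - N) < (1 :: real)"
      using powr_less_mono'[of "1/2" 0 "\<beta> - N"] assms by (simp add: N_def)
    then have "summable (\<lambda>k. (V * 2 powr N) * ((1 / 2) powr (\<beta> - N)) ^ k)"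
      by (intro summable_mult summable_geometric) auto
    then show ?thesis
      by (subst suminf_ennreal2) (auto simp: V_def N_def)
  qed
  finally show ?thesis .
qed

lemma nn_integral_kernel_shift:
  fixes x :: "'a::euclidean_space" and k :: "'a \<Rightarrow> ennreal"
  assumes k: "k \<in> borel_measurable borel"
  shows "(\<integral>\<^sup>+ y. k (y - x) \<partial>lebesgue) = (\<integral>\<^sup>+ h. k h \<partial>lebesgue)"
proof -
  have "k \<in> borel_measurable lebesgue" using k by (simp add: measurable_completion)
  from nn_integral_translation[OF this, of "- x"] show ?thesis by simp
qed

text \<open>Radius 2 suffices because two points of a ball of radius at most 1 have distance below
  2. \<open>enn2real\<close> returns the true value when \<open>\<beta>\<close> is below the
  dimension.\<close>

definition near_const :: "'a::euclidean_space itself \<Rightarrow> real \<Rightarrow> real"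
  where "near_const T \<beta> = enn2real (\<integral>\<^sup>+ h. indicator (ball 0 2) (h :: 'a) * ennreal (1 / norm h powr \<beta>) \<partial>lebesgue)"

text \<open>The volume accounts for the region \<open>d \<le> norm h < 1\<close>, where the kernel
  is at most \<open>1 / d powr \<beta>\<close>; thus one constant serves every
  \<open>d \<le> 1\<close>.\<close>

definition far_const :: "'a::euclidean_space itself \<Rightarrow> real \<Rightarrow> real"
  where "far_const T \<beta> = unit_ball_vol (real DIM('a))
    + enn2real (\<integral>\<^sup>+ h. indicator {h. 1 \<le> norm h} (h :: 'a) * ennreal (1 / norm h powr \<beta>) \<partial>lebesgue)"

lemma near_const_nonneg [simp]: "0 \<le> near_const T \<beta>"
  by (simp add: near_const_def)

lemma far_const_nonneg [simp]: "0 \<le> far_const T \<beta>"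
  by (simp add: far_const_def)

lemma near_kernel_bound:
  fixes x :: "'a::euclidean_space"
  assumes "\<beta> < real DIM('a)"
  shows "(\<integral>\<^sup>+ y. indicator (ball x 2) y * ennreal (1 / norm (x - y) powr \<beta>) \<partial>lebesgue) \<le> ennreal (near_const TYPE('a) \<beta>)"
proof -
  have "(\<integral>\<^sup>+ y. indicator (ball x 2) y * ennreal (1 / norm (x - y) powr \<beta>) \<partial>lebesgue)
      = (\<integral>\<^sup>+ y. indicator (ball 0 2) (y - x) * ennreal (1 / norm (y - x) powr \<beta>) \<partial>lebesgue)"
    by (intro nn_integral_cong) (simp add: indicator_def dist_norm norm_minus_commute)
  also have "\<dots> = (\<integral>\<^sup>+ h. indicator (ball 0 2) (h :: 'a) * ennreal (1 / norm h powr \<beta>) \<partial>lebesgue)"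
    by (rule nn_integral_kernel_shift) measurable
  also have "\<dots> = ennreal (near_const TYPE('a) \<beta>)"
    using near_kernel_bound_aux[OF assms] by (simp add: near_const_def ennreal_enn2real)
  finally show ?thesis by simp
qed

lemma far_kernel_bound:
  fixes x :: "'a::euclidean_space"
  assumes "real DIM('a) < \<beta>" and d: "0 < d" "d \<le> 1"
  shows "(\<integral>\<^sup>+ y. indicator (- ball x d) y * ennreal (1 / norm (x - y) powr \<beta>) \<partial>lebesgue)
    \<le> ennreal (far_const TYPE('a) \<beta> / d powr \<beta>)"
proof -
  define V where "V = unit_ball_vol (real DIM('a))"
  have V: "V \<ge> 0" by (simp add: V_def)
  define C where "C = enn2real (\<integral>\<^sup>+ h. indicator {h. 1 \<le> norm h} (h :: 'a) * ennreal (1 / norm h powr \<beta>) \<partial>lebesgue)"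
  have C: "0 \<le> C" "(\<integral>\<^sup>+ h. indicator {h. 1 \<le> norm h} (h :: 'a) * ennreal (1 / norm h powr \<beta>) \<partial>lebesgue) = ennreal C"
    using far_kernel_bound_aux[OF assms(1)] by (simp_all add: C_def ennreal_enn2real)
  have \<beta>: "\<beta> > 0" using assms(1) by (rule order.strict_trans1[rotated]) simp
  have d1: "1 \<le> 1 / d powr \<beta>" using d \<beta> powr_le1[of \<beta> d] by (simp add: field_simps)
  have "(\<integral>\<^sup>+ y. indicator (- ball x d) y * ennreal (1 / norm (x - y) powr \<beta>) \<partial>lebesgue)
      = (\<integral>\<^sup>+ y. indicator (- ball 0 d) (y - x) * ennreal (1 / norm (y - x) powr \<beta>) \<partial>lebesgue)"
    by (intro nn_integral_cong) (simp add: indicator_def dist_norm norm_minus_commute)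
  also have "\<dots> = (\<integral>\<^sup>+ h. indicator (- ball 0 d) (h :: 'a) * ennreal (1 / norm h powr \<beta>) \<partial>lebesgue)"
    by (rule nn_integral_kernel_shift) measurable
  also have "\<dots> \<le> (\<integral>\<^sup>+ h. ennreal (1 / d powr \<beta>) * indicator (ball 0 1) (h :: 'a)
      + indicator {h. 1 \<le> norm h} (h :: 'a) * ennreal (1 / norm h powr \<beta>) \<partial>lebesgue)"
  proof (rule nn_integral_mono)
    fix h :: 'a
    have "1 / norm h powr \<beta> \<le> 1 / d powr \<beta>" if "d \<le> norm h"
      using that d \<beta> by (intro divide_left_mono powr_mono2 mult_pos_pos) auto
    then show "indicator (- ball 0 d) (h :: 'a) * ennreal (1 / norm h powr \<beta>)
       \<le> ennreal (1 / d powr \<beta>) * indicator (ball 0 1) (h :: 'a)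
          + indicator {h. 1 \<le> norm h} (h :: 'a) * ennreal (1 / norm h powr \<beta>)"
      by (auto simp: indicator_def ennreal_leI)
  qed
  also have "\<dots> = ennreal (1 / d powr \<beta>) * ennreal V + ennreal C"
  proof -
    have "(\<lambda>h :: 'a. indicator {h. 1 \<le> norm h} h * ennreal (1 / norm h powr \<beta>)) \<in> borel_measurable lebesgue"
      by (rule measurable_completion) measurable
    then show ?thesis
      using emeasure_lebesgue_ball[of 1 "0 :: 'a"]
      by (subst nn_integral_add) (auto simp: C(2) V_def nn_integral_cmult nn_integral_indicator
          simp del: emeasure_completion)
  qed
  also have "\<dots> = ennreal (V / d powr \<beta> + C)"
    using V C(1) by (simp add: ennreal_mult[symmetric] ennreal_plus[symmetric] del: ennreal_plus)
  also have "\<dots> \<le> ennreal ((V + C) / d powr \<beta>)"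
    using mult_left_mono[OF d1 C(1)] by (intro ennreal_leI) (simp add: add_divide_distrib)
  finally show ?thesis by (simp add: far_const_def V_def C_def)
qed

section \<open>Gagliardo seminorms and differences\<close>

definition diff :: "'a::euclidean_space \<Rightarrow> ('a \<Rightarrow> real) \<Rightarrow> 'a \<Rightarrow> real"
  where "diff h w x = w (x + h) - w x"

definition pow_int :: "real \<Rightarrow> 'a::euclidean_space set \<Rightarrow> ('a \<Rightarrow> real) \<Rightarrow> ennreal"
  where "pow_int q U w = (\<integral>\<^sup>+x. indicator U x * ennreal (\<bar>w x\<bar> powr q) \<partial>lebesgue)"

lemma diff_measurable [measurable]:
  assumes [measurable]: "w \<in> borel_measurable lebesgue"
  shows "diff h w \<in> borel_measurable lebesgue"
  unfolding diff_def[abs_def] by measurable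

lemma powr_add_le:
  fixes a b q :: real
  assumes "0 \<le> a" "0 \<le> b" "0 \<le> q"
  shows "(a + b) powr q \<le> 2 powr q * (a powr q + b powr q)"
proof -
  have "(a + b) powr q \<le> (2 * max a b) powr q"
    using assms by (intro powr_mono2) auto
  also have "\<dots> = 2 powr q * max a b powr q" by (simp add: powr_mult)
  also have "\<dots> \<le> 2 powr q * (a powr q + b powr q)"
    by (intro mult_left_mono) (auto simp: max_def)
  finally show ?thesis .
qed

lemma gagliardo_int_alt:
  fixes w :: "'a::euclidean_space \<Rightarrow> real"
  shows "gagliardo_int \<gamma> q U w = (\<integral>\<^sup>+ z. indicator U (fst z) * indicator U (snd z) *
      ennreal (\<bar>w (fst z) - w (snd z)\<bar> powr q / norm (fst z - snd z) powr (real DIM('a) + \<gamma> * q)) \<partial>leb2)"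
  unfolding gagliardo_int_def by (intro nn_integral_cong) (auto simp: indicator_def split: prod.splits)

lemma gagliardo_integrand_measurable [measurable]:
  fixes w :: "'a::euclidean_space \<Rightarrow> real"
  assumes [measurable]: "w \<in> borel_measurable lebesgue"
  shows "(\<lambda>z. indicator (ball c r) (fst z) * indicator (ball c r) (snd z) *
      ennreal (\<bar>w (fst z) - w (snd z)\<bar> powr q / norm (fst z - snd z) powr \<beta>)) \<in> borel_measurable leb2"
  by measurable

lemma ennreal_le_of_cmult_le:
  fixes P X :: ennreal
  assumes "0 < c" "0 \<le> a" "ennreal c * P \<le> ennreal a * X"
  shows "P \<le> ennreal (a / c) * X"
proof -
  have "P = ennreal (1 / c) * (ennreal c * P)"
    using assms(1) by (simp add: mult.assoc[symmetric] ennreal_mult[symmetric] less_imp_le)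
  also have "\<dots> \<le> ennreal (1 / c) * (ennreal a * X)"
    by (rule mult_left_mono[OF assms(3)]) simp
  also have "\<dots> = ennreal (a / c) * X"
    using assms by (simp add: mult.assoc[symmetric] ennreal_mult[symmetric])
  finally show ?thesis .
qed

text \<open>Origin of the factors: \<open>2 powr q\<close> from a power of a sum of two terms,
  \<open>2^(N + \<sigma> q)\<close> from distances up to \<open>2 * norm h\<close>, one more 2 for
  the two pairs of points, and the volume from averaging over a ball of radius
  \<open>norm h\<close>.\<close>

definition nik_const :: "'a::euclidean_space itself \<Rightarrow> real \<Rightarrow> real \<Rightarrow> real"
  where "nik_const T \<sigma> q = 2 powr (q + real DIM('a) + \<sigma> * q + 1) / unit_ball_vol (real DIM('a))"

lemma nik_const_nonneg [simp]: "0 \<le> nik_const T \<sigma> q"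
  by (simp add: nik_const_def)

text \<open>Average over auxiliary points \<open>y\<close> within \<open>norm h\<close> of
  \<open>x\<close>: the increment from \<open>x\<close> to \<open>x + h\<close> passes through
  \<open>y\<close>, both resulting pairs have distance at most \<open>2 * norm h\<close>, and there
  the kernel of the seminorm is bounded below.\<close>

lemma pow_int_diff_le_gagliardo:
  fixes w :: "'a::euclidean_space \<Rightarrow> real"
  assumes w [measurable]: "w \<in> borel_measurable lebesgue"
    and q: "0 \<le> q" and \<beta>0: "0 \<le> real DIM('a) + \<sigma> * q"
    and h: "h \<noteq> 0" and sub: "\<rho> + 2 * norm h \<le> \<rho>'"
  shows "pow_int q (ball x0 \<rho>) (diff h w)
    \<le> ennreal (nik_const TYPE('a) \<sigma> q * norm h powr (\<sigma> * q)) * gagliardo_int \<sigma> q (ball x0 \<rho>') w"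
proof -
  define N where "N = real DIM('a)"
  define \<beta> where "\<beta> = N + \<sigma> * q"
  define V where "V = unit_ball_vol N"
  define B' where "B' = ball x0 \<rho>'"
  define g where "g z = indicator B' (fst z) * indicator B' (snd z) *
      ennreal (\<bar>w (fst z) - w (snd z)\<bar> powr q / norm (fst z - snd z) powr \<beta>)" for z
  define K where "K = 2 powr q * (2 * norm h) powr \<beta>"
  \<comment> \<open>Integrating out the second point multiplies the increment by the volume of a
    ball of radius \<open>norm h\<close>; this is the averaging.\<close>
  define f where "f z = indicator (ball x0 \<rho>) (fst z) * indicator {z. dist (fst z) (snd z) < norm h} z
      * ennreal (\<bar>diff h w (fst z)\<bar> powr q)" for z
  have V: "V > 0" by (simp add: V_def N_def)
  have gm [measurable]: "g \<in> borel_measurable leb2" unfolding g_def[abs_def] B'_def by measurable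
  have fm [measurable]: "f \<in> borel_measurable leb2" unfolding f_def[abs_def] by measurable
  have G: "gagliardo_int \<sigma> q (ball x0 \<rho>') w = (\<integral>\<^sup>+z. g z \<partial>leb2)"
    unfolding gagliardo_int_alt g_def B'_def \<beta>_def N_def ..
  have near: "\<bar>w a - w b\<bar> powr q \<le> (2 * norm h) powr \<beta> * (\<bar>w a - w b\<bar> powr q / norm (a - b) powr \<beta>)"
    if "norm (a - b) \<le> 2 * norm h" for a b
  proof (cases "a = b")
    case False
    have "norm (a - b) powr \<beta> \<le> (2 * norm h) powr \<beta>"
      using that \<beta>0 by (intro powr_mono2) (auto simp: \<beta>_def N_def)
    from mult_left_mono[OF this, of "\<bar>w a - w b\<bar> powr q"]
    show ?thesis using False by (simp add: divide_simps mult.commute)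
  qed auto
  \<comment> \<open>The first summand is \<open>g\<close> at a translated pair, hence has the same
    integral as the second.\<close>
  have le: "f z \<le> ennreal K * (g (fst z + h, snd z + 0) + g z)" for z
  proof (cases "fst z \<in> ball x0 \<rho> \<and> dist (fst z) (snd z) < norm h")
    case True
    obtain x y where z: "z = (x, y)" by force
    have x: "dist x0 x < \<rho>" and y: "dist x y < norm h" using True z by auto
    have "dist x0 (x + h) \<le> dist x0 x + norm h"
      using dist_triangle[of x0 "x + h" x] by (simp add: dist_norm)
    moreover have "dist x0 y \<le> dist x0 x + dist x y" by (rule dist_triangle)
    ultimately have "x \<in> B'" "x + h \<in> B'" "y \<in> B'"
      unfolding B'_def mem_ball using x y sub norm_ge_zero[of h] by linarith+
    have n1: "norm (x - y) \<le> 2 * norm h" using y norm_ge_zero[of h] unfolding dist_norm by linarith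
    have n2: "norm (x + h - y) \<le> 2 * norm h"
      using y norm_triangle_ineq[of "x - y" h] by (simp add: dist_norm algebra_simps)
    have "\<bar>diff h w x\<bar> powr q \<le> (\<bar>w (x + h) - w y\<bar> + \<bar>w x - w y\<bar>) powr q"
      using q by (intro powr_mono2) (auto simp: diff_def)
    also have "\<dots> \<le> 2 powr q * (\<bar>w (x + h) - w y\<bar> powr q + \<bar>w x - w y\<bar> powr q)"
      using q by (intro powr_add_le) auto
    also have "\<dots> \<le> 2 powr q * ((2 * norm h) powr \<beta> * (\<bar>w (x + h) - w y\<bar> powr q / norm (x + h - y) powr \<beta>)
        + (2 * norm h) powr \<beta> * (\<bar>w x - w y\<bar> powr q / norm (x - y) powr \<beta>))"
      by (intro mult_left_mono add_mono near n1 n2) auto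
    also have "\<dots> = K * (\<bar>w (x + h) - w y\<bar> powr q / norm (x + h - y) powr \<beta>
        + \<bar>w x - w y\<bar> powr q / norm (x - y) powr \<beta>)"
      by (simp add: K_def algebra_simps)
    finally have "ennreal (\<bar>diff h w x\<bar> powr q) \<le> ennreal (K * (\<bar>w (x + h) - w y\<bar> powr q / norm (x + h - y) powr \<beta>
        + \<bar>w x - w y\<bar> powr q / norm (x - y) powr \<beta>))" by (rule ennreal_leI)
    also have "\<dots> = ennreal K * (ennreal (\<bar>w (x + h) - w y\<bar> powr q / norm (x + h - y) powr \<beta>)
        + ennreal (\<bar>w x - w y\<bar> powr q / norm (x - y) powr \<beta>))"
      by (subst ennreal_mult) (auto simp: K_def)
    finally show ?thesis
      using True \<open>x \<in> B'\<close> \<open>x + h \<in> B'\<close> \<open>y \<in> B'\<close> by (simp add: f_def g_def z)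
  qed (auto simp: f_def)
  have "(\<integral>\<^sup>+z. f z \<partial>leb2) = (\<integral>\<^sup>+x. \<integral>\<^sup>+y. f (x, y) \<partial>lebesgue \<partial>lebesgue)"
    by (rule leb.nn_integral_fst[symmetric]) (rule fm)
  also have "\<dots> = (\<integral>\<^sup>+x. ennreal (V * norm h powr N) * (indicator (ball x0 \<rho>) x * ennreal (\<bar>diff h w x\<bar> powr q)) \<partial>lebesgue)"
  proof (intro nn_integral_cong)
    fix x
    have "(\<integral>\<^sup>+y. f (x, y) \<partial>lebesgue)
        = (\<integral>\<^sup>+y. (indicator (ball x0 \<rho>) x * ennreal (\<bar>diff h w x\<bar> powr q)) * indicator (ball x (norm h)) y \<partial>lebesgue)"
      by (intro nn_integral_cong) (auto simp: f_def indicator_def)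
    also have "\<dots> = (indicator (ball x0 \<rho>) x * ennreal (\<bar>diff h w x\<bar> powr q)) * emeasure lebesgue (ball x (norm h))"
      by (rule nn_integral_cmult_indicator) simp
    also have "emeasure lebesgue (ball x (norm h)) = ennreal (V * norm h powr N)"
      unfolding V_def N_def by (rule emeasure_lebesgue_ball) simp
    finally show "(\<integral>\<^sup>+y. f (x, y) \<partial>lebesgue)
      = ennreal (V * norm h powr N) * (indicator (ball x0 \<rho>) x * ennreal (\<bar>diff h w x\<bar> powr q))"
      by (simp add: mult.commute)
  qed
  also have "\<dots> = ennreal (V * norm h powr N) * pow_int q (ball x0 \<rho>) (diff h w)"
    unfolding pow_int_def by (rule nn_integral_cmult) measurable
  finally have 1: "(\<integral>\<^sup>+z. f z \<partial>leb2) = ennreal (V * norm h powr N) * pow_int q (ball x0 \<rho>) (diff h w)" .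
  have "(\<integral>\<^sup>+z. f z \<partial>leb2) \<le> (\<integral>\<^sup>+z. ennreal K * (g (fst z + h, snd z + 0) + g z) \<partial>leb2)"
    by (rule nn_integral_mono) (rule le)
  also have "\<dots> = ennreal K * ((\<integral>\<^sup>+z. g (fst z + h, snd z + 0) \<partial>leb2) + (\<integral>\<^sup>+z. g z \<partial>leb2))"
  proof -
    have [measurable]: "(\<lambda>z. g (fst z + h, snd z + 0)) \<in> borel_measurable leb2"
      using measurable_compose[OF pair_translation_measurable_leb2 gm] .
    show ?thesis by (subst nn_integral_cmult, measurable, subst nn_integral_add, measurable)
  qed
  also have "\<dots> = ennreal (K * 2) * (\<integral>\<^sup>+z. g z \<partial>leb2)"
    unfolding nn_integral_leb2_translation[OF gm] by (subst ennreal_mult) (auto simp: K_def mult.assoc simp flip: mult_2)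
  finally have "ennreal (V * norm h powr N) * pow_int q (ball x0 \<rho>) (diff h w)
      \<le> ennreal (K * 2) * gagliardo_int \<sigma> q (ball x0 \<rho>') w"
    unfolding 1 G .
  then have "pow_int q (ball x0 \<rho>) (diff h w)
      \<le> ennreal (K * 2 / (V * norm h powr N)) * gagliardo_int \<sigma> q (ball x0 \<rho>') w"
    using h V by (intro ennreal_le_of_cmult_le) (auto simp: K_def)
  also have "K * 2 / (V * norm h powr N) = 2 powr (q + N + \<sigma> * q + 1) / V * norm h powr (\<sigma> * q)"
    using h by (simp add: K_def \<beta>_def powr_mult powr_add)
  finally show ?thesis unfolding V_def N_def nik_const_def .
qed

lemma pow_int_cong_AE:
  assumes "AE x in lebesgue. w x = (w' :: 'a::euclidean_space \<Rightarrow> real) x"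
  shows "pow_int q U w = pow_int q U w'"
  unfolding pow_int_def using assms by (intro nn_integral_cong_AE) auto

lemma gagliardo_int_cong_AE:
  assumes "AE x in lebesgue. w x = (w' :: 'a::euclidean_space \<Rightarrow> real) x"
  shows "gagliardo_int \<gamma> q U w = gagliardo_int \<gamma> q U w'"
  unfolding gagliardo_int_def using AE_leb2_fst[OF assms] AE_leb2_snd[OF assms]
  by (intro nn_integral_cong_AE) (auto elim: AE_mp)

text \<open>Substituting \<open>y = x + h\<close> and exchanging the integrals turns the seminorm
  into an integral over \<open>h\<close>. The strict gap \<open>\<sigma> < s\<close> makes
  \<open>|h|^(s q)\<close> times the kernel integrable at 0; for \<open>norm h \<ge> d\<close> the
  sup bound \<open>L\<close> suffices. The constant is fixed before the function, the ball and
  \<open>d\<close>.\<close>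

lemma gagliardo_le_of_pow_int_diff:
  fixes \<sigma> s q :: real
  assumes q: "1 \<le> q" and s: "\<sigma> < s" "0 < \<sigma>"
  obtains C where "0 \<le> C"
    "\<And>(w :: 'a::euclidean_space \<Rightarrow> real) x0 r d L S. w \<in> borel_measurable lebesgue \<Longrightarrow> 0 < d \<Longrightarrow> d \<le> 1 \<Longrightarrow> 0 \<le> L \<Longrightarrow> 0 \<le> S \<Longrightarrow>
      0 \<le> r \<Longrightarrow> r < 1 \<Longrightarrow> (AE x in lebesgue. x \<in> ball x0 r \<longrightarrow> \<bar>w x\<bar> \<le> L) \<Longrightarrow>
      (\<And>h. h \<noteq> 0 \<Longrightarrow> norm h < d \<Longrightarrow> pow_int q (ball x0 r) (diff h w) \<le> ennreal (S * norm h powr (s * q))) \<Longrightarrow>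
      gagliardo_int \<sigma> q (ball x0 r) w \<le> ennreal (C * (S + L powr q / d powr (real DIM('a) + \<sigma> * q)))"
proof -
  define N where "N = real DIM('a)"
  define \<beta> where "\<beta> = N + \<sigma> * q"
  define V where "V = unit_ball_vol N"
  have V: "V > 0" by (simp add: V_def N_def)
  have \<beta>: "\<beta> > 0" using q s by (simp add: \<beta>_def N_def add_pos_pos)
  have "\<beta> - s * q < real DIM('a)" using q s by (simp add: \<beta>_def N_def)
  note C1' = near_kernel_bound[OF this]
  define C1 where "C1 = near_const TYPE('a) (\<beta> - s * q)"
  have C1: "0 \<le> C1" by (simp add: C1_def)
  define C2 where "C2 = 2 powr q * V * (V * 2 powr N)"
  have C2: "C2 \<ge> 0" using V by (simp add: C2_def)
  show ?thesis
  proof (rule that[of "C1 + C2"])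
    show "0 \<le> C1 + C2" using C1 C2 by simp
    fix v :: "'a \<Rightarrow> real" and x0 r d L S
    assume v: "v \<in> borel_measurable lebesgue" and d: "0 < d" "d \<le> 1" and L: "0 \<le> L" and S: "0 \<le> S"
      and r: "0 \<le> r" "r < 1" and bd_v: "AE x in lebesgue. x \<in> ball x0 r \<longrightarrow> \<bar>v x\<bar> \<le> L"
      and nik_v: "\<And>h. h \<noteq> 0 \<Longrightarrow> norm h < d \<Longrightarrow> pow_int q (ball x0 r) (diff h v) \<le> ennreal (S * norm h powr (s * q))"
    \<comment> \<open>A Borel representative is needed for the joint measurability of \<open>(x, h) \<mapsto> w (x + h)\<close>.\<close>
    obtain w where "w \<in> borel_measurable lborel" and "AE x in lborel. v x = w x"
      using completion_ex_borel_measurable_real[OF v] by blast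
    then have w [measurable]: "w \<in> borel_measurable borel" and eq: "AE x in lebesgue. v x = w x"
      by (auto intro: AE_completion)
    have bd: "AE x in lebesgue. x \<in> ball x0 r \<longrightarrow> \<bar>w x\<bar> \<le> L" using bd_v eq by eventually_elim auto
    have nik: "pow_int q (ball x0 r) (diff h w) \<le> ennreal (S * norm h powr (s * q))" if "h \<noteq> 0" "norm h < d" for h
    proof -
      have "AE x in lebesgue. diff h v x = diff h w x"
        using eq AE_translation[OF eq, of h] by eventually_elim (simp add: diff_def)
      from pow_int_cong_AE[OF this] nik_v[OF that] show ?thesis by simp
    qed
    define B where "B = ball x0 r"
    define g where "g x y = indicator B x * indicator B y * ennreal (\<bar>w x - w y\<bar> powr q / norm (x - y) powr \<beta>)" for x y
    have wl [measurable]: "w \<in> borel_measurable lebesgue" using w by (simp add: measurable_completion)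
    have gm [measurable]: "(\<lambda>z. g (fst z) (snd z)) \<in> borel_measurable leb2"
      unfolding g_def B_def by measurable
    have gm2 [measurable]: "(\<lambda>z. g (fst z) (fst z + snd z)) \<in> borel_measurable leb2"
      unfolding g_def B_def by measurable
    have gx: "(\<lambda>y. g x y) \<in> borel_measurable lebesgue" for x
      using measurable_compose_Pair1[OF _ gm, of x] by simp
    \<comment> \<open>Shifts with \<open>norm h \<ge> 2\<close> contribute nothing because the ball
      has radius below 1. The form \<open>0 - h\<close> matches \<open>near_kernel_bound\<close> at
      the centre 0.\<close>
    have inner: "(\<integral>\<^sup>+x. g x (x + h) \<partial>lebesgue)
        \<le> ennreal S * (indicator (ball 0 2) (0 - h) * ennreal (1 / norm (0 - h) powr (\<beta> - s * q)))
          + ennreal (2 powr q * (L powr q / d powr \<beta>) * V) * indicator (ball 0 2) h" for h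
    proof (cases "h = 0 \<or> 2 \<le> norm h")
      case True
      have "g x (x + h) = 0" for x
      proof (cases "h = 0")
        case False
        have "\<not> (x \<in> B \<and> x + h \<in> B)"
        proof
          assume a: "x \<in> B \<and> x + h \<in> B"
          have "norm h \<le> dist x0 x + dist x0 (x + h)"
            using dist_triangle3[of x "x + h" x0] by (simp add: dist_norm)
          then show False using a True False r by (simp add: B_def)
        qed
        then show ?thesis by (auto simp: g_def)
      qed (simp add: g_def)
      then show ?thesis by simp
    next
      case False
      then have h: "h \<noteq> 0" "norm h < 2" by auto
      show ?thesis
      proof (cases "norm h < d")
        case True
        have "(\<integral>\<^sup>+x. g x (x + h) \<partial>lebesgue)
            \<le> (\<integral>\<^sup>+x. ennreal (1 / norm h powr \<beta>) * (indicator B x * ennreal (\<bar>diff h w x\<bar> powr q)) \<partial>lebesgue)"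
        proof (rule nn_integral_mono)
          fix x
          show "g x (x + h) \<le> ennreal (1 / norm h powr \<beta>) * (indicator B x * ennreal (\<bar>diff h w x\<bar> powr q))"
          proof (cases "x \<in> B \<and> x + h \<in> B")
            case True
            have "ennreal (1 / norm h powr \<beta>) * ennreal (\<bar>diff h w x\<bar> powr q) = ennreal (\<bar>w x - w (x + h)\<bar> powr q / norm h powr \<beta>)"
              by (subst ennreal_mult[symmetric]) (auto simp: diff_def abs_minus_commute)
            then show ?thesis using True by (simp add: g_def)
          qed (auto simp: g_def)
        qed
        also have "\<dots> = ennreal (1 / norm h powr \<beta>) * pow_int q B (diff h w)"
          unfolding pow_int_def B_def by (rule nn_integral_cmult) measurable
        also have "\<dots> \<le> ennreal (1 / norm h powr \<beta>) * ennreal (S * norm h powr (s * q))"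
          unfolding B_def by (intro mult_left_mono nik h True) auto
        also have "\<dots> = ennreal S * ennreal (1 / norm h powr (\<beta> - s * q))"
          using S h by (subst (1 2) ennreal_mult[symmetric]) (auto simp: powr_diff)
        also have "\<dots> = ennreal S * (indicator (ball 0 2) (0 - h) * ennreal (1 / norm (0 - h) powr (\<beta> - s * q)))"
          using h by simp
        finally show ?thesis by (rule order_trans) simp
      next
        case False
        have bd': "AE x in lebesgue. x + h \<in> B \<longrightarrow> \<bar>w (x + h)\<bar> \<le> L"
          using AE_translation[OF bd, of h] by (simp add: B_def)
        have "(\<integral>\<^sup>+x. g x (x + h) \<partial>lebesgue)
            \<le> (\<integral>\<^sup>+x. ennreal (2 powr q * (L powr q / d powr \<beta>)) * indicator B x \<partial>lebesgue)"
        proof (rule nn_integral_mono_AE)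
          show "AE x in lebesgue. g x (x + h) \<le> ennreal (2 powr q * (L powr q / d powr \<beta>)) * indicator B x"
            using bd bd'
          proof eventually_elim
            case (elim x)
            show ?case
            proof (cases "x \<in> B \<and> x + h \<in> B")
              case True
              then have "\<bar>w x - w (x + h)\<bar> \<le> 2 * L" using elim by (auto simp: B_def)
              then have "\<bar>w x - w (x + h)\<bar> powr q / norm h powr \<beta> \<le> (2 * L) powr q / d powr \<beta>"
                using False d \<beta> q by (intro frac_le powr_mono2) auto
              then show ?thesis using True by (simp add: g_def powr_mult ennreal_leI)
            qed (auto simp: g_def)
          qed
        qed
        also have "\<dots> = ennreal (2 powr q * (L powr q / d powr \<beta>)) * ennreal (V * r powr N)"
          unfolding B_def V_def N_def using r
          by (subst nn_integral_cmult_indicator) (auto simp: emeasure_lebesgue_ball simp del: emeasure_completion)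
        also have "\<dots> \<le> ennreal (2 powr q * (L powr q / d powr \<beta>)) * ennreal V"
          using V r powr_le1[of N r] by (intro mult_left_mono ennreal_leI) (auto simp: N_def)
        also have "\<dots> = ennreal (2 powr q * (L powr q / d powr \<beta>) * V) * indicator (ball 0 2) h"
          using h V by (subst ennreal_mult[symmetric]) auto
        finally show ?thesis by (rule order_trans) simp
      qed
    qed
    have "gagliardo_int \<sigma> q (ball x0 r) v = (\<integral>\<^sup>+z. g (fst z) (snd z) \<partial>leb2)"
      unfolding gagliardo_int_cong_AE[OF eq] unfolding gagliardo_int_alt g_def B_def \<beta>_def N_def ..
    also have "\<dots> = (\<integral>\<^sup>+x. \<integral>\<^sup>+y. g x y \<partial>lebesgue \<partial>lebesgue)"
      using leb.nn_integral_fst[OF gm] by simp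
    also have "\<dots> = (\<integral>\<^sup>+x. \<integral>\<^sup>+h. g x (x + h) \<partial>lebesgue \<partial>lebesgue)"
    proof (rule nn_integral_cong)
      fix x
      show "(\<integral>\<^sup>+y. g x y \<partial>lebesgue) = (\<integral>\<^sup>+h. g x (x + h) \<partial>lebesgue)"
        using nn_integral_translation[OF gx[of x], of x] by (simp add: add.commute)
    qed
    also have "\<dots> = (\<integral>\<^sup>+h. \<integral>\<^sup>+x. g x (x + h) \<partial>lebesgue \<partial>lebesgue)"
      using leb_pair.Fubini[OF gm2] by simp
    also have "\<dots> \<le> (\<integral>\<^sup>+h. ennreal S * (indicator (ball 0 2) (0 - h :: 'a) * ennreal (1 / norm (0 - h) powr (\<beta> - s * q)))
          + ennreal (2 powr q * (L powr q / d powr \<beta>) * V) * indicator (ball 0 2) h \<partial>lebesgue)"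
      by (rule nn_integral_mono) (rule inner)
    also have "\<dots> = ennreal S * (\<integral>\<^sup>+h. indicator (ball 0 2) (h :: 'a) * ennreal (1 / norm (0 - h) powr (\<beta> - s * q)) \<partial>lebesgue)
          + ennreal (2 powr q * (L powr q / d powr \<beta>) * V) * ennreal (V * 2 powr N)"
    proof -
      have [measurable]: "(\<lambda>h :: 'a. indicator (ball 0 2) h * ennreal (1 / norm h powr (\<beta> - s * q))) \<in> borel_measurable lebesgue"
        by (rule measurable_completion) measurable
      have i: "indicator (ball 0 2) (- h :: 'a) = (indicator (ball 0 2) h :: ennreal)" for h
        by (simp add: indicator_def)
      show ?thesis
        using emeasure_lebesgue_ball[of 2 "0 :: 'a"]
        unfolding V_def N_def i diff_0 norm_minus_cancel
        by (subst nn_integral_add, measurable, subst nn_integral_cmult, measurable,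
            subst nn_integral_cmult_indicator) (auto simp del: emeasure_completion)
    qed
    also have "\<dots> \<le> ennreal S * ennreal C1 + ennreal (2 powr q * (L powr q / d powr \<beta>) * V) * ennreal (V * 2 powr N)"
      using C1'[of 0, folded C1_def] by (intro add_mono mult_left_mono) auto
    also have "\<dots> = ennreal (C1 * S + C2 * (L powr q / d powr \<beta>))"
    proof -
      have "2 powr q * (L powr q / d powr \<beta>) * V * (V * 2 powr N) = C2 * (L powr q / d powr \<beta>)"
        by (simp add: C2_def)
      then show ?thesis
        using S C1 V C2 by (subst (1 2) ennreal_mult[symmetric]) (auto simp: mult.commute)
    qed
    also have "\<dots> \<le> ennreal ((C1 + C2) * (S + L powr q / d powr \<beta>))"
    proof (rule ennreal_leI)
      have *: "C1 * S + C2 * X \<le> (C1 + C2) * (S + X)" if "0 \<le> X" for X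
        using C1 C2 S that by (simp add: algebra_simps)
      show "C1 * S + C2 * (L powr q / d powr \<beta>) \<le> (C1 + C2) * (S + L powr q / d powr \<beta>)"
        by (rule *) simp
    qed
    finally show "gagliardo_int \<sigma> q (ball x0 r) v \<le> ennreal ((C1 + C2) * (S + L powr q / d powr (real DIM('a) + \<sigma> * q)))"
      by (simp add: \<beta>_def N_def)
  qed
qed

section \<open>Passage from second differences to first differences\<close>

text \<open>Comparing \<open>B\<close> with \<open>\<mu> * A\<close> keeps the factor of
  \<open>A powr q\<close> as close to \<open>2 powr (- q)\<close> as desired, at the price of a
  large factor of \<open>B powr q\<close>.\<close>

lemma half_sum_powr_le:
  fixes A B \<mu> q :: real
  assumes "0 \<le> A" "0 \<le> B" "0 < \<mu>" "0 \<le> q"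
  shows "(A / 2 + B / 2) powr q \<le> ((1 + \<mu>) / 2) powr q * A powr q + ((1 + 1 / \<mu>) / 2) powr q * B powr q"
proof (cases "B \<le> \<mu> * A")
  case True
  then have "(A / 2 + B / 2) powr q \<le> ((1 + \<mu>) / 2 * A) powr q"
    using assms by (intro powr_mono2) (auto simp: field_simps)
  then have "(A / 2 + B / 2) powr q \<le> ((1 + \<mu>) / 2) powr q * A powr q" by (simp only: powr_mult)
  then show ?thesis by (rule add_increasing2[rotated]) simp
next
  case False
  then have "(A / 2 + B / 2) powr q \<le> ((1 + 1 / \<mu>) / 2 * B) powr q"
    using assms by (intro powr_mono2) (auto simp: field_simps)
  then have "(A / 2 + B / 2) powr q \<le> ((1 + 1 / \<mu>) / 2) powr q * B powr q" by (simp only: powr_mult)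
  then show ?thesis by (rule add_increasing[rotated]) simp
qed

text \<open>Since \<open>s < 1\<close>, the identity \<open>diff h w = (diff (2h) w - diff h (diff h w)) / 2\<close> contracts
  the quotient \<open>pow_int q B (diff h w) / |h|^(s q)\<close> when passing from \<open>2h\<close> to \<open>h\<close>.\<close>

lemma pow_int_diff_le_of_second_diff:
  fixes s q :: real
  assumes s: "0 < s" "s < 1" and q: "1 \<le> q"
  obtains C where "0 \<le> C"
    "\<And>(w :: 'a::euclidean_space \<Rightarrow> real) x0 r d K K0 h. w \<in> borel_measurable lebesgue \<Longrightarrow> 0 < d \<Longrightarrow> 0 \<le> K \<Longrightarrow> 0 \<le> K0 \<Longrightarrow>
      (\<And>h. h \<noteq> 0 \<Longrightarrow> norm h \<le> d \<Longrightarrow> pow_int q (ball x0 r) (diff h (diff h w)) \<le> ennreal (K * norm h powr (s * q))) \<Longrightarrow>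
      (\<And>h. norm h \<le> 2 * d \<Longrightarrow> pow_int q (ball x0 r) (diff h w) \<le> ennreal K0) \<Longrightarrow>
      h \<noteq> 0 \<Longrightarrow> norm h \<le> 2 * d \<Longrightarrow>
      pow_int q (ball x0 r) (diff h w) \<le> ennreal (C * (K + K0 / d powr (s * q)) * norm h powr (s * q))"
proof -
  \<comment> \<open>Doubling \<open>h\<close> costs \<open>2^(s q)\<close>, halving the difference
    gains almost \<open>2^q\<close>. This \<open>\<mu>\<close> leaves the net factor
    \<open>\<beta> = 2^(- (1 - s) q / 2)\<close>, which is below 1.\<close>
  define \<mu> :: real where "\<mu> = 2 powr ((1 - s) / 2) - 1"
  have \<mu>: "\<mu> > 0" using powr_less_mono[of 0 "(1 - s) / 2" 2] s by (simp add: \<mu>_def)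
  define \<alpha> where "\<alpha> = ((1 + \<mu>) / 2) powr q"
  define \<beta> where "\<beta> = \<alpha> * 2 powr (s * q)"
  have "\<beta> = 2 powr (- ((1 - s) / 2 * q))"
  proof -
    have "(1 + \<mu>) / 2 = 2 powr ((1 - s) / 2 - 1)" by (simp add: \<mu>_def powr_diff)
    then have "\<beta> = 2 powr (((1 - s) / 2 - 1) * q + s * q)" by (simp only: \<beta>_def \<alpha>_def powr_powr powr_add)
    also have "((1 - s) / 2 - 1) * q + s * q = - ((1 - s) / 2 * q)" by (simp add: field_simps)
    finally show ?thesis .
  qed
  then have \<beta>: "0 < \<beta>" "\<beta> < 1" using powr_less_mono[of "- ((1 - s) / 2 * q)" 0 2] s q by auto
  define c where "c = ((1 + 1 / \<mu>) / 2) powr q"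
  have c: "c \<ge> 0" by (simp add: c_def)
  have \<alpha>: "\<alpha> \<ge> 0" by (simp add: \<alpha>_def)
  show ?thesis
  proof (rule that[of "c / (1 - \<beta>) + 1"])
    show "0 \<le> c / (1 - \<beta>) + 1" using \<beta> c by simp
    fix w :: "'a \<Rightarrow> real" and x0 r d K K0 and h :: 'a
    assume w [measurable]: "w \<in> borel_measurable lebesgue" and d: "0 < d" and K: "0 \<le> K" "0 \<le> K0"
      and second: "\<And>h. h \<noteq> 0 \<Longrightarrow> norm h \<le> d \<Longrightarrow> pow_int q (ball x0 r) (diff h (diff h w)) \<le> ennreal (K * norm h powr (s * q))"
      and first: "\<And>h. norm h \<le> 2 * d \<Longrightarrow> pow_int q (ball x0 r) (diff h w) \<le> ennreal K0"
      and h: "h \<noteq> 0" "norm h \<le> 2 * d"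
    \<comment> \<open>Chosen to close the induction: it satisfies
      \<open>\<beta> * S + c * K \<le> S\<close> and dominates \<open>K0\<close> at the scale
      \<open>d\<close>.\<close>
    define S where "S = c * K / (1 - \<beta>) + K0 / d powr (s * q)"
    have S0: "S \<ge> 0" using c K \<beta> by (simp add: S_def)
    have S1: "K0 \<le> S * d powr (s * q)" using c K \<beta> d by (simp add: S_def field_simps)
    have S2: "\<beta> * S + c * K \<le> S"
    proof -
      have "(1 - \<beta>) * S = c * K + (1 - \<beta>) * (K0 / d powr (s * q))"
        using \<beta> by (simp add: S_def distrib_left)
      also have "\<dots> \<ge> c * K" using \<beta> K by simp
      finally show ?thesis by (simp add: algebra_simps)
    qed
    have step: "pow_int q (ball x0 r) (diff h w)
        \<le> ennreal \<alpha> * pow_int q (ball x0 r) (diff (2 *\<^sub>R h) w) + ennreal c * pow_int q (ball x0 r) (diff h (diff h w))" for h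
    proof -
      have le: "\<bar>diff h w x\<bar> powr q \<le> \<alpha> * \<bar>diff (2 *\<^sub>R h) w x\<bar> powr q + c * \<bar>diff h (diff h w) x\<bar> powr q" for x
      proof -
        have "\<bar>diff h w x\<bar> \<le> \<bar>diff (2 *\<^sub>R h) w x\<bar> / 2 + \<bar>diff h (diff h w) x\<bar> / 2"
        proof -
          have "diff h w x = diff (2 *\<^sub>R h) w x / 2 + - diff h (diff h w) x / 2"
            by (simp add: diff_def scaleR_2 add.assoc field_simps)
          then show ?thesis
            using abs_triangle_ineq[of "diff (2 *\<^sub>R h) w x / 2" "- diff h (diff h w) x / 2"] by simp
        qed
        then have "\<bar>diff h w x\<bar> powr q \<le> (\<bar>diff (2 *\<^sub>R h) w x\<bar> / 2 + \<bar>diff h (diff h w) x\<bar> / 2) powr q"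
          using q by (intro powr_mono2) auto
        also have "\<dots> \<le> \<alpha> * \<bar>diff (2 *\<^sub>R h) w x\<bar> powr q + c * \<bar>diff h (diff h w) x\<bar> powr q"
          unfolding \<alpha>_def c_def using \<mu> q by (intro half_sum_powr_le) auto
        finally show ?thesis .
      qed
      have "pow_int q (ball x0 r) (diff h w) \<le> (\<integral>\<^sup>+x. ennreal \<alpha> * (indicator (ball x0 r) x * ennreal (\<bar>diff (2 *\<^sub>R h) w x\<bar> powr q))
          + ennreal c * (indicator (ball x0 r) x * ennreal (\<bar>diff h (diff h w) x\<bar> powr q)) \<partial>lebesgue)"
        unfolding pow_int_def
      proof (rule nn_integral_mono)
        fix x
        show "indicator (ball x0 r) x * ennreal (\<bar>diff h w x\<bar> powr q)
          \<le> ennreal \<alpha> * (indicator (ball x0 r) x * ennreal (\<bar>diff (2 *\<^sub>R h) w x\<bar> powr q))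
          + ennreal c * (indicator (ball x0 r) x * ennreal (\<bar>diff h (diff h w) x\<bar> powr q))"
          using ennreal_leI[OF le[of x]] \<alpha> c by (auto simp: indicator_def ennreal_mult)
      qed
      also have "\<dots> = ennreal \<alpha> * pow_int q (ball x0 r) (diff (2 *\<^sub>R h) w) + ennreal c * pow_int q (ball x0 r) (diff h (diff h w))"
        unfolding pow_int_def
        by (subst nn_integral_add, measurable, subst nn_integral_cmult, measurable, subst nn_integral_cmult, measurable)
      finally show ?thesis .
    qed
    \<comment> \<open>Induction over dyadic scales, from coarse to fine. Scale 0 covers
      \<open>d < norm h\<close>, where \<open>K0\<close> suffices; a shorter \<open>h\<close> is
      reduced to \<open>2 *\<^sub>R h\<close>, which is still no longer than
      \<open>2 * d\<close>.\<close>
    have main: "pow_int q (ball x0 r) (diff h w) \<le> ennreal (S * norm h powr (s * q))"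
      if "d / 2 ^ n < norm h" "norm h \<le> 2 * d" for n h
      using that
    proof (induction n arbitrary: h)
      case (0 h)
      have "pow_int q (ball x0 r) (diff h w) \<le> ennreal K0" by (rule first) (use 0 in auto)
      also have "K0 \<le> S * d powr (s * q)" by (rule S1)
      also have "\<dots> \<le> S * norm h powr (s * q)" using 0 S0 d s q by (intro mult_left_mono powr_mono2) auto
      finally show ?case by (simp add: ennreal_leI)
    next
      case (Suc n h)
      show ?case
      proof (cases "d / 2 ^ n < norm h")
        case True
        then show ?thesis using Suc by auto
      next
        case False
        have "d / 2 ^ n \<le> d" using d by (simp add: field_simps)
        then have hd: "norm h \<le> d" using False by simp
        have "0 < d / 2 ^ Suc n" using d by simp
        then have h0: "h \<noteq> 0" using Suc.prems(1) by auto
        have "pow_int q (ball x0 r) (diff (2 *\<^sub>R h) w) \<le> ennreal (S * norm (2 *\<^sub>R h) powr (s * q))"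
          using Suc.prems(1) hd by (intro Suc.IH) (auto simp: field_simps)
        then have "ennreal \<alpha> * pow_int q (ball x0 r) (diff (2 *\<^sub>R h) w) + ennreal c * pow_int q (ball x0 r) (diff h (diff h w))
          \<le> ennreal \<alpha> * ennreal (S * norm (2 *\<^sub>R h) powr (s * q)) + ennreal c * ennreal (K * norm h powr (s * q))"
          using second[OF h0 hd] by (intro add_mono mult_left_mono) simp_all
        from order_trans[OF step this]
        have "pow_int q (ball x0 r) (diff h w) \<le> ennreal \<alpha> * ennreal (S * norm (2 *\<^sub>R h) powr (s * q)) + ennreal c * ennreal (K * norm h powr (s * q))" .
        also have "\<dots> = ennreal ((\<beta> * S + c * K) * norm h powr (s * q))"
          using \<alpha> c S0 K by (simp add: \<beta>_def ennreal_mult[symmetric] ennreal_plus[symmetric] powr_mult algebra_simps del: ennreal_plus)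
        also have "\<dots> \<le> ennreal (S * norm h powr (s * q))"
          using S2 by (intro ennreal_leI mult_right_mono) auto
        finally show ?thesis .
      qed
    qed
    obtain n where "d / norm h < 2 ^ n" using real_arch_pow[of 2 "d / norm h"] by auto
    then have "d / 2 ^ n < norm h" using h by (simp add: field_simps)
    then have "pow_int q (ball x0 r) (diff h w) \<le> ennreal (S * norm h powr (s * q))" using h by (intro main)
    also have "\<dots> \<le> ennreal ((c / (1 - \<beta>) + 1) * (K + K0 / d powr (s * q)) * norm h powr (s * q))"
    proof (intro ennreal_leI mult_right_mono)
      show "S \<le> (c / (1 - \<beta>) + 1) * (K + K0 / d powr (s * q))"
      proof -
        have *: "a * K + Y \<le> (a + 1) * (K + Y)" if "0 \<le> a" "0 \<le> Y" for a Y
          using that K by (simp add: algebra_simps)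
        show ?thesis
          using *[of "c / (1 - \<beta>)" "K0 / d powr (s * q)"] c \<beta> K by (simp add: S_def)
      qed
    qed simp
    finally show "pow_int q (ball x0 r) (diff h w)
        \<le> ennreal ((c / (1 - \<beta>) + 1) * (K + K0 / d powr (s * q)) * norm h powr (s * q))" .
  qed
qed

section \<open>Monotonicity of power nonlinearities\<close>

text \<open>The nonlinearity of the p-Laplacian. It occurs with exponent \<open>p\<close> in the
  flux and with exponent \<open>\<delta> + 1\<close> in the test function.\<close>

definition jp :: "real \<Rightarrow> real \<Rightarrow> real"
  where "jp p t = \<bar>t\<bar> powr (p - 2) * t"

lemma abs_jp: "\<bar>jp p t\<bar> = \<bar>t\<bar> powr (p - 1)"
  using powr_mult_base'[of "\<bar>t\<bar>" "p - 2"] by (simp add: jp_def abs_mult mult.commute)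

lemma jp_minus: "jp p (- t) = - jp p t"
  by (simp add: jp_def)

lemma jp_nonneg: "0 \<le> t \<Longrightarrow> jp p t = t powr (p - 1)"
  using powr_mult_base[of t "p - 2"] by (simp add: jp_def mult.commute)

lemma jp_nonpos: "t \<le> 0 \<Longrightarrow> jp p t = - ((- t) powr (p - 1))"
  using jp_nonneg[of "- t" p] by (simp add: jp_minus)

lemma jp_mono:
  assumes "1 \<le> p" "s \<le> t"
  shows "jp p s \<le> jp p t"
proof -
  consider "0 \<le> s" | "t \<le> 0" | "s \<le> 0" "0 \<le> t" by linarith
  then show ?thesis
  proof cases
    case 1
    then show ?thesis using assms by (simp add: jp_nonneg powr_mono2)
  next
    case 2
    then show ?thesis using assms by (simp add: jp_nonpos powr_mono2)
  next
    case 3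
    then show ?thesis using powr_ge_zero[of t "p - 1"] powr_ge_zero[of "- s" "p - 1"]
      by (simp only: jp_nonneg jp_nonpos)
  qed
qed

text \<open>A concave power lies below its tangent at 1; here this is Young's inequality for
  \<open>t\<close> and 1 with weights \<open>r\<close> and \<open>1 - r\<close>.\<close>

lemma powr_le_Bernoulli:
  fixes t r :: real
  assumes "0 \<le> t" "0 < r" "r \<le> 1"
  shows "t powr r \<le> 1 + r * (t - 1)"
proof (cases "t = 0")
  case False
  then show ?thesis
    using Youngs_inequality_0[of r "1 - r" t 1] assms by (simp add: algebra_simps)
qed (use assms in auto)

lemma powr_ge_Bernoulli:
  fixes t r :: real
  assumes "0 \<le> t" "1 \<le> r"
  shows "1 + r * (t - 1) \<le> t powr r"
proof -
  have "t = (t powr r) powr (1 / r)" using assms by (simp add: powr_powr)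
  also have "\<dots> \<le> 1 + 1 / r * (t powr r - 1)" using assms by (intro powr_le_Bernoulli) auto
  finally show ?thesis using assms by (simp add: field_simps)
qed

text \<open>The tangent inequality at 1, applied to \<open>b / a\<close> and rescaled. It takes the
  place of a mean value argument and includes \<open>b = 0\<close>.\<close>

lemma powr_diff_ge:
  fixes a b r :: real
  assumes "0 \<le> b" "b < a" "0 < r" "r \<le> 1"
  shows "r * a powr (r - 1) * (a - b) \<le> a powr r - b powr r"
proof -
  have a: "a > 0" using assms by simp
  have "(b / a) powr r \<le> 1 + r * (b / a - 1)" using assms a by (intro powr_le_Bernoulli) auto
  from mult_left_mono[OF this, of "a powr r"]
  have "b powr r \<le> a powr r + r * (a powr r / a) * (b - a)"
    using a by (simp add: powr_divide field_simps)
  also have "a powr r / a = a powr (r - 1)" using a by (simp add: powr_diff)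
  finally show ?thesis by (simp add: algebra_simps)
qed

lemma powr_diff_le:
  fixes a b r :: real
  assumes "0 \<le> b" "b < a" "1 \<le> r"
  shows "a powr r - b powr r \<le> r * a powr (r - 1) * (a - b)"
proof -
  have a: "a > 0" using assms by simp
  have "1 + r * (b / a - 1) \<le> (b / a) powr r" using assms a by (intro powr_ge_Bernoulli) auto
  from mult_left_mono[OF this, of "a powr r"]
  have "a powr r + r * (a powr r / a) * (b - a) \<le> b powr r"
    using a by (simp add: powr_divide field_simps)
  moreover have "a powr r / a = a powr (r - 1)" using a by (simp add: powr_diff)
  ultimately have "a powr r + r * a powr (r - 1) * (b - a) \<le> b powr r" by (simp only:)
  then show ?thesis by (simp add: algebra_simps)
qed

text \<open>After division by \<open>a + b\<close> this is \<open>x \<le> x powr r\<close> on the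
  unit interval, used for two numbers with sum 1.\<close>

lemma powr_subadditive:
  fixes a b r :: real
  assumes "0 \<le> a" "0 \<le> b" "0 \<le> r" "r \<le> 1"
  shows "(a + b) powr r \<le> a powr r + b powr r"
proof (cases "a + b = 0")
  case False
  then have s: "a + b > 0" using assms by simp
  have le: "x / (a + b) \<le> (x / (a + b)) powr r" if "0 \<le> x" "x \<le> a + b" for x
    using powr_mono'[of r 1 "x / (a + b)"] that s assms by simp
  have "1 = a / (a + b) + b / (a + b)" using s by (simp add: add_divide_distrib[symmetric])
  also have "\<dots> \<le> (a / (a + b)) powr r + (b / (a + b)) powr r"
    using assms by (intro add_mono le) auto
  also have "\<dots> = (a powr r + b powr r) / (a + b) powr r" by (simp add: powr_divide add_divide_distrib)
  finally show ?thesis using s by (simp add: field_simps)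
qed (use assms in auto)

lemma powr_superadditive:
  fixes a b r :: real
  assumes "0 \<le> a" "0 \<le> b" "1 \<le> r"
  shows "a powr r + b powr r \<le> (a + b) powr r"
proof (cases "a + b = 0")
  case False
  then have s: "a + b > 0" using assms by simp
  have le: "(x / (a + b)) powr r \<le> x / (a + b)" if "0 \<le> x" "x \<le> a + b" for x
    using powr_mono'[of 1 r "x / (a + b)"] that s assms by simp
  have "(a powr r + b powr r) / (a + b) powr r = (a / (a + b)) powr r + (b / (a + b)) powr r"
    by (simp add: powr_divide add_divide_distrib)
  also have "\<dots> \<le> a / (a + b) + b / (a + b)"
    using assms by (intro add_mono le) auto
  also have "\<dots> = 1" using s by (simp add: add_divide_distrib[symmetric])
  finally show ?thesis using s by (simp add: field_simps)
next
  case True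
  then have "a = 0" "b = 0" using assms by auto
  then show ?thesis by simp
qed

text \<open>For equal signs the tangent inequality gives a weight \<open>a powr (p - 2)\<close>,
  which only decreases when \<open>\<bar>a\<bar> + \<bar>b\<bar>\<close> replaces \<open>a\<close>,
  as \<open>p \<le> 2\<close>. For opposite signs
  \<open>a - b = \<bar>a\<bar> + \<bar>b\<bar>\<close>, and subadditivity of the power
  \<open>p - 1\<close> suffices.\<close>

lemma jp_diff_ge_subquadratic:
  assumes p: "1 < p" "p \<le> 2" and "b < a"
  shows "(p - 1) * (\<bar>a\<bar> + \<bar>b\<bar>) powr (p - 2) * (a - b) \<le> jp p a - jp p b"
proof -
  have pos: "(p - 1) * (\<bar>a\<bar> + \<bar>b\<bar>) powr (p - 2) * (a - b) \<le> jp p a - jp p b" if "0 \<le> b" "b < a" for a b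
  proof -
    have "(p - 1) * (\<bar>a\<bar> + \<bar>b\<bar>) powr (p - 2) * (a - b) \<le> (p - 1) * a powr (p - 2) * (a - b)"
      using that p by (intro mult_right_mono mult_left_mono powr_mono2') auto
    also have "\<dots> \<le> a powr (p - 1) - b powr (p - 1)"
      using powr_diff_ge[of b a "p - 1"] that p by simp
    finally show ?thesis using that by (simp add: jp_nonneg)
  qed
  consider "0 \<le> b" | "a \<le> 0" | "b \<le> 0" "0 \<le> a" by linarith
  then show ?thesis
  proof cases
    case 1
    then show ?thesis using pos \<open>b < a\<close> by blast
  next
    case 2
    then show ?thesis using pos[of "- a" "- b"] \<open>b < a\<close> by (simp add: jp_minus add.commute)
  next
    case 3
    have "(p - 1) * (\<bar>a\<bar> + \<bar>b\<bar>) powr (p - 2) * (a - b) \<le> 1 * (\<bar>a\<bar> + \<bar>b\<bar>) powr (p - 2) * (a - b)"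
      using p \<open>b < a\<close> by (intro mult_right_mono) auto
    also have "\<dots> = (a + - b) powr (p - 1)"
      using 3 powr_mult_base[of "a - b" "p - 2"] by (simp add: mult.commute)
    also have "\<dots> \<le> a powr (p - 1) + (- b) powr (p - 1)"
      using 3 p by (intro powr_subadditive) auto
    finally show ?thesis using 3 by (simp add: jp_nonneg jp_nonpos)
  qed
qed

text \<open>Superadditivity handles equal signs; for opposite signs the bound on a power of a sum
  dictates the factor \<open>2 powr (1 - p)\<close>. It is applied to the nonlinearity of the test
  function.\<close>

lemma jp_diff_ge_superlinear:
  assumes p: "2 \<le> p" and "b < a"
  shows "2 powr (1 - p) * (a - b) powr (p - 1) \<le> jp p a - jp p b"
proof -
  have c: "2 powr (1 - p) \<le> 1" using powr_mono[of "1 - p" 0 2] p by simp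
  have pos: "2 powr (1 - p) * (a - b) powr (p - 1) \<le> jp p a - jp p b" if "0 \<le> b" "b < a" for a b
  proof -
    have "2 powr (1 - p) * (a - b) powr (p - 1) \<le> 1 * (a - b) powr (p - 1)"
      using c by (intro mult_right_mono) auto
    also have "\<dots> \<le> a powr (p - 1) - b powr (p - 1)"
      using powr_superadditive[of "a - b" b "p - 1"] that p by simp
    finally show ?thesis using that by (simp add: jp_nonneg)
  qed
  consider "0 \<le> b" | "a \<le> 0" | "b \<le> 0" "0 \<le> a" by linarith
  then show ?thesis
  proof cases
    case 1
    then show ?thesis using pos \<open>b < a\<close> by blast
  next
    case 2
    then show ?thesis using pos[of "- a" "- b"] \<open>b < a\<close> by (simp add: jp_minus)
  next
    case 3
    have "2 powr (1 - p) * (a - b) powr (p - 1) = 2 powr (1 - p) * (a + - b) powr (p - 1)" by simp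
    also have "\<dots> \<le> 2 powr (1 - p) * (2 powr (p - 1) * (a powr (p - 1) + (- b) powr (p - 1)))"
      using 3 p by (intro mult_left_mono powr_add_le) auto
    also have "\<dots> = a powr (p - 1) + (- b) powr (p - 1)"
      by (simp add: mult.assoc[symmetric] powr_add[symmetric])
    finally show ?thesis using 3 by (simp add: jp_nonneg jp_nonpos)
  qed
qed

text \<open>Makes the truncated nonlinearity of the test function Lipschitz, so that the test
  function inherits the finite seminorms of \<open>u\<close>.\<close>

lemma jp_Lipschitz:
  assumes p: "2 \<le> p" and "\<bar>a\<bar> \<le> K" "\<bar>b\<bar> \<le> K"
  shows "\<bar>jp p a - jp p b\<bar> \<le> (p - 1) * K powr (p - 2) * \<bar>a - b\<bar>"
proof -
  have pos: "jp p a - jp p b \<le> (p - 1) * K powr (p - 2) * (a - b)" if "0 \<le> b" "b < a" "a \<le> K" for a b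
  proof -
    have "a powr (p - 1) - b powr (p - 1) \<le> (p - 1) * a powr (p - 2) * (a - b)"
      using powr_diff_le[of b a "p - 1"] that p by simp
    also have "\<dots> \<le> (p - 1) * K powr (p - 2) * (a - b)"
      using that p by (intro mult_right_mono mult_left_mono powr_mono2) auto
    finally show ?thesis using that by (simp add: jp_nonneg)
  qed
  have main: "jp p a - jp p b \<le> (p - 1) * K powr (p - 2) * (a - b)" if "b < a" "\<bar>a\<bar> \<le> K" "\<bar>b\<bar> \<le> K" for a b
  proof -
    consider "0 \<le> b" | "a \<le> 0" | "b \<le> 0" "0 \<le> a" by linarith
    then show ?thesis
    proof cases
      case 1
      then show ?thesis using pos that by simp
    next
      case 2
      then show ?thesis using pos[of "- a" "- b"] that by (simp add: jp_minus)
    next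
      case 3
      have le: "x powr (p - 1) \<le> K powr (p - 2) * x" if "0 \<le> x" "x \<le> K" for x
        using powr_mult_base[of x "p - 2"] mult_left_mono[OF powr_mono2[of "p - 2" x K], of x] that p
        by (simp add: mult.commute)
      have "a powr (p - 1) + (- b) powr (p - 1) \<le> K powr (p - 2) * (a - b)"
        using le[of a] le[of "- b"] 3 that by (simp add: algebra_simps)
      also have "\<dots> \<le> (p - 1) * (K powr (p - 2) * (a - b))"
        using mult_right_mono[of 1 "p - 1" "K powr (p - 2) * (a - b)"] p that by simp
      finally show ?thesis using 3 by (simp add: jp_nonneg jp_nonpos)
    qed
  qed
  consider "a = b" | "b < a" | "a < b" by linarith
  then show ?thesis
  proof cases
    case 2
    then show ?thesis using main[of b a] jp_mono[of p b a] assms by simp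
  next
    case 3
    then show ?thesis using main[of a b] jp_mono[of p a b] assms by simp
  qed simp
qed

text \<open>Both factors have the sign of \<open>a - b\<close>, so their lower bounds multiply. In
  the application \<open>a\<close> and \<open>b\<close> are increments of \<open>u\<close> over the
  shifted and the original pair, \<open>s\<close> and \<open>t\<close> the values of
  \<open>w\<close> at the two points; this is why \<open>s - t = a - b\<close>.\<close>

lemma jp_product_ge:
  assumes p: "1 < p" "p \<le> 2" and \<delta>: "1 \<le> \<delta>" and eq: "s - t = a - b"
  shows "(p - 1) * 2 powr (- \<delta>) * ((\<bar>a\<bar> + \<bar>b\<bar>) powr (p - 2) * \<bar>a - b\<bar> powr (\<delta> + 1))
    \<le> (jp p a - jp p b) * (jp (\<delta> + 1) s - jp (\<delta> + 1) t)"
proof -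
  have main: "(p - 1) * 2 powr (- \<delta>) * ((\<bar>a\<bar> + \<bar>b\<bar>) powr (p - 2) * \<bar>a - b\<bar> powr (\<delta> + 1))
    \<le> (jp p a - jp p b) * (jp (\<delta> + 1) s - jp (\<delta> + 1) t)" if "b < a" "s - t = a - b" for a b s t
  proof -
    have "(p - 1) * 2 powr (- \<delta>) * ((\<bar>a\<bar> + \<bar>b\<bar>) powr (p - 2) * \<bar>a - b\<bar> powr (\<delta> + 1))
      = ((p - 1) * (\<bar>a\<bar> + \<bar>b\<bar>) powr (p - 2) * (a - b)) * (2 powr (- \<delta>) * (s - t) powr \<delta>)"
    proof -
      have "\<bar>a - b\<bar> powr (\<delta> + 1) = (a - b) * (s - t) powr \<delta>"
        using that powr_mult_base[of "a - b" \<delta>] by (simp add: add.commute)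
      then show ?thesis by (simp add: mult_ac)
    qed
    also have "\<dots> \<le> (jp p a - jp p b) * (jp (\<delta> + 1) s - jp (\<delta> + 1) t)"
      using jp_diff_ge_subquadratic[OF p that(1)] jp_diff_ge_superlinear[of "\<delta> + 1" t s] that \<delta> p
        jp_mono[of p b a]
      by (intro mult_mono) auto
    finally show ?thesis .
  qed
  consider "a = b" | "b < a" | "a < b" by linarith
  then show ?thesis
  proof cases
    case 1
    then show ?thesis by simp
  next
    case 2
    then show ?thesis using main eq by blast
  next
    case 3
    have "(jp p b - jp p a) * (jp (\<delta> + 1) t - jp (\<delta> + 1) s) = (jp p a - jp p b) * (jp (\<delta> + 1) s - jp (\<delta> + 1) t)"
      by (simp add: algebra_simps)
    then show ?thesis using main[of a b t s] 3 eq by (simp add: add.commute abs_minus_commute)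
  qed
qed

lemma in_sgn_abs_le: "in_sgn z t \<Longrightarrow> \<bar>z\<bar> \<le> 1"
  by (auto simp: in_sgn_def sgn_real_def split: if_splits)

text \<open>Monotonicity of the graph of \<open>sgn\<close>. For \<open>a = b\<close> the selections
  \<open>z1\<close> and \<open>z2\<close> may differ, but then \<open>s = t\<close> and the second
  factor vanishes.\<close>

lemma in_sgn_product_nonneg:
  assumes "in_sgn z1 a" "in_sgn z2 b" "s - t = a - b" "1 \<le> p"
  shows "0 \<le> (z1 - z2) * (jp p s - jp p t)"
proof -
  consider "a = b" | "b < a" | "a < b" by linarith
  then show ?thesis
  proof cases
    case 1
    then show ?thesis using assms by simp
  next
    case 2
    then have "z2 \<le> z1" using assms(1,2) by (auto simp: in_sgn_def sgn_real_def split: if_splits)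
    then show ?thesis using jp_mono[of p t s] assms 2 by (intro mult_nonneg_nonneg) auto
  next
    case 3
    then have "z1 \<le> z2" using assms(1,2) by (auto simp: in_sgn_def sgn_real_def split: if_splits)
    then show ?thesis using jp_mono[of p s t] assms 3 by (intro mult_nonpos_nonpos) auto
  qed
qed

text \<open>The splitting \<open>\<phi> x - \<phi> y = (\<eta> x + \<eta> y) / 2 * (g s - g t) + (\<eta> x - \<eta> y) / 2 * (g s + g t)\<close>
  isolates the coercive part; the second summand carries the smallness of \<open>\<eta> x - \<eta> y\<close>.\<close>

lemma caccioppoli_pointwise:
  fixes \<eta>x \<eta>y k1 k2 Q :: real
  assumes p: "1 < p" "p \<le> 2" and \<delta>: "1 \<le> \<delta>" and eq: "s - t = a - b"
    and z: "in_sgn z1 a" "in_sgn z2 b"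
    and \<eta>: "0 \<le> \<eta>x" "0 \<le> \<eta>y" and k: "0 \<le> k1" "0 \<le> k2"
    and Q: "\<bar>jp p a\<bar> \<le> Q" "\<bar>jp p b\<bar> \<le> Q"
  shows "k2 * ((\<eta>x + \<eta>y) / 2 * ((p - 1) * 2 powr (- \<delta>) * ((\<bar>a\<bar> + \<bar>b\<bar>) powr (p - 2) * \<bar>a - b\<bar> powr (\<delta> + 1))))
    \<le> (z1 - z2) * (\<eta>x * jp (\<delta> + 1) s - \<eta>y * jp (\<delta> + 1) t) * k1
      + (jp p a - jp p b) * (\<eta>x * jp (\<delta> + 1) s - \<eta>y * jp (\<delta> + 1) t) * k2
      + (k1 + Q * k2) * (\<bar>\<eta>x - \<eta>y\<bar> * (\<bar>s\<bar> powr \<delta> + \<bar>t\<bar> powr \<delta>))"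
proof -
  define gs where "gs = jp (\<delta> + 1) s"
  define gt where "gt = jp (\<delta> + 1) t"
  define X where "X = \<bar>\<eta>x - \<eta>y\<bar> * (\<bar>s\<bar> powr \<delta> + \<bar>t\<bar> powr \<delta>)"
  define E where "E = (p - 1) * 2 powr (- \<delta>) * ((\<bar>a\<bar> + \<bar>b\<bar>) powr (p - 2) * \<bar>a - b\<bar> powr (\<delta> + 1))"
  have split: "\<eta>x * gs - \<eta>y * gt = (\<eta>x + \<eta>y) / 2 * (gs - gt) + (\<eta>x - \<eta>y) / 2 * (gs + gt)"
    by (simp add: field_simps)
  have "\<bar>gs + gt\<bar> \<le> \<bar>s\<bar> powr \<delta> + \<bar>t\<bar> powr \<delta>"
    using abs_triangle_ineq[of gs gt] by (simp add: gs_def gt_def abs_jp)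
  then have err: "\<bar>(\<eta>x - \<eta>y) / 2 * (gs + gt)\<bar> \<le> X / 2"
    by (simp add: X_def abs_mult mult_left_mono)
  \<comment> \<open>The cutoff error against a coefficient of size at most \<open>2 * c\<close>:
    \<open>c = 1\<close> for \<open>z1 - z2\<close>, and \<open>c = Q\<close> for the difference of
    the fluxes.\<close>
  have err': "- (c * X) \<le> m * ((\<eta>x - \<eta>y) / 2 * (gs + gt))" if "\<bar>m\<bar> \<le> 2 * c" for m c
  proof -
    have "\<bar>m * ((\<eta>x - \<eta>y) / 2 * (gs + gt))\<bar> \<le> (2 * c) * (X / 2)"
      unfolding abs_mult[of m] using that by (intro mult_mono err) auto
    then show ?thesis by (simp add: abs_le_iff)
  qed
  have 1: "0 \<le> (\<eta>x + \<eta>y) / 2 * ((z1 - z2) * (gs - gt))"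
    unfolding gs_def gt_def using in_sgn_product_nonneg[OF z eq, of "\<delta> + 1"] \<eta> \<delta> by simp
  have 2: "(\<eta>x + \<eta>y) / 2 * E \<le> (\<eta>x + \<eta>y) / 2 * ((jp p a - jp p b) * (gs - gt))"
    unfolding gs_def gt_def E_def using \<eta> by (intro mult_left_mono jp_product_ge p \<delta> eq) auto
  have "- (1 * X) \<le> (z1 - z2) * ((\<eta>x - \<eta>y) / 2 * (gs + gt))"
    using in_sgn_abs_le[OF z(1)] in_sgn_abs_le[OF z(2)] by (intro err') auto
  with 1 have A: "- X \<le> (z1 - z2) * (\<eta>x * gs - \<eta>y * gt)"
    unfolding split by (simp add: distrib_left mult.left_commute)
  have "- (Q * X) \<le> (jp p a - jp p b) * ((\<eta>x - \<eta>y) / 2 * (gs + gt))"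
    using Q by (intro err') auto
  with 2 have B: "(\<eta>x + \<eta>y) / 2 * E - Q * X \<le> (jp p a - jp p b) * (\<eta>x * gs - \<eta>y * gt)"
    unfolding split by (simp add: distrib_left mult.left_commute)
  have "- X * k1 \<le> (z1 - z2) * (\<eta>x * gs - \<eta>y * gt) * k1"
    by (rule mult_right_mono[OF A k(1)])
  moreover have "((\<eta>x + \<eta>y) / 2 * E - Q * X) * k2 \<le> (jp p a - jp p b) * (\<eta>x * gs - \<eta>y * gt) * k2"
    by (rule mult_right_mono[OF B k(2)])
  ultimately have "k2 * ((\<eta>x + \<eta>y) / 2 * E) \<le> (z1 - z2) * (\<eta>x * gs - \<eta>y * gt) * k1
      + (jp p a - jp p b) * (\<eta>x * gs - \<eta>y * gt) * k2 + (k1 + Q * k2) * X"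
    by (simp add: algebra_simps)
  then show ?thesis unfolding gs_def gt_def X_def E_def .
qed

section \<open>Admissible test functions\<close>

lemma gagliardo_int_mono_set:
  "U \<subseteq> V \<Longrightarrow> gagliardo_int \<gamma> q U w \<le> gagliardo_int \<gamma> q V w"
  unfolding gagliardo_int_alt by (intro nn_integral_mono) (auto simp: indicator_def)

lemma gagliardo_int_translation:
  fixes w :: "'a::euclidean_space \<Rightarrow> real" and h :: 'a
  assumes [measurable]: "w \<in> borel_measurable lebesgue"
  shows "gagliardo_int \<gamma> q (ball c \<rho>) (\<lambda>x. w (x + h)) = gagliardo_int \<gamma> q (ball (c + h) \<rho>) w"
proof -
  define f where "f z = indicator (ball (c + h) \<rho>) (fst z) * indicator (ball (c + h) \<rho>) (snd z) *
      ennreal (\<bar>w (fst z) - w (snd z)\<bar> powr q / norm (fst z - snd z) powr (real DIM('a) + \<gamma> * q))" for z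
  have f: "f \<in> borel_measurable leb2" unfolding f_def[abs_def] by measurable
  have i: "indicator (ball (c + h) \<rho>) (x + h) = (indicator (ball c \<rho>) x :: ennreal)" for x
    by (simp add: indicator_def dist_norm)
  show ?thesis
    unfolding gagliardo_int_alt using nn_integral_leb2_translation[OF f, of h h]
    by (simp add: f_def i)
qed

text \<open>If the kernel is nonzero at a pair not contained in the enlarged ball, one point lies in
  the small ball and the other outside the enlarged one, hence at distance at least
  \<open>d\<close>. By symmetry the two far contributions agree, whence the factor 2.\<close>

lemma nn_integral_near_far_le:
  fixes K :: "'a::euclidean_space \<times> 'a \<Rightarrow> ennreal"
  assumes K [measurable]: "K \<in> borel_measurable leb2"
    and sym: "\<And>x y. K (x, y) = K (y, x)"
    and supp: "\<And>x y. x \<notin> ball c \<rho> \<Longrightarrow> y \<notin> ball c \<rho> \<Longrightarrow> K (x, y) = 0"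
    and d: "0 \<le> d"
  shows "(\<integral>\<^sup>+z. K z \<partial>leb2)
    \<le> (\<integral>\<^sup>+z. indicator (ball c (\<rho> + d)) (fst z) * indicator (ball c (\<rho> + d)) (snd z) * K z \<partial>leb2)
      + 2 * (\<integral>\<^sup>+x. indicator (ball c \<rho>) x * (\<integral>\<^sup>+y. indicator (- ball x d) y * K (x, y) \<partial>lebesgue) \<partial>lebesgue)"
proof -
  define B where "B = ball c \<rho>"
  define B' where "B' = ball c (\<rho> + d)"
  define A where "A = {z :: 'a \<times> 'a. d \<le> dist (fst z) (snd z)}"
  have [measurable]: "Measurable.pred leb2 (\<lambda>z. z \<in> A)" "Measurable.pred leb2 (\<lambda>z. fst z \<in> B)" "Measurable.pred leb2 (\<lambda>z. snd z \<in> B)"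
     "Measurable.pred leb2 (\<lambda>z. fst z \<in> B')" "Measurable.pred leb2 (\<lambda>z. snd z \<in> B')"
    unfolding A_def B_def B'_def by measurable
  define K1 where "K1 z = indicator B (fst z) * (indicator A z * K z)" for z
  define K2 where "K2 z = indicator B (snd z) * (indicator A z * K z)" for z
  have [measurable]: "K1 \<in> borel_measurable leb2" "K2 \<in> borel_measurable leb2"
    unfolding K1_def[abs_def] K2_def[abs_def] by measurable
  have le: "K z \<le> indicator B' (fst z) * indicator B' (snd z) * K z + (K1 z + K2 z)" for z
  proof -
    obtain x y where z: "z = (x, y)" by force
    have far: "d \<le> dist x y" if "x \<in> B" "y \<notin> B'" for x y
      using that dist_triangle[of c y x] by (auto simp: B_def B'_def)
    have sub: "x \<in> B'" if "x \<in> B" for x using that d by (auto simp: B_def B'_def)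
    consider "x \<in> B'" "y \<in> B'" | "x \<in> B" "y \<notin> B'" | "y \<in> B" "x \<notin> B'" | "x \<notin> B" "y \<notin> B"
      using sub by blast
    then show ?thesis
    proof cases
      case 2
      then show ?thesis using far[of x y] sub by (simp add: z K1_def A_def)
    next
      case 3
      then show ?thesis using far[of y x] sub by (simp add: z K2_def A_def dist_commute)
    next
      case 4
      then show ?thesis using supp[of x y] by (simp add: z B_def)
    qed (simp add: z)
  qed
  have e1: "(\<integral>\<^sup>+z. K1 z \<partial>leb2) = (\<integral>\<^sup>+x. indicator B x * (\<integral>\<^sup>+y. indicator (- ball x d) y * K (x, y) \<partial>lebesgue) \<partial>lebesgue)"
  proof -
    have "(\<integral>\<^sup>+z. K1 z \<partial>leb2) = (\<integral>\<^sup>+x. \<integral>\<^sup>+y. K1 (x, y) \<partial>lebesgue \<partial>lebesgue)"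
      by (rule leb.nn_integral_fst[symmetric]) measurable
    also have "\<dots> = (\<integral>\<^sup>+x. indicator B x * (\<integral>\<^sup>+y. indicator (- ball x d) y * K (x, y) \<partial>lebesgue) \<partial>lebesgue)"
      by (intro nn_integral_cong) (auto simp: K1_def A_def indicator_def intro!: nn_integral_cong)
    finally show ?thesis .
  qed
  have e2: "(\<integral>\<^sup>+z. K2 z \<partial>leb2) = (\<integral>\<^sup>+z. K1 z \<partial>leb2)"
  proof -
    have "(\<integral>\<^sup>+z. K2 z \<partial>leb2) = (\<integral>\<^sup>+y. \<integral>\<^sup>+x. K2 (x, y) \<partial>lebesgue \<partial>lebesgue)"
      by (rule leb_pair.nn_integral_snd[symmetric]) measurable
    also have "\<dots> = (\<integral>\<^sup>+y. \<integral>\<^sup>+x. K1 (y, x) \<partial>lebesgue \<partial>lebesgue)"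
      by (intro nn_integral_cong) (auto simp: K1_def K2_def A_def indicator_def dist_commute sym)
    also have "\<dots> = (\<integral>\<^sup>+z. K1 z \<partial>leb2)" by (rule leb.nn_integral_fst) measurable
    finally show ?thesis .
  qed
  have "(\<integral>\<^sup>+z. K z \<partial>leb2) \<le> (\<integral>\<^sup>+z. indicator B' (fst z) * indicator B' (snd z) * K z + (K1 z + K2 z) \<partial>leb2)"
    by (rule nn_integral_mono) (rule le)
  also have "\<dots> = (\<integral>\<^sup>+z. indicator B' (fst z) * indicator B' (snd z) * K z \<partial>leb2) + ((\<integral>\<^sup>+z. K1 z \<partial>leb2) + (\<integral>\<^sup>+z. K2 z \<partial>leb2))"
    by (subst nn_integral_add, measurable, subst nn_integral_add, measurable)
  also have "(\<integral>\<^sup>+z. K1 z \<partial>leb2) + (\<integral>\<^sup>+z. K2 z \<partial>leb2) = 2 * (\<integral>\<^sup>+z. K1 z \<partial>leb2)"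
    unfolding e2 by (rule mult_2[symmetric])
  finally show ?thesis unfolding e1 unfolding B_def B'_def .
qed

lemma ennreal_mult_less_infinity:
  fixes a b :: ennreal
  shows "a < \<infinity> \<Longrightarrow> b < \<infinity> \<Longrightarrow> a * b < \<infinity>"
  using ennreal_mult_less_top by auto

text \<open>Global membership from a local seminorm: at distance at least \<open>d\<close> the
  increments of \<open>\<psi>\<close> are at most \<open>2 * K\<close>, and the kernel is integrable
  there because \<open>\<gamma> > 0\<close>.\<close>

lemma in_W_of_support:
  fixes \<psi> :: "'a::euclidean_space \<Rightarrow> real"
  assumes \<psi> [measurable]: "\<psi> \<in> borel_measurable lebesgue"
    and supp: "\<And>x. x \<notin> ball c \<rho> \<Longrightarrow> \<psi> x = 0" and bd: "\<And>x. \<bar>\<psi> x\<bar> \<le> K"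
    and \<gamma>: "0 < \<gamma>" and q: "1 \<le> q" and d: "0 < d" "d \<le> 1" and \<rho>: "0 \<le> \<rho>"
    and G: "gagliardo_int \<gamma> q (ball c (\<rho> + d)) \<psi> < \<infinity>"
  shows "in_W \<gamma> q UNIV \<psi>"
proof -
  define \<beta> where "\<beta> = real DIM('a) + \<gamma> * q"
  have K: "K \<ge> 0" using bd[of c] by simp
  have "set_integrable lebesgue UNIV (\<lambda>x. \<bar>\<psi> x\<bar> powr q)"
    unfolding set_integrable_def
  proof (rule integrableI_bounded)
    have "(\<integral>\<^sup>+x. ennreal (norm (indicat_real UNIV x *\<^sub>R \<bar>\<psi> x\<bar> powr q)) \<partial>lebesgue)
        \<le> (\<integral>\<^sup>+x. ennreal (K powr q) * indicator (ball c \<rho>) x \<partial>lebesgue)"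
    proof (rule nn_integral_mono)
      fix x
      have "\<bar>\<psi> x\<bar> powr q \<le> K powr q" using bd q by (intro powr_mono2) auto
      then show "ennreal (norm (indicat_real UNIV x *\<^sub>R \<bar>\<psi> x\<bar> powr q)) \<le> ennreal (K powr q) * indicator (ball c \<rho>) x"
        using supp[of x] by (cases "x \<in> ball c \<rho>") (auto simp: ennreal_leI)
    qed
    also have "\<dots> = ennreal (K powr q) * emeasure lebesgue (ball c \<rho>)"
      by (rule nn_integral_cmult_indicator) simp
    also have "\<dots> < \<infinity>"
      unfolding emeasure_lebesgue_ball[OF \<rho>] by (intro ennreal_mult_less_infinity) auto
    finally show "(\<integral>\<^sup>+x. ennreal (norm (indicat_real UNIV x *\<^sub>R \<bar>\<psi> x\<bar> powr q)) \<partial>lebesgue) < \<infinity>" .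
  qed measurable
  moreover have "gagliardo_int \<gamma> q UNIV \<psi> < \<infinity>"
  proof -
    define g where "g z = ennreal (\<bar>\<psi> (fst z) - \<psi> (snd z)\<bar> powr q / norm (fst z - snd z) powr \<beta>)" for z
    have [measurable]: "g \<in> borel_measurable leb2" unfolding g_def[abs_def] by measurable
    have "real DIM('a) < \<beta>" using \<gamma> q by (simp add: \<beta>_def)
    note far = far_kernel_bound[OF this]
    define C where "C = far_const TYPE('a) \<beta>"
    have inner: "(\<integral>\<^sup>+y. indicator (- ball x d) y * g (x, y) \<partial>lebesgue) \<le> ennreal ((2 * K) powr q) * ennreal (C / d powr \<beta>)" for x
    proof -
      have "(\<integral>\<^sup>+y. indicator (- ball x d) y * g (x, y) \<partial>lebesgue)
        \<le> (\<integral>\<^sup>+y. ennreal ((2 * K) powr q) * (indicator (- ball x d) y * ennreal (1 / norm (x - y) powr \<beta>)) \<partial>lebesgue)"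
      proof (rule nn_integral_mono)
        fix y
        have "\<bar>\<psi> x - \<psi> y\<bar> powr q \<le> (2 * K) powr q"
          using bd[of x] bd[of y] q by (intro powr_mono2) auto
        then have "g (x, y) \<le> ennreal ((2 * K) powr q * (1 / norm (x - y) powr \<beta>))"
          unfolding g_def by (intro ennreal_leI) (simp add: divide_right_mono)
        also have "\<dots> = ennreal ((2 * K) powr q) * ennreal (1 / norm (x - y) powr \<beta>)"
          by (rule ennreal_mult) auto
        finally show "indicator (- ball x d) y * g (x, y)
          \<le> ennreal ((2 * K) powr q) * (indicator (- ball x d) y * ennreal (1 / norm (x - y) powr \<beta>))"
          by (cases "y \<in> ball x d") auto
      qed
      also have "\<dots> = ennreal ((2 * K) powr q) * (\<integral>\<^sup>+y. indicator (- ball x d) y * ennreal (1 / norm (x - y) powr \<beta>) \<partial>lebesgue)"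
        by (rule nn_integral_cmult) (rule measurable_completion, measurable)
      also have "\<dots> \<le> ennreal ((2 * K) powr q) * ennreal (C / d powr \<beta>)"
        unfolding C_def by (intro mult_left_mono far d) auto
      finally show ?thesis .
    qed
    have "gagliardo_int \<gamma> q UNIV \<psi> = (\<integral>\<^sup>+z. g z \<partial>leb2)"
      unfolding gagliardo_int_def g_def \<beta>_def by simp
    also have "\<dots> \<le> (\<integral>\<^sup>+z. indicator (ball c (\<rho> + d)) (fst z) * indicator (ball c (\<rho> + d)) (snd z) * g z \<partial>leb2)
      + 2 * (\<integral>\<^sup>+x. indicator (ball c \<rho>) x * (\<integral>\<^sup>+y. indicator (- ball x d) y * g (x, y) \<partial>lebesgue) \<partial>lebesgue)"
      using d supp by (intro nn_integral_near_far_le) (auto simp: g_def abs_minus_commute norm_minus_commute)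
    also have "\<dots> \<le> gagliardo_int \<gamma> q (ball c (\<rho> + d)) \<psi>
      + 2 * (\<integral>\<^sup>+x. (ennreal ((2 * K) powr q) * ennreal (C / d powr \<beta>)) * indicator (ball c \<rho>) x \<partial>lebesgue)"
      unfolding gagliardo_int_alt g_def[symmetric] \<beta>_def[symmetric]
    proof (intro add_mono mult_left_mono nn_integral_mono)
      fix x
      show "indicator (ball c \<rho>) x * (\<integral>\<^sup>+y. indicator (- ball x d) y * g (x, y) \<partial>lebesgue)
        \<le> (ennreal ((2 * K) powr q) * ennreal (C / d powr \<beta>)) * indicator (ball c \<rho>) x"
        using inner[of x] by (cases "x \<in> ball c \<rho>") simp_all
    qed auto
    also have "\<dots> < \<infinity>"
    proof -
      have "(\<integral>\<^sup>+x. (ennreal ((2 * K) powr q) * ennreal (C / d powr \<beta>)) * indicator (ball c \<rho>) x \<partial>lebesgue) < \<infinity>"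
        by (subst nn_integral_cmult_indicator, simp)
          (simp only: emeasure_lebesgue_ball[OF \<rho>], intro ennreal_mult_less_infinity, auto)
      then show ?thesis using G ennreal_mult_less_top by auto
    qed
    finally show ?thesis .
  qed
  ultimately show ?thesis by (simp add: in_W_def in_Lq_def)
qed

text \<open>The three increments are integrated separately. The linear one has finite seminorm
  because \<open>\<gamma> < 1\<close> leaves the exponent \<open>\<beta> - q\<close> below the
  dimension.\<close>

lemma gagliardo_finite_of_increment_bound:
  fixes u \<psi> :: "'a::euclidean_space \<Rightarrow> real"
  assumes u [measurable]: "u \<in> borel_measurable lebesgue"
    and \<gamma>: "\<gamma> < 1" and q: "1 \<le> q" and \<rho>: "0 \<le> \<rho>" "\<rho> \<le> 1" and A: "0 \<le> A"
    and le: "\<And>x y. \<bar>\<psi> x - \<psi> y\<bar> \<le> A * (\<bar>u (x + h) - u (y + h)\<bar> + \<bar>u x - u y\<bar> + norm (x - y))"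
    and G1: "gagliardo_int \<gamma> q (ball (c + h) \<rho>) u < \<infinity>"
    and G2: "gagliardo_int \<gamma> q (ball c \<rho>) u < \<infinity>"
  shows "gagliardo_int \<gamma> q (ball c \<rho>) \<psi> < \<infinity>"
proof -
  define \<beta> where "\<beta> = real DIM('a) + \<gamma> * q"
  define B where "B = ball c \<rho>"
  define g where "g v z = indicator B (fst z) * indicator B (snd z) *
      ennreal (\<bar>v (fst z) - v (snd z)\<bar> powr q / norm (fst z - snd z) powr \<beta>)" for v :: "'a \<Rightarrow> real" and z
  define k where "k z = indicator B (fst z) * indicator B (snd z) * ennreal (1 / norm (fst z - snd z) powr (\<beta> - q))" for z
  define A' where "A' = A powr q * (4 powr q)"
  have [measurable]: "(\<lambda>z. g (\<lambda>x. u (x + h)) z) \<in> borel_measurable leb2" "(\<lambda>z. g u z) \<in> borel_measurable leb2"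
    "k \<in> borel_measurable leb2"
    unfolding g_def B_def k_def[abs_def] by measurable
  have "\<beta> - q < real DIM('a)" using \<gamma> q by (simp add: \<beta>_def)
  note near = near_kernel_bound[OF this]
  define C where "C = near_const TYPE('a) (\<beta> - q)"
  have le': "g \<psi> z \<le> ennreal A' * (g (\<lambda>x. u (x + h)) z + g u z + k z)" for z
  proof -
    obtain x y where z: "z = (x, y)" by force
    define a where "a = \<bar>u (x + h) - u (y + h)\<bar>"
    define b where "b = \<bar>u x - u y\<bar>"
    define e where "e = norm (x - y)"
    have nn: "0 \<le> a" "0 \<le> b" "0 \<le> e" by (auto simp: a_def b_def e_def)
    have "\<bar>\<psi> x - \<psi> y\<bar> powr q \<le> (A * (a + b + e)) powr q"
      using le[of x y] q unfolding a_def b_def e_def by (intro powr_mono2) auto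
    also have "\<dots> = A powr q * (a + b + e) powr q" by (rule powr_mult)
    also have "\<dots> \<le> A powr q * (2 powr q * (2 powr q * (a powr q + b powr q) + e powr q))"
      using nn q powr_add_le[of "a + b" e q] powr_add_le[of a b q]
      by (intro mult_left_mono order_trans[OF powr_add_le] add_mono) auto
    also have "\<dots> \<le> A powr q * (2 powr q * (2 powr q * (a powr q + b powr q) + 2 powr q * e powr q))"
      using q ge_one_powr_ge_zero[of 2 q] mult_right_mono[of 1 "2 powr q" "e powr q"]
      by (intro mult_left_mono add_mono) auto
    also have "\<dots> = A' * (a powr q + b powr q + e powr q)"
      by (simp add: A'_def algebra_simps flip: powr_mult)
    finally have "\<bar>\<psi> x - \<psi> y\<bar> powr q / e powr \<beta> \<le> A' * (a powr q + b powr q + e powr q) / e powr \<beta>"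
      by (rule divide_right_mono) simp
    also have "\<dots> = A' * (a powr q / e powr \<beta> + b powr q / e powr \<beta> + 1 / e powr (\<beta> - q))"
      by (simp add: powr_diff add_divide_distrib[symmetric])
    finally have "ennreal (\<bar>\<psi> x - \<psi> y\<bar> powr q / e powr \<beta>)
       \<le> ennreal (A' * (a powr q / e powr \<beta> + b powr q / e powr \<beta> + 1 / e powr (\<beta> - q)))" by (rule ennreal_leI)
    also have "\<dots> = ennreal A' * (ennreal (a powr q / e powr \<beta>) + ennreal (b powr q / e powr \<beta>) + ennreal (1 / e powr (\<beta> - q)))"
      by (subst ennreal_mult) (auto simp: A'_def)
    finally show ?thesis
      by (cases "x \<in> B \<and> y \<in> B") (auto simp: g_def k_def z a_def b_def e_def)
  qed
  have kfin: "(\<integral>\<^sup>+z. k z \<partial>leb2) < \<infinity>"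
  proof -
    have "(\<integral>\<^sup>+z. k z \<partial>leb2) = (\<integral>\<^sup>+x. \<integral>\<^sup>+y. k (x, y) \<partial>lebesgue \<partial>lebesgue)"
      by (rule leb.nn_integral_fst[symmetric]) measurable
    also have "\<dots> \<le> (\<integral>\<^sup>+x. ennreal C * indicator B x \<partial>lebesgue)"
    proof (rule nn_integral_mono)
      fix x
      show "(\<integral>\<^sup>+y. k (x, y) \<partial>lebesgue) \<le> ennreal C * indicator B x"
      proof (cases "x \<in> B")
        case True
        have "y \<in> ball x 2" if "y \<in> B" for y
          using that True \<rho> dist_triangle3[of x y c] by (auto simp: B_def)
        then have "(\<integral>\<^sup>+y. k (x, y) \<partial>lebesgue) \<le> (\<integral>\<^sup>+ y. indicator (ball x 2) y * ennreal (1 / norm (x - y) powr (\<beta> - q)) \<partial>lebesgue)"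
          by (intro nn_integral_mono) (auto simp: k_def indicator_def)
        also note near[of x, folded C_def]
        finally show ?thesis using True by simp
      qed (simp add: k_def)
    qed
    also have "\<dots> = ennreal C * emeasure lebesgue B"
      unfolding B_def by (rule nn_integral_cmult_indicator) simp
    also have "\<dots> < \<infinity>"
      unfolding B_def emeasure_lebesgue_ball[OF \<rho>(1)] by (intro ennreal_mult_less_infinity) auto
    finally show ?thesis .
  qed
  have "gagliardo_int \<gamma> q (ball c \<rho>) \<psi> = (\<integral>\<^sup>+z. g \<psi> z \<partial>leb2)"
    unfolding gagliardo_int_alt g_def B_def \<beta>_def ..
  also have "\<dots> \<le> (\<integral>\<^sup>+z. ennreal A' * (g (\<lambda>x. u (x + h)) z + g u z + k z) \<partial>leb2)"
    by (rule nn_integral_mono) (rule le')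
  also have "\<dots> = ennreal A' * ((\<integral>\<^sup>+z. g (\<lambda>x. u (x + h)) z \<partial>leb2) + (\<integral>\<^sup>+z. g u z \<partial>leb2) + (\<integral>\<^sup>+z. k z \<partial>leb2))"
    by (subst nn_integral_cmult, measurable, subst nn_integral_add, measurable, subst nn_integral_add, measurable)
  also have "(\<integral>\<^sup>+z. g (\<lambda>x. u (x + h)) z \<partial>leb2) = gagliardo_int \<gamma> q (ball (c + h) \<rho>) u"
    unfolding gagliardo_int_translation[OF u, symmetric] unfolding gagliardo_int_alt g_def B_def \<beta>_def ..
  also have "(\<integral>\<^sup>+z. g u z \<partial>leb2) = gagliardo_int \<gamma> q (ball c \<rho>) u"
    unfolding gagliardo_int_alt g_def B_def \<beta>_def ..
  also have "ennreal A' * (gagliardo_int \<gamma> q (ball (c + h) \<rho>) u + gagliardo_int \<gamma> q (ball c \<rho>) u + (\<integral>\<^sup>+z. k z \<partial>leb2)) < \<infinity>"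
    using G1 G2 kfin by (intro ennreal_mult_less_infinity) auto
  finally show ?thesis .
qed

section \<open>Solutions on a ball: control of the tail and admissibility of test functions\<close>

text \<open>The common shape of both terms of the weak formulation: coefficient \<open>Z\<close>
  with exponent \<open>N + s1\<close>, and coefficient \<open>flux p u\<close> with exponent
  \<open>N + sp p\<close>.\<close>

definition pairing :: "('a::euclidean_space \<times> 'a \<Rightarrow> real) \<Rightarrow> real \<Rightarrow> ('a \<Rightarrow> real) \<Rightarrow> 'a \<times> 'a \<Rightarrow> real"
  where "pairing A b \<phi> z = A z * (\<phi> (fst z) - \<phi> (snd z)) / norm (fst z - snd z) powr b"

definition flux :: "real \<Rightarrow> ('a::euclidean_space \<Rightarrow> real) \<Rightarrow> 'a \<times> 'a \<Rightarrow> real"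
  where "flux p u z = jp p (u (fst z) - u (snd z))"

lemma jp_measurable [measurable]: "jp q \<in> borel_measurable borel"
  unfolding jp_def[abs_def] by measurable

lemma flux_measurable [measurable]:
  assumes [measurable]: "u \<in> borel_measurable lebesgue"
  shows "flux p u \<in> borel_measurable leb2"
  unfolding flux_def[abs_def] by measurable

lemma pairing_measurable [measurable]:
  assumes [measurable]: "A \<in> borel_measurable leb2" "\<phi> \<in> borel_measurable lebesgue"
  shows "pairing A b \<phi> \<in> borel_measurable leb2"
  unfolding pairing_def[abs_def] by measurable

text \<open>What the estimates use about \<open>u\<close> on one ball; the domain enters no longer,
  as test functions vanish outside the ball. The one bound \<open>M\<close> dominates sup norm,
  seminorm and tail, each to its own power, so every estimate is a power of \<open>M\<close> and of
  the width of an annulus times a constant depending only on exponents and dimension.\<close>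

locale local_solution =
  fixes s1 sp p :: real and u :: "'a::euclidean_space \<Rightarrow> real" and x0 :: 'a and R M :: real
    and Z :: "'a \<times> 'a \<Rightarrow> real"
  assumes s1: "0 < s1" "s1 < 1" and p: "1 < p" "p < 2" and sp: "0 < sp" "sp * p < 1"
    and u_measurable [measurable]: "u \<in> borel_measurable lebesgue"
    and R: "0 < R" "R < 1" and M: "1 \<le> M"
    and u_bounded: "AE x in lebesgue. x \<in> ball x0 R \<longrightarrow> \<bar>u x\<bar> \<le> M"
    and gagliardo_1: "gagliardo_int s1 1 (ball x0 R) u < \<infinity>"
    and gagliardo_p: "gagliardo_int sp p (ball x0 R) u \<le> ennreal (M powr p)"
    and tail: "(\<integral>\<^sup>+y. indicator (- ball x0 R) y *
        ennreal (\<bar>u y\<bar> powr (p - 1) / norm (y - x0) powr (real DIM('a) + sp * p)) \<partial>lebesgue)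
      \<le> ennreal (M powr (p - 1) / R powr (sp * p))"
    and Z_measurable [measurable]: "Z \<in> borel_measurable leb2"
    and Z_sgn: "AE z in leb2. in_sgn (Z z) (u (fst z) - u (snd z))"
    and weak: "\<And>\<phi>. in_W s1 1 UNIV \<phi> \<Longrightarrow> in_W sp p UNIV \<phi> \<Longrightarrow> (\<And>x. x \<notin> ball x0 R \<Longrightarrow> \<phi> x = 0) \<Longrightarrow>
      integrable leb2 (pairing Z (real DIM('a) + s1) \<phi>) \<Longrightarrow>
      integrable leb2 (pairing (flux p u) (real DIM('a) + sp * p) \<phi>) \<Longrightarrow>
      integral\<^sup>L leb2 (pairing Z (real DIM('a) + s1) \<phi>)
      + integral\<^sup>L leb2 (pairing (flux p u) (real DIM('a) + sp * p) \<phi>) = 0"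
begin

definition "\<beta>1 = real DIM('a) + s1"
definition "\<beta> = real DIM('a) + sp * p"
definition "vol = unit_ball_vol (real DIM('a))"

lemma vol_nonneg: "0 \<le> vol" by (simp add: vol_def)

lemma \<beta>_pos: "0 < \<beta>" using sp p by (simp add: \<beta>_def add_nonneg_pos)

lemma exponent_bounds:
  "\<beta>1 - 1 < real DIM('a)" "\<beta> - 1 < real DIM('a)" "real DIM('a) < \<beta>1" "real DIM('a) < \<beta>"
  using s1 sp p by (auto simp: \<beta>1_def \<beta>_def)

text \<open>Moves the centre of the tail from \<open>x0\<close> to \<open>x\<close>. Inside the
  large ball the sup bound applies; outside, \<open>d * norm (y - x0) \<le> norm (x - y)\<close>
  compares the kernels at the cost \<open>d^(- \<beta>)\<close>. With
  \<open>R^(- sp p) \<le> d^(- sp p)\<close> this gives the exponent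
  \<open>\<beta> + sp p\<close>.\<close>

lemma tail_bound:
  assumes d: "0 < d" "d \<le> R" and x: "dist x0 x \<le> R - d"
  shows "(\<integral>\<^sup>+y. indicator (- ball x d) y * ennreal (\<bar>u y\<bar> powr (p - 1) / norm (x - y) powr \<beta>) \<partial>lebesgue)
    \<le> ennreal ((vol + 1) * M powr (p - 1) / d powr (\<beta> + sp * p))"
proof -
  define m where "m = M powr (p - 1)"
  have m: "m \<ge> 0" by (simp add: m_def)
  have d1: "d < 1" using d R by simp
  define T where "T y = indicator (- ball x0 R) y * ennreal (\<bar>u y\<bar> powr (p - 1) / norm (y - x0) powr \<beta>)" for y
  have [measurable]: "T \<in> borel_measurable lebesgue"
  proof -
    have [measurable]: "(\<lambda>y :: 'a. norm (y - x0) powr \<beta>) \<in> borel_measurable lebesgue" 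
      by (rule measurable_completion) measurable
    show ?thesis unfolding T_def[abs_def] by measurable
  qed
  have "(\<integral>\<^sup>+y. indicator (- ball x d) y * ennreal (\<bar>u y\<bar> powr (p - 1) / norm (x - y) powr \<beta>) \<partial>lebesgue)
    \<le> (\<integral>\<^sup>+y. ennreal (m / d powr \<beta>) * indicator (ball x0 R) y + ennreal (1 / d powr \<beta>) * T y \<partial>lebesgue)"
  proof (rule nn_integral_mono_AE)
    show "AE y in lebesgue. indicator (- ball x d) y * ennreal (\<bar>u y\<bar> powr (p - 1) / norm (x - y) powr \<beta>)
       \<le> ennreal (m / d powr \<beta>) * indicator (ball x0 R) y + ennreal (1 / d powr \<beta>) * T y"
      using u_bounded
    proof eventually_elim
      case (elim y)
      show ?case
      proof (cases "y \<in> ball x d")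
        case False
        then have dy: "d \<le> norm (x - y)" by (simp add: dist_norm)
        show ?thesis
        proof (cases "y \<in> ball x0 R")
          case True
          then have "\<bar>u y\<bar> powr (p - 1) / norm (x - y) powr \<beta> \<le> m / d powr \<beta>"
            unfolding m_def using elim p d dy \<beta>_pos by (intro frac_le powr_mono2) auto
          then show ?thesis using True False by (simp add: T_def ennreal_leI)
        next
          case F2: False
          have R1: "R \<le> norm (y - x0)" using F2 by (simp add: dist_norm norm_minus_commute)
          have "norm (y - x0) \<le> norm (x - y) + (R - d)"
            using x norm_triangle_ineq4[of "x - x0" "x - y"] by (simp add: dist_norm norm_minus_commute)
          \<comment> \<open>It suffices to compare at \<open>norm (y - x0) = R\<close>, where
            \<open>R - d \<le> (1 - d) * R\<close> because \<open>R < 1\<close>.\<close>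
          moreover have "d * norm (y - x0) \<le> norm (y - x0) - (R - d)"
          proof -
            have "(1 - d) * R \<le> (1 - d) * norm (y - x0)" using R1 d1 by (intro mult_left_mono) auto
            moreover have "R - d \<le> (1 - d) * R" using d R by (simp add: algebra_simps mult_left_le)
            ultimately show ?thesis by (simp add: algebra_simps)
          qed
          ultimately have "d * norm (y - x0) \<le> norm (x - y)" by simp
          then have "\<bar>u y\<bar> powr (p - 1) / norm (x - y) powr \<beta> \<le> \<bar>u y\<bar> powr (p - 1) / (d * norm (y - x0)) powr \<beta>"
            using d R R1 \<beta>_pos p by (intro frac_le powr_mono2) auto
          also have "\<dots> = 1 / d powr \<beta> * (\<bar>u y\<bar> powr (p - 1) / norm (y - x0) powr \<beta>)"
            by (simp add: powr_mult)
          finally have "ennreal (\<bar>u y\<bar> powr (p - 1) / norm (x - y) powr \<beta>)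
             \<le> ennreal (1 / d powr \<beta>) * ennreal (\<bar>u y\<bar> powr (p - 1) / norm (y - x0) powr \<beta>)"
            by (subst ennreal_mult[symmetric]) (auto intro: ennreal_leI)
          then show ?thesis using F2 False by (simp add: T_def)
        qed
      qed simp
    qed
  qed
  also have "\<dots> = ennreal (m / d powr \<beta>) * emeasure lebesgue (ball x0 R) + ennreal (1 / d powr \<beta>) * (\<integral>\<^sup>+y. T y \<partial>lebesgue)"
    by (subst nn_integral_add, measurable, subst nn_integral_cmult, measurable, subst nn_integral_cmult_indicator, simp_all)
  also have "\<dots> \<le> ennreal (m / d powr \<beta>) * ennreal vol + ennreal (1 / d powr \<beta>) * ennreal (m / R powr (sp * p))"
  proof (intro add_mono mult_left_mono)
    show "emeasure lebesgue (ball x0 R) \<le> ennreal vol"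
    proof -
      have "vol * R powr real DIM('a) \<le> vol"
        using R vol_nonneg powr_le1[of "real DIM('a)" R] by (intro mult_left_le) auto
      then show ?thesis
        using emeasure_lebesgue_ball[of R x0] R by (simp add: vol_def ennreal_leI del: emeasure_completion)
    qed
    show "(\<integral>\<^sup>+y. T y \<partial>lebesgue) \<le> ennreal (m / R powr (sp * p))"
      using tail by (simp add: T_def m_def \<beta>_def)
  qed auto
  also have "\<dots> = ennreal (m / d powr \<beta> * vol + 1 / d powr \<beta> * (m / R powr (sp * p)))"
    using m vol_nonneg by (subst (1 2) ennreal_mult[symmetric]) auto
  also have "\<dots> \<le> ennreal ((vol + 1) * m / d powr (\<beta> + sp * p))"
  proof (rule ennreal_leI)
    have a: "1 / d powr \<beta> \<le> 1 / d powr (\<beta> + sp * p)"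
      using d d1 sp p by (intro divide_left_mono powr_mono') auto
    have b: "1 / d powr \<beta> * (1 / R powr (sp * p)) \<le> 1 / d powr (\<beta> + sp * p)"
    proof -
      have "d powr (\<beta> + sp * p) \<le> d powr \<beta> * R powr (sp * p)"
        unfolding powr_add using d sp p by (intro mult_left_mono powr_mono2) auto
      then show ?thesis using d R by (simp add: divide_left_mono)
    qed
    have "m / d powr \<beta> * vol + 1 / d powr \<beta> * (m / R powr (sp * p))
      = (m * vol) * (1 / d powr \<beta>) + m * (1 / d powr \<beta> * (1 / R powr (sp * p)))" by simp
    also have "\<dots> \<le> (m * vol) * (1 / d powr (\<beta> + sp * p)) + m * (1 / d powr (\<beta> + sp * p))"
      using m vol_nonneg by (intro add_mono mult_left_mono a b) auto
    also have "\<dots> = (vol + 1) * m / d powr (\<beta> + sp * p)"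
      by (simp add: add_divide_distrib[symmetric] algebra_simps)
    finally show "m / d powr \<beta> * vol + 1 / d powr \<beta> * (m / R powr (sp * p)) \<le> (vol + 1) * m / d powr (\<beta> + sp * p)" .
  qed
  finally show ?thesis unfolding m_def .
qed

lemma abs_jp_diff_le: "\<bar>jp p (a - b)\<bar> \<le> \<bar>a\<bar> powr (p - 1) + \<bar>b\<bar> powr (p - 1)"
proof -
  have "\<bar>jp p (a - b)\<bar> \<le> (\<bar>a\<bar> + \<bar>b\<bar>) powr (p - 1)"
    unfolding abs_jp using p by (intro powr_mono2) auto
  also have "\<dots> \<le> \<bar>a\<bar> powr (p - 1) + \<bar>b\<bar> powr (p - 1)"
    using p by (intro powr_subadditive) auto
  finally show ?thesis .
qed

lemma kernel_measurable [measurable]: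
  "(\<lambda>y. norm (x - y) powr b) \<in> borel_measurable lebesgue" for x :: 'a and b :: real
  by (rule measurable_completion) measurable

lemma far_flux_bound:
  assumes d: "0 < d" "d \<le> R" and x: "dist x0 x \<le> R - d" and ux: "\<bar>u x\<bar> \<le> M"
  shows "(\<integral>\<^sup>+y. indicator (- ball x d) y * ennreal (\<bar>jp p (u x - u y)\<bar> / norm (x - y) powr \<beta>) \<partial>lebesgue)
    \<le> ennreal ((far_const TYPE('a) \<beta> + vol + 1) * M powr (p - 1) / d powr (\<beta> + sp * p))"
proof -
  define C where "C = far_const TYPE('a) \<beta>"
  have C: "0 \<le> C" by (simp add: C_def)
  define m where "m = M powr (p - 1)"
  have m: "m \<ge> 0" by (simp add: m_def)
  have d1: "d < 1" using d R by simp
  have "(\<integral>\<^sup>+y. indicator (- ball x d) y * ennreal (\<bar>jp p (u x - u y)\<bar> / norm (x - y) powr \<beta>) \<partial>lebesgue)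
    \<le> (\<integral>\<^sup>+y. ennreal m * (indicator (- ball x d) y * ennreal (1 / norm (x - y) powr \<beta>))
        + indicator (- ball x d) y * ennreal (\<bar>u y\<bar> powr (p - 1) / norm (x - y) powr \<beta>) \<partial>lebesgue)"
  proof (rule nn_integral_mono)
    fix y
    have "\<bar>jp p (u x - u y)\<bar> \<le> m + \<bar>u y\<bar> powr (p - 1)"
      using abs_jp_diff_le[of "u x" "u y"] powr_mono2[of "p - 1" "\<bar>u x\<bar>" M] ux p by (simp add: m_def)
    then have "\<bar>jp p (u x - u y)\<bar> / norm (x - y) powr \<beta> \<le> (m + \<bar>u y\<bar> powr (p - 1)) / norm (x - y) powr \<beta>"
      by (rule divide_right_mono) simp
    also have "\<dots> = m * (1 / norm (x - y) powr \<beta>) + \<bar>u y\<bar> powr (p - 1) / norm (x - y) powr \<beta>"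
      by (simp add: add_divide_distrib)
    finally have "ennreal (\<bar>jp p (u x - u y)\<bar> / norm (x - y) powr \<beta>)
      \<le> ennreal (m * (1 / norm (x - y) powr \<beta>) + \<bar>u y\<bar> powr (p - 1) / norm (x - y) powr \<beta>)"
      by (rule ennreal_leI)
    also have "\<dots> = ennreal m * ennreal (1 / norm (x - y) powr \<beta>) + ennreal (\<bar>u y\<bar> powr (p - 1) / norm (x - y) powr \<beta>)"
      using m by (subst ennreal_mult[symmetric]) auto
    finally show "indicator (- ball x d) y * ennreal (\<bar>jp p (u x - u y)\<bar> / norm (x - y) powr \<beta>)
      \<le> ennreal m * (indicator (- ball x d) y * ennreal (1 / norm (x - y) powr \<beta>))
        + indicator (- ball x d) y * ennreal (\<bar>u y\<bar> powr (p - 1) / norm (x - y) powr \<beta>)"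
      by (cases "y \<in> ball x d") auto
  qed
  also have "\<dots> = ennreal m * (\<integral>\<^sup>+y. indicator (- ball x d) y * ennreal (1 / norm (x - y) powr \<beta>) \<partial>lebesgue)
        + (\<integral>\<^sup>+y. indicator (- ball x d) y * ennreal (\<bar>u y\<bar> powr (p - 1) / norm (x - y) powr \<beta>) \<partial>lebesgue)"
    by (subst nn_integral_add, measurable, subst nn_integral_cmult, measurable)
  also have "\<dots> \<le> ennreal m * ennreal (C / d powr \<beta>) + ennreal ((vol + 1) * m / d powr (\<beta> + sp * p))"
    unfolding m_def C_def using d1 by (intro add_mono mult_left_mono far_kernel_bound exponent_bounds tail_bound d x) auto
  also have "\<dots> = ennreal (m * (C / d powr \<beta>) + (vol + 1) * m / d powr (\<beta> + sp * p))"
    using m C vol_nonneg by (subst ennreal_mult[symmetric]) auto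
  also have "\<dots> \<le> ennreal ((C + vol + 1) * m / d powr (\<beta> + sp * p))"
  proof (rule ennreal_leI)
    have "m * (C / d powr \<beta>) \<le> m * (C / d powr (\<beta> + sp * p))"
      using m C d d1 sp p by (intro mult_left_mono divide_left_mono powr_mono') auto
    moreover have "(C + vol + 1) * m / e = m * (C / e) + (vol + 1) * m / e" for e
      by (simp add: add_divide_distrib algebra_simps)
    ultimately show "m * (C / d powr \<beta>) + (vol + 1) * m / d powr (\<beta> + sp * p) \<le> (C + vol + 1) * m / d powr (\<beta> + sp * p)"
      by (simp only: add_right_mono)
  qed
  finally show ?thesis unfolding m_def C_def .
qed

lemma far_flux_bound_translated:
  fixes h :: 'a
  assumes d: "0 < d" "d \<le> R" and x: "dist x0 (x + h) \<le> R - d" and ux: "\<bar>u (x + h)\<bar> \<le> M"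
  shows "(\<integral>\<^sup>+y. indicator (- ball x d) y * ennreal (\<bar>jp p (u (x + h) - u (y + h))\<bar> / norm (x - y) powr \<beta>) \<partial>lebesgue)
    \<le> ennreal ((far_const TYPE('a) \<beta> + vol + 1) * M powr (p - 1) / d powr (\<beta> + sp * p))"
proof -
  define f where "f y = indicator (- ball (x + h) d) y * ennreal (\<bar>jp p (u (x + h) - u y)\<bar> / norm (x + h - y) powr \<beta>)" for y
  have f: "f \<in> borel_measurable lebesgue" unfolding f_def[abs_def] by measurable
  have i: "indicator (- ball (x + h) d) (y + h) = (indicator (- ball x d) y :: ennreal)" for y
    by (simp add: indicator_def dist_norm)
  have "(\<integral>\<^sup>+y. f (y + h) \<partial>lebesgue) \<le> ennreal ((far_const TYPE('a) \<beta> + vol + 1) * M powr (p - 1) / d powr (\<beta> + sp * p))"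
    unfolding nn_integral_translation[OF f] unfolding f_def by (rule far_flux_bound[OF d x ux])
  then show ?thesis by (simp add: f_def i)
qed

text \<open>The weak formulation speaks only of test functions with integrable pairings, so
  integrability comes first. The \<open>Z\<close> pairing lies below the seminorm of order
  \<open>s1\<close>; the flux pairing is split into near pairs, treated by Young's inequality, and
  far pairs, treated by the tail. The margin \<open>d\<close> keeps the near pairs inside the ball
  where the seminorm of \<open>u\<close> is finite.\<close>

lemma weak_test:
  fixes \<psi> :: "'a \<Rightarrow> real"
  assumes \<psi> [measurable]: "\<psi> \<in> borel_measurable lebesgue"
    and supp: "\<And>x. x \<notin> ball c \<rho> \<Longrightarrow> \<psi> x = 0" and bd: "\<And>x. \<bar>\<psi> x\<bar> \<le> K"
    and d: "0 < d" "d \<le> R" and \<rho>: "0 \<le> \<rho>"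
    and sub1: "ball c \<rho> \<subseteq> cball x0 (R - d)" and sub2: "ball c (\<rho> + d) \<subseteq> ball x0 R"
    and G1: "gagliardo_int s1 1 (ball c (\<rho> + d)) \<psi> < \<infinity>"
    and Gp: "gagliardo_int sp p (ball c (\<rho> + d)) \<psi> < \<infinity>"
  shows "integrable leb2 (pairing Z \<beta>1 \<psi>)"
    and "integrable leb2 (pairing (flux p u) \<beta> \<psi>)"
    and "integral\<^sup>L leb2 (pairing Z \<beta>1 \<psi>)
      + integral\<^sup>L leb2 (pairing (flux p u) \<beta> \<psi>) = 0"
proof -
  have K: "K \<ge> 0" using bd[of c] by simp
  have d1: "d \<le> 1" using d R by simp
  have W1: "in_W s1 1 UNIV \<psi>" using in_W_of_support[OF \<psi> supp bd s1(1) _ d(1) d1 \<rho> G1] by simp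
  have Wp: "in_W sp p UNIV \<psi>" using in_W_of_support[OF \<psi> supp bd sp(1) _ d(1) d1 \<rho> Gp] p by simp
  show i1: "integrable leb2 (pairing Z \<beta>1 \<psi>)"
  proof (rule integrableI_bounded)
    have "(\<integral>\<^sup>+z. ennreal (norm (pairing Z \<beta>1 \<psi> z)) \<partial>leb2)
      \<le> gagliardo_int s1 1 UNIV \<psi>"
      unfolding gagliardo_int_def
    proof (rule nn_integral_mono_AE)
      show "AE z in leb2. ennreal (norm (pairing Z \<beta>1 \<psi> z))
        \<le> indicator (UNIV \<times> UNIV) z * ennreal (\<bar>\<psi> (fst z) - \<psi> (snd z)\<bar> powr 1 / norm (fst z - snd z) powr (real DIM('a) + s1 * 1))"
        using Z_sgn
      proof eventually_elim
        case (elim z)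
        have "\<bar>Z z\<bar> * \<bar>\<psi> (fst z) - \<psi> (snd z)\<bar> \<le> 1 * \<bar>\<psi> (fst z) - \<psi> (snd z)\<bar>"
          by (intro mult_right_mono in_sgn_abs_le[OF elim]) simp
        then show ?case
          by (simp add: pairing_def abs_mult \<beta>1_def ennreal_leI divide_right_mono)
      qed
    qed
    also have "\<dots> < \<infinity>" using W1 by (simp add: in_W_def)
    finally show "(\<integral>\<^sup>+z. ennreal (norm (pairing Z \<beta>1 \<psi> z)) \<partial>leb2) < \<infinity>" .
  qed measurable
  show i2: "integrable leb2 (pairing (flux p u) \<beta> \<psi>)"
  proof (rule integrableI_bounded)
    define k where "k z = ennreal (norm (pairing (flux p u) \<beta> \<psi> z))" for z
    have [measurable]: "k \<in> borel_measurable leb2" unfolding k_def[abs_def] by measurable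
    define B' where "B' = ball c (\<rho> + d)"
    define D where "D = (far_const TYPE('a) \<beta> + vol + 1) * M powr (p - 1) / d powr (\<beta> + sp * p)"
    define gg where "gg w z = indicator B' (fst z) * indicator B' (snd z) *
      ennreal (\<bar>w (fst z) - w (snd z)\<bar> powr p / norm (fst z - snd z) powr \<beta>)" for w :: "'a \<Rightarrow> real" and z
    have [measurable]: "(\<lambda>z. gg u z) \<in> borel_measurable leb2" "(\<lambda>z. gg \<psi> z) \<in> borel_measurable leb2"
      unfolding gg_def B'_def by measurable
    have near: "(\<integral>\<^sup>+z. indicator B' (fst z) * indicator B' (snd z) * k z \<partial>leb2) < \<infinity>"
    proof -
      have "(\<integral>\<^sup>+z. indicator B' (fst z) * indicator B' (snd z) * k z \<partial>leb2) \<le> (\<integral>\<^sup>+z. gg u z + gg \<psi> z \<partial>leb2)"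
      proof (rule nn_integral_mono)
        fix z
        define a where "a = \<bar>u (fst z) - u (snd z)\<bar>"
        define b where "b = \<bar>\<psi> (fst z) - \<psi> (snd z)\<bar>"
        have ab: "0 \<le> a" "0 \<le> b" by (auto simp: a_def b_def)
        \<comment> \<open>Young's inequality with constant 1: both factors are compared with the
          larger of \<open>a\<close> and \<open>b\<close>.\<close>
        have "a powr (p - 1) * b \<le> max a b powr (p - 1) * max a b"
          using ab p by (intro mult_mono powr_mono2) auto
        also have "\<dots> = max a b powr p" using powr_mult_base[of "max a b" "p - 1"] ab by (simp add: mult.commute)
        also have "\<dots> \<le> a powr p + b powr p" by (auto simp: max_def)
        finally have "a powr (p - 1) * b / norm (fst z - snd z) powr \<beta> \<le> (a powr p + b powr p) / norm (fst z - snd z) powr \<beta>"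
          by (rule divide_right_mono) simp
        then have "k z \<le> ennreal (a powr p / norm (fst z - snd z) powr \<beta> + b powr p / norm (fst z - snd z) powr \<beta>)"
          unfolding k_def pairing_def flux_def a_def b_def by (intro ennreal_leI) (simp add: abs_mult abs_jp add_divide_distrib)
        also have "\<dots> = ennreal (a powr p / norm (fst z - snd z) powr \<beta>) + ennreal (b powr p / norm (fst z - snd z) powr \<beta>)"
          by (rule ennreal_plus) auto
        finally show "indicator B' (fst z) * indicator B' (snd z) * k z \<le> gg u z + gg \<psi> z"
          by (cases "fst z \<in> B' \<and> snd z \<in> B'") (auto simp: gg_def a_def b_def)
      qed
      also have "\<dots> = gagliardo_int sp p B' u + gagliardo_int sp p B' \<psi>"
        unfolding gagliardo_int_alt \<beta>_def[symmetric] gg_def[symmetric] by (rule nn_integral_add) measurable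
      also have "gagliardo_int sp p B' u \<le> ennreal (M powr p)"
        unfolding B'_def using gagliardo_int_mono_set[OF sub2, of sp p u] gagliardo_p by simp
      finally show ?thesis using Gp by (simp add: B'_def add_right_mono le_less_trans)
    qed
    have inner: "AE x in lebesgue. indicator (ball c \<rho>) x * (\<integral>\<^sup>+y. indicator (- ball x d) y * k (x, y) \<partial>lebesgue)
        \<le> (ennreal (2 * K) * ennreal D) * indicator (ball c \<rho>) x"
      using u_bounded
    proof eventually_elim
      case (elim x)
      show ?case
      proof (cases "x \<in> ball c \<rho>")
        case True
        then have x: "dist x0 x \<le> R - d" using sub1 by auto
        then have ux: "\<bar>u x\<bar> \<le> M" using elim d by simp
        have "(\<integral>\<^sup>+y. indicator (- ball x d) y * k (x, y) \<partial>lebesgue)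
          \<le> (\<integral>\<^sup>+y. ennreal (2 * K) * (indicator (- ball x d) y * ennreal (\<bar>jp p (u x - u y)\<bar> / norm (x - y) powr \<beta>)) \<partial>lebesgue)"
        proof (rule nn_integral_mono)
          fix y
          have "\<bar>\<psi> x - \<psi> y\<bar> \<le> 2 * K" using bd[of x] bd[of y] by simp
          from mult_left_mono[OF this, of "\<bar>jp p (u x - u y)\<bar> / norm (x - y) powr \<beta>"]
          have "k (x, y) \<le> ennreal (2 * K * (\<bar>jp p (u x - u y)\<bar> / norm (x - y) powr \<beta>))"
            unfolding k_def pairing_def flux_def by (intro ennreal_leI) (simp add: abs_mult mult_ac)
          also have "\<dots> = ennreal (2 * K) * ennreal (\<bar>jp p (u x - u y)\<bar> / norm (x - y) powr \<beta>)"
            using K by (intro ennreal_mult) auto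
          finally show "indicator (- ball x d) y * k (x, y)
            \<le> ennreal (2 * K) * (indicator (- ball x d) y * ennreal (\<bar>jp p (u x - u y)\<bar> / norm (x - y) powr \<beta>))"
            by (cases "y \<in> ball x d") auto
        qed
        also have "\<dots> = ennreal (2 * K) * (\<integral>\<^sup>+y. indicator (- ball x d) y * ennreal (\<bar>jp p (u x - u y)\<bar> / norm (x - y) powr \<beta>) \<partial>lebesgue)"
          by (rule nn_integral_cmult) measurable
        also have "\<dots> \<le> ennreal (2 * K) * ennreal D"
          unfolding D_def by (intro mult_left_mono far_flux_bound d x ux) auto
        finally show ?thesis using True by simp
      qed simp
    qed
    have "(\<integral>\<^sup>+z. k z \<partial>leb2) \<le> (\<integral>\<^sup>+z. indicator B' (fst z) * indicator B' (snd z) * k z \<partial>leb2)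
      + 2 * (\<integral>\<^sup>+x. indicator (ball c \<rho>) x * (\<integral>\<^sup>+y. indicator (- ball x d) y * k (x, y) \<partial>lebesgue) \<partial>lebesgue)"
      unfolding B'_def
    proof (rule nn_integral_near_far_le)
      show "k (x, y) = k (y, x)" for x y
      proof -
        have "\<bar>jp p (u x - u y)\<bar> = \<bar>jp p (u y - u x)\<bar>" unfolding abs_jp by (simp add: abs_minus_commute)
        then show ?thesis by (simp add: k_def pairing_def flux_def abs_mult abs_minus_commute norm_minus_commute)
      qed
      show "k (x, y) = 0" if "x \<notin> ball c \<rho>" "y \<notin> ball c \<rho>" for x y
        using supp[OF that(1)] supp[OF that(2)] by (simp add: k_def pairing_def)
    qed (use d in auto)
    also have "\<dots> \<le> (\<integral>\<^sup>+z. indicator B' (fst z) * indicator B' (snd z) * k z \<partial>leb2)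
      + 2 * (\<integral>\<^sup>+x. (ennreal (2 * K) * ennreal D) * indicator (ball c \<rho>) x \<partial>lebesgue)"
      using inner by (intro add_left_mono mult_left_mono nn_integral_mono_AE) auto
    also have "\<dots> < \<infinity>"
    proof -
      have "(\<integral>\<^sup>+x. (ennreal (2 * K) * ennreal D) * indicator (ball c \<rho>) x \<partial>lebesgue) < \<infinity>"
        by (subst nn_integral_cmult_indicator, simp)
          (simp only: emeasure_lebesgue_ball[OF \<rho>], intro ennreal_mult_less_infinity, auto)
      then show ?thesis using near ennreal_mult_less_top by auto
    qed
    finally show "(\<integral>\<^sup>+z. ennreal (norm (pairing (flux p u) \<beta> \<psi> z)) \<partial>leb2) < \<infinity>"
      unfolding k_def .
  qed measurable
  show "integral\<^sup>L leb2 (pairing Z \<beta>1 \<psi>)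
      + integral\<^sup>L leb2 (pairing (flux p u) \<beta> \<psi>) = 0"
    unfolding \<beta>1_def \<beta>_def
  proof (rule weak[OF W1 Wp])
    show "\<psi> x = 0" if "x \<notin> ball x0 R" for x
      using that sub1 d by (intro supp) auto
  qed (use i1 i2 in \<open>simp_all add: \<beta>1_def \<beta>_def\<close>)
qed

end

section \<open>The Caccioppoli inequality for differences\<close>

text \<open>The bounds on \<open>u\<close> hold only almost everywhere and only in the ball.
  Truncation makes the test function bounded, with controlled increments, at every point.\<close>

definition clip :: "real \<Rightarrow> real \<Rightarrow> real"
  where "clip K t = max (- K) (min K t)"

lemma clip_Lipschitz: "\<bar>clip K s - clip K t\<bar> \<le> \<bar>s - t\<bar>"
  by (auto simp: clip_def max_def min_def)

lemma abs_clip_le: "0 \<le> K \<Longrightarrow> \<bar>clip K t\<bar> \<le> K" "0 \<le> K \<Longrightarrow> \<bar>clip K t\<bar> \<le> \<bar>t\<bar>"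
  by (auto simp: clip_def max_def min_def)

lemma clip_eq: "\<bar>t\<bar> \<le> K \<Longrightarrow> clip K t = t"
  by (auto simp: clip_def max_def min_def)

definition cutoff :: "'a::euclidean_space \<Rightarrow> real \<Rightarrow> real \<Rightarrow> 'a \<Rightarrow> real"
  where "cutoff c r d x = max 0 (min 1 ((r + d - dist c x) / d))"

lemma cutoff_bounds: "0 \<le> cutoff c r d x" "cutoff c r d x \<le> 1"
  by (auto simp: cutoff_def)

lemma cutoff_eq_1: "0 < d \<Longrightarrow> dist c x \<le> r \<Longrightarrow> cutoff c r d x = 1"
  by (simp add: cutoff_def min_def)

lemma cutoff_eq_0: "0 < d \<Longrightarrow> r + d \<le> dist c x \<Longrightarrow> cutoff c r d x = 0"
  using divide_nonpos_pos[of "r + d - dist c x" d] by (simp add: cutoff_def)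

lemma cutoff_Lipschitz:
  assumes "0 < d"
  shows "\<bar>cutoff c r d x - cutoff c r d y\<bar> \<le> norm (x - y) / d"
proof -
  have "\<bar>max 0 (min 1 s) - max 0 (min 1 t)\<bar> \<le> \<bar>s - t\<bar>" for s t :: real
    by (auto simp: max_def min_def)
  then have "\<bar>cutoff c r d x - cutoff c r d y\<bar> \<le> \<bar>(r + d - dist c x) / d - (r + d - dist c y) / d\<bar>"
    unfolding cutoff_def .
  also have "\<dots> = \<bar>dist c y - dist c x\<bar> / d"
    using assms by (simp add: diff_divide_distrib[symmetric])
  also have "\<dots> \<le> norm (x - y) / d"
    using assms abs_dist_diff_le[of y c x] by (intro divide_right_mono) (auto simp: dist_norm norm_minus_commute)
  finally show ?thesis .
qed

text \<open>The absorption step: \<open>F\<close> has no sign, so its vanishing integral is a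
  Bochner integral, while \<open>E\<close> and \<open>e\<close> are nonnegative. If \<open>e\<close>
  is not integrable, the right-hand side is infinite and nothing is claimed.\<close>

lemma nn_integral_le_of_integral_zero:
  fixes F e E :: "'b \<Rightarrow> real"
  assumes F: "integrable N F" "(\<integral>z. F z \<partial>N) = 0"
    and e [measurable]: "e \<in> borel_measurable N" and e0: "\<And>z. 0 \<le> e z" and E0: "\<And>z. 0 \<le> E z"
    and le: "AE z in N. E z \<le> F z + e z"
  shows "(\<integral>\<^sup>+z. ennreal (E z) \<partial>N) \<le> (\<integral>\<^sup>+z. ennreal (e z) \<partial>N)"
proof (cases "(\<integral>\<^sup>+z. ennreal (e z) \<partial>N) < \<infinity>")
  case True
  then have ie: "integrable N e"
    using e0 by (intro integrableI_bounded) auto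
  have "(\<integral>\<^sup>+z. ennreal (E z) \<partial>N) \<le> (\<integral>\<^sup>+z. ennreal (F z + e z) \<partial>N)"
    using le by (intro nn_integral_mono_AE) (auto elim: eventually_mono intro: ennreal_leI)
  also have "\<dots> = ennreal (\<integral>z. F z + e z \<partial>N)"
  proof (rule nn_integral_eq_integral)
    show "AE z in N. 0 \<le> F z + e z" using le by eventually_elim (use E0 in \<open>metis order_trans\<close>)
  qed (use F ie in auto)
  also have "(\<integral>z. F z + e z \<partial>N) = (\<integral>z. e z \<partial>N)"
    using F ie by simp
  also have "ennreal \<dots> = (\<integral>\<^sup>+z. ennreal (e z) \<partial>N)"
    by (rule nn_integral_eq_integral[symmetric]) (use ie e0 in auto)
  finally show ?thesis .
qed (simp add: not_less top_unique)

text \<open>The Lipschitz bound of the cutoff supplies the factor \<open>t\<close>, which lowers the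
  singularity by one power. At \<open>t = 0\<close> both sides are 0.\<close>

lemma mult_kernel_le:
  fixes t b :: real
  assumes "0 \<le> t"
  shows "t * (1 / t powr b) \<le> 1 / t powr (b - 1)"
  using assms by (cases "t = 0") (auto simp: powr_diff)

text \<open>\<open>2 powr \<delta> / (p - 1)\<close> inverts the constant of
  \<open>jp_product_ge\<close>. The near constants come from the variation of the cutoff, where one
  power of each kernel is cancelled; the remaining terms come from far pairs and the tail.\<close>

definition cacc_const :: "'a::euclidean_space itself \<Rightarrow> real \<Rightarrow> real \<Rightarrow> real \<Rightarrow> real \<Rightarrow> real"
  where "cacc_const T s1 sp p \<delta> = 2 powr \<delta> / (p - 1) *
    (2 * near_const T (real DIM('a) + s1 - 1) + 4 * near_const T (real DIM('a) + sp * p - 1)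
      + 4 * far_const T (real DIM('a) + s1) + 4 * far_const T (real DIM('a) + sp * p)
      + 4 * unit_ball_vol (real DIM('a)) + 4)"

definition coercive_int :: "real \<Rightarrow> real \<Rightarrow> real \<Rightarrow> 'a::euclidean_space set \<Rightarrow> ('a \<Rightarrow> real) \<Rightarrow> 'a \<Rightarrow> ennreal"
  where "coercive_int p e b U u h = (\<integral>\<^sup>+z. indicator U (fst z) * indicator U (snd z) *
      ennreal ((\<bar>u (fst z + h) - u (snd z + h)\<bar> + \<bar>u (fst z) - u (snd z)\<bar>) powr (p - 2)
        * \<bar>diff h u (fst z) - diff h u (snd z)\<bar> powr e / norm (fst z - snd z) powr b) \<partial>leb2)"

context local_solution
begin

text \<open>The cutoff lives in radius \<open>r + d\<close>, its error in \<open>r + 2 d\<close>;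
  the shift and the margin of \<open>weak_test\<close> still fit into \<open>R\<close>. The power
  \<open>N + 2\<close> of \<open>1 / d\<close> dominates every loss: 1 from the cutoff,
  \<open>\<beta>1 = N + s1\<close>, and \<open>\<beta> + sp p = N + 2 sp p\<close>, where
  \<open>sp p < 1\<close>.\<close>

lemma caccioppoli:
  fixes h :: 'a
  assumes \<delta>: "1 \<le> \<delta>" and d: "0 < d" and r: "0 < r" "r + 4 * d \<le> R" and h: "norm h \<le> d"
  shows "coercive_int p (\<delta> + 1) \<beta> (ball x0 r) u h
    \<le> ennreal (cacc_const TYPE('a) s1 sp p \<delta> * M powr (p - 1) / d powr (real DIM('a) + 2))
      * pow_int \<delta> (ball x0 (r + 2 * d)) (diff h u)"
proof -
  define C1 where "C1 = near_const TYPE('a) (\<beta>1 - 1)"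
  define C2 where "C2 = near_const TYPE('a) (\<beta> - 1)"
  define C3 where "C3 = far_const TYPE('a) \<beta>1"
  define C4 where "C4 = far_const TYPE('a) \<beta>"
  have C: "0 \<le> C1" "0 \<le> C2" "0 \<le> C3" "0 \<le> C4" by (simp_all add: C1_def C2_def C3_def C4_def)
  note near1 = near_kernel_bound[OF exponent_bounds(1), folded C1_def]
    and near2 = near_kernel_bound[OF exponent_bounds(2), folded C2_def]
    and far1 = far_kernel_bound[OF exponent_bounds(3), folded C3_def]
  define w where "w = diff h u"
  define \<eta> where "\<eta> = cutoff x0 r d"
  \<comment> \<open>Where the bounds on \<open>u\<close> hold, \<open>w\<close> is at most
    \<open>2 * M\<close> in absolute value and the truncation has no effect.\<close>
  define \<phi> where "\<phi> x = \<eta> x * jp (\<delta> + 1) (clip (2 * M) (w x))" for x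
  \<comment> \<open>Translating the integrals tested with \<open>\<psi>\<close> by
    \<open>(h, h)\<close> restores \<open>\<phi>\<close> and puts the shift on \<open>Z\<close> and
    \<open>u\<close> instead.\<close>
  define \<psi> where "\<psi> x = \<phi> (x + - h)" for x
  define B where "B = ball x0 (r + d)"
  define B' where "B' = ball x0 (r + 2 * d)"
  define a where "a z = u (fst z + h) - u (snd z + h)" for z :: "'a \<times> 'a"
  define b where "b z = u (fst z) - u (snd z)" for z :: "'a \<times> 'a"
  define k1 where "k1 z = 1 / norm (fst z - snd z) powr \<beta>1" for z :: "'a \<times> 'a"
  define k2 where "k2 z = 1 / norm (fst z - snd z) powr \<beta>" for z :: "'a \<times> 'a"
  define m where "m = M powr (p - 1)"
  define Q where "Q = (2 * M) powr (p - 1)"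
  have m: "1 \<le> m" using M p by (simp add: m_def ge_one_powr_ge_zero)
  have Q: "0 \<le> Q" "Q \<le> 2 * m"
  proof -
    have "2 powr (p - 1) \<le> 2 powr (1 :: real)" using p by (intro powr_mono) auto
    then show "Q \<le> 2 * m" unfolding Q_def m_def powr_mult by (intro mult_right_mono) auto
  qed (simp add: Q_def)
  have d1: "d < 1" "d \<le> R" using d r R by auto
  have ab: "w (fst z) - w (snd z) = a z - b z" for z
    by (simp add: w_def diff_def a_def b_def)
  have [measurable]: "w \<in> borel_measurable lebesgue" unfolding w_def by measurable
  have [measurable]: "\<eta> \<in> borel_measurable lebesgue"
    unfolding \<eta>_def cutoff_def[abs_def] by (rule measurable_completion) measurable
  have [measurable]: "clip K \<in> borel_measurable borel" for K
    unfolding clip_def[abs_def] by measurable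
  have \<phi>m [measurable]: "\<phi> \<in> borel_measurable lebesgue" unfolding \<phi>_def[abs_def] by measurable
  have \<psi>m [measurable]: "\<psi> \<in> borel_measurable lebesgue" unfolding \<psi>_def[abs_def] by measurable
  have [measurable]: "a \<in> borel_measurable leb2" "b \<in> borel_measurable leb2" "k1 \<in> borel_measurable leb2" "k2 \<in> borel_measurable leb2"
    unfolding a_def[abs_def] b_def[abs_def] k1_def[abs_def] k2_def[abs_def] by measurable
  have k0: "0 \<le> k1 z" "0 \<le> k2 z" for z by (auto simp: k1_def k2_def)
  have \<eta>01: "0 \<le> \<eta> x" "\<eta> x \<le> 1" for x unfolding \<eta>_def by (rule cutoff_bounds)+
  have \<eta>0: "\<eta> x = 0" if "x \<notin> B" for x
    unfolding \<eta>_def using that d by (intro cutoff_eq_0) (auto simp: B_def)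
  have \<eta>1: "\<eta> x = 1" if "x \<in> ball x0 r" for x
    unfolding \<eta>_def using that d by (intro cutoff_eq_1) auto
  have \<eta>L: "\<bar>\<eta> x - \<eta> y\<bar> \<le> norm (x - y) / d" for x y
    unfolding \<eta>_def by (rule cutoff_Lipschitz[OF d])
  have \<phi>0: "\<phi> x = 0" if "x \<notin> B" for x using \<eta>0[OF that] by (simp add: \<phi>_def)
  have gb: "\<bar>jp (\<delta> + 1) (clip (2 * M) t)\<bar> \<le> (2 * M) powr \<delta>" for t
    using abs_clip_le(1)[of "2 * M" t] M \<delta> by (simp add: abs_jp powr_mono2)
  have \<phi>b: "\<bar>\<phi> x\<bar> \<le> (2 * M) powr \<delta>" for x
    using mult_mono[OF \<eta>01(2) gb] \<eta>01 by (simp add: \<phi>_def abs_mult)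
  have \<phi>w: "\<bar>\<phi> x\<bar> \<le> \<bar>w x\<bar> powr \<delta>" for x
  proof -
    have "\<bar>jp (\<delta> + 1) (clip (2 * M) (w x))\<bar> \<le> \<bar>w x\<bar> powr \<delta>"
      using abs_clip_le(2)[of "2 * M" "w x"] M \<delta> by (simp add: abs_jp powr_mono2)
    from mult_mono[OF \<eta>01(2) this] show ?thesis using \<eta>01 by (simp add: \<phi>_def abs_mult)
  qed
  \<comment> \<open>Product rule: the Lipschitz constant of the truncated nonlinearity, plus its
    maximum times the slope \<open>1 / d\<close> of the cutoff.\<close>
  define A where "A = \<delta> * (2 * M) powr (\<delta> - 1) + (2 * M) powr \<delta> / d"
  have A: "0 \<le> A" using \<delta> d M by (simp add: A_def)
  have \<phi>inc: "\<bar>\<phi> x - \<phi> y\<bar> \<le> A * (\<bar>u (x + h) - u (y + h)\<bar> + \<bar>u x - u y\<bar> + norm (x - y))" for x y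
  proof -
    define gx where "gx = jp (\<delta> + 1) (clip (2 * M) (w x))"
    define gy where "gy = jp (\<delta> + 1) (clip (2 * M) (w y))"
    define X where "X = \<bar>u (x + h) - u (y + h)\<bar> + \<bar>u x - u y\<bar>"
    have "\<bar>gx - gy\<bar> \<le> (\<delta> + 1 - 1) * (2 * M) powr (\<delta> + 1 - 2) * \<bar>clip (2 * M) (w x) - clip (2 * M) (w y)\<bar>"
      unfolding gx_def gy_def using \<delta> M by (intro jp_Lipschitz abs_clip_le) auto
    also have "\<dots> \<le> \<delta> * (2 * M) powr (\<delta> - 1) * X"
    proof -
      have "\<bar>clip (2 * M) (w x) - clip (2 * M) (w y)\<bar> \<le> X"
        using clip_Lipschitz[of "2 * M" "w x" "w y"] by (simp add: w_def diff_def X_def)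
      then show ?thesis using \<delta> by (simp add: mult_left_mono)
    qed
    finally have 1: "\<bar>gx - gy\<bar> \<le> \<delta> * (2 * M) powr (\<delta> - 1) * X" .
    have "\<phi> x - \<phi> y = \<eta> x * (gx - gy) + (\<eta> x - \<eta> y) * gy"
      by (simp add: \<phi>_def gx_def gy_def algebra_simps)
    then have "\<bar>\<phi> x - \<phi> y\<bar> \<le> \<bar>\<eta> x\<bar> * \<bar>gx - gy\<bar> + \<bar>\<eta> x - \<eta> y\<bar> * \<bar>gy\<bar>"
      using abs_triangle_ineq[of "\<eta> x * (gx - gy)" "(\<eta> x - \<eta> y) * gy"] by (simp add: abs_mult)
    also have "\<dots> \<le> 1 * (\<delta> * (2 * M) powr (\<delta> - 1) * X) + norm (x - y) / d * (2 * M) powr \<delta>"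
      using \<eta>01[of x] d gb[of "w y"] by (intro add_mono mult_mono 1 \<eta>L) (auto simp: gy_def)
    also have "\<dots> \<le> A * (X + norm (x - y))"
    proof -
      have "0 \<le> \<delta> * (2 * M) powr (\<delta> - 1) * norm (x - y)" "0 \<le> (2 * M) powr \<delta> / d * X"
        using \<delta> d by (auto simp: X_def)
      then show ?thesis by (simp add: A_def algebra_simps add_divide_distrib)
    qed
    finally show ?thesis by (simp add: X_def)
  qed
  have sub0: "ball x0 (r + 2 * d) \<subseteq> ball x0 R" using r d by (intro subset_ball) auto
  have subh: "ball (x0 + h) (r + 2 * d) \<subseteq> ball x0 R"
  proof
    fix y assume "y \<in> ball (x0 + h) (r + 2 * d)"
    then show "y \<in> ball x0 R"
      using dist_triangle[of x0 y "x0 + h"] h r d by (simp add: dist_norm)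
  qed
  have \<phi>G: "gagliardo_int \<gamma> q (ball x0 (r + 2 * d)) \<phi> < \<infinity>"
    if "\<gamma> < 1" "1 \<le> q" "gagliardo_int \<gamma> q (ball x0 R) u < \<infinity>" for \<gamma> q
  proof (rule gagliardo_finite_of_increment_bound[OF u_measurable that(1,2) _ _ A \<phi>inc])
    show "gagliardo_int \<gamma> q (ball (x0 + h) (r + 2 * d)) u < \<infinity>"
      using gagliardo_int_mono_set[OF subh, of \<gamma> q u] that(3) by simp
    show "gagliardo_int \<gamma> q (ball x0 (r + 2 * d)) u < \<infinity>"
      using gagliardo_int_mono_set[OF sub0, of \<gamma> q u] that(3) by simp
  qed (use r d R in auto)
  have Gp: "gagliardo_int sp p (ball x0 R) u < \<infinity>"
    using gagliardo_p by (simp add: le_less_trans)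
  have sp1: "sp < 1" using sp p mult_strict_left_mono[of 1 p sp] by linarith
  note \<phi>G1 = \<phi>G[OF s1(2) order_refl gagliardo_1]
  note \<phi>Gp = \<phi>G[OF sp1 less_imp_le[OF p(1)] Gp]
  have \<psi>G: "gagliardo_int \<gamma> q (ball (x0 + h) (r + 2 * d)) \<psi> = gagliardo_int \<gamma> q (ball x0 (r + 2 * d)) \<phi>" for \<gamma> q
    using gagliardo_int_translation[OF \<phi>m, of \<gamma> q "x0 + h" "r + 2 * d" "- h"] by (simp add: \<psi>_def[abs_def])
  have rd: "r + d + d = r + 2 * d" by simp
  note test1 = weak_test[OF \<phi>m, of x0 "r + d" "(2 * M) powr \<delta>" d]
  have T1: "integrable leb2 (pairing Z \<beta>1 \<phi>)"
    "integrable leb2 (pairing (flux p u) \<beta> \<phi>)"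
    "integral\<^sup>L leb2 (pairing Z \<beta>1 \<phi>)
      + integral\<^sup>L leb2 (pairing (flux p u) \<beta> \<phi>) = 0"
    by (rule test1; use \<phi>0 \<phi>b d d1 r \<phi>G1 \<phi>Gp sub0 in \<open>force simp: B_def rd\<close>)+
  have \<psi>0: "\<psi> x = 0" if "x \<notin> ball (x0 + h) (r + d)" for x
    using that unfolding \<psi>_def by (intro \<phi>0) (auto simp: B_def dist_norm algebra_simps)
  have subh1: "ball (x0 + h) (r + d) \<subseteq> cball x0 (R - d)"
  proof
    fix y assume "y \<in> ball (x0 + h) (r + d)"
    then show "y \<in> cball x0 (R - d)"
      using dist_triangle[of x0 y "x0 + h"] h r d by (simp add: dist_norm)
  qed
  have \<psi>b: "\<bar>\<psi> x\<bar> \<le> (2 * M) powr \<delta>" for x unfolding \<psi>_def by (rule \<phi>b)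
  note test2 = weak_test[OF \<psi>m, of "x0 + h" "r + d" "(2 * M) powr \<delta>" d]
  have T2: "integrable leb2 (pairing Z \<beta>1 \<psi>)"
    "integrable leb2 (pairing (flux p u) \<beta> \<psi>)"
    "integral\<^sup>L leb2 (pairing Z \<beta>1 \<psi>)
      + integral\<^sup>L leb2 (pairing (flux p u) \<beta> \<psi>) = 0"
    by (rule test2; use \<psi>0 \<psi>b d d1 r \<psi>G \<phi>G1 \<phi>Gp subh subh1 in \<open>force simp: rd\<close>)+
  define Zh where "Zh z = Z (fst z + h, snd z + h)" for z :: "'a \<times> 'a"
  define D\<phi> where "D\<phi> z = \<phi> (fst z) - \<phi> (snd z)" for z
  \<comment> \<open>The equation tested with \<open>\<psi>\<close>, translated back, minus the one
    tested with \<open>\<phi>\<close>. All four integrals are finite, so the total integral is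
    0.\<close>
  define F where "F z = (Zh z - Z z) * D\<phi> z * k1 z + (jp p (a z) - jp p (b z)) * D\<phi> z * k2 z" for z
  have F: "integrable leb2 F" "(\<integral>z. F z \<partial>leb2) = 0"
  proof -
    have i1: "integrable leb2 (\<lambda>z. Zh z * D\<phi> z * k1 z)"
      using integrable_leb2_translation[OF T2(1), of h h] by (simp add: pairing_def[abs_def] \<psi>_def Zh_def D\<phi>_def k1_def)
    have e1: "integral\<^sup>L leb2 (pairing Z \<beta>1 \<psi>) = (\<integral>z. Zh z * D\<phi> z * k1 z \<partial>leb2)"
      using integral_leb2_translation[OF borel_measurable_integrable[OF T2(1)], of h h]
      by (simp add: pairing_def[abs_def] \<psi>_def Zh_def D\<phi>_def k1_def)
    have i2: "integrable leb2 (\<lambda>z. jp p (a z) * D\<phi> z * k2 z)"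
      using integrable_leb2_translation[OF T2(2), of h h] by (simp add: pairing_def[abs_def] flux_def \<psi>_def a_def D\<phi>_def k2_def)
    have e2: "integral\<^sup>L leb2 (pairing (flux p u) \<beta> \<psi>)
        = (\<integral>z. jp p (a z) * D\<phi> z * k2 z \<partial>leb2)"
      using integral_leb2_translation[OF borel_measurable_integrable[OF T2(2)], of h h]
      by (simp add: pairing_def[abs_def] flux_def \<psi>_def a_def D\<phi>_def k2_def)
    have i3: "integrable leb2 (\<lambda>z. Z z * D\<phi> z * k1 z)" using T1(1) by (simp add: pairing_def[abs_def] D\<phi>_def k1_def)
    have i4: "integrable leb2 (\<lambda>z. jp p (b z) * D\<phi> z * k2 z)" using T1(2) by (simp add: pairing_def[abs_def] flux_def D\<phi>_def k2_def b_def)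
    have z1: "(\<integral>z. Z z * D\<phi> z * k1 z \<partial>leb2) + (\<integral>z. jp p (b z) * D\<phi> z * k2 z \<partial>leb2) = 0"
      using T1(3) by (simp add: pairing_def[abs_def] flux_def D\<phi>_def k1_def k2_def b_def)
    have z2: "(\<integral>z. Zh z * D\<phi> z * k1 z \<partial>leb2) + (\<integral>z. jp p (a z) * D\<phi> z * k2 z \<partial>leb2) = 0"
      using T2(3) unfolding e1 e2 .
    have Fe: "F = (\<lambda>z. (Zh z * D\<phi> z * k1 z - Z z * D\<phi> z * k1 z) + (jp p (a z) * D\<phi> z * k2 z - jp p (b z) * D\<phi> z * k2 z))"
      by (auto simp: F_def algebra_simps)
    show "integrable leb2 F" unfolding Fe using i1 i2 i3 i4 by auto
    have "(\<integral>z. F z \<partial>leb2) = ((\<integral>z. Zh z * D\<phi> z * k1 z \<partial>leb2) - (\<integral>z. Z z * D\<phi> z * k1 z \<partial>leb2))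
        + ((\<integral>z. jp p (a z) * D\<phi> z * k2 z \<partial>leb2) - (\<integral>z. jp p (b z) * D\<phi> z * k2 z \<partial>leb2))"
      unfolding Fe using i1 i2 i3 i4 by simp
    then show "(\<integral>z. F z \<partial>leb2) = 0" using z1 z2 by simp
  qed
  define c where "c = (p - 1) * 2 powr (- \<delta>)"
  have c: "0 < c" using p by (simp add: c_def)
  define E where "E z = (if fst z \<in> ball x0 r \<and> snd z \<in> ball x0 r then
      k2 z * (c * ((\<bar>a z\<bar> + \<bar>b z\<bar>) powr (p - 2) * \<bar>a z - b z\<bar> powr (\<delta> + 1))) else 0)" for z
  \<comment> \<open>The errors are separated by whether both points lie in \<open>B'\<close>. If so,
    the sup bounds hold at both points and the increment of the cutoff is kept in \<open>e1\<close>;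
    otherwise \<open>F\<close> is estimated by its absolute value, without any cancellation, by
    \<open>e2\<close>.\<close>
  define e1 where "e1 z = (if fst z \<in> B' \<and> snd z \<in> B' then
      (k1 z + Q * k2 z) * (\<bar>\<eta> (fst z) - \<eta> (snd z)\<bar> * (\<bar>w (fst z)\<bar> powr \<delta> + \<bar>w (snd z)\<bar> powr \<delta>)) else 0)" for z
  define e2 where "e2 z = (if fst z \<in> B' \<and> snd z \<in> B' then 0 else
      (2 * k1 z + (\<bar>jp p (a z)\<bar> + \<bar>jp p (b z)\<bar>) * k2 z) * (\<bar>\<phi> (fst z)\<bar> + \<bar>\<phi> (snd z)\<bar>))" for z
  have em [measurable]: "e1 \<in> borel_measurable leb2" "e2 \<in> borel_measurable leb2"
    unfolding e1_def[abs_def] e2_def[abs_def] B'_def by measurable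
  have e0: "0 \<le> e1 z" "0 \<le> e2 z" "0 \<le> E z" for z
    using k0 Q c by (auto simp: e1_def e2_def E_def)
  have ux: "AE x in lebesgue. x \<in> B' \<longrightarrow> \<bar>u x\<bar> \<le> M"
    using u_bounded sub0 by (auto elim!: eventually_mono simp: B'_def)
  have uxh: "AE x in lebesgue. x \<in> B' \<longrightarrow> \<bar>u (x + h)\<bar> \<le> M"
    using AE_translation[OF u_bounded, of h]
  proof eventually_elim
    case (elim x)
    show ?case
    proof
      assume "x \<in> B'"
      then have "x + h \<in> ball x0 R"
        using dist_triangle[of x0 "x + h" x] h r d by (simp add: dist_norm B'_def)
      then show "\<bar>u (x + h)\<bar> \<le> M" using elim by simp
    qed
  qed
  have "AE z in leb2. E z \<le> F z + (e1 z + e2 z)"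
    using AE_leb2_fst[OF ux] AE_leb2_snd[OF ux] AE_leb2_fst[OF uxh] AE_leb2_snd[OF uxh]
      Z_sgn AE_leb2_translation[OF Z_sgn, of h h]
  proof eventually_elim
    case (elim z)
    have sz: "in_sgn (Zh z) (a z)" "in_sgn (Z z) (b z)"
      using elim(5,6) by (auto simp: Zh_def a_def b_def)
    show ?case
    proof (cases "fst z \<in> B' \<and> snd z \<in> B'")
      case True
      have bd: "\<bar>w (fst z)\<bar> \<le> 2 * M" "\<bar>w (snd z)\<bar> \<le> 2 * M" "\<bar>a z\<bar> \<le> 2 * M" "\<bar>b z\<bar> \<le> 2 * M"
        using elim(1-4) True by (auto simp: w_def diff_def a_def b_def)
      have D: "D\<phi> z = \<eta> (fst z) * jp (\<delta> + 1) (w (fst z)) - \<eta> (snd z) * jp (\<delta> + 1) (w (snd z))"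
        using bd by (simp add: D\<phi>_def \<phi>_def clip_eq)
      have jQ: "\<bar>jp p (a z)\<bar> \<le> Q" "\<bar>jp p (b z)\<bar> \<le> Q"
        unfolding Q_def abs_jp using bd p by (auto intro!: powr_mono2)
      have "k2 z * ((\<eta> (fst z) + \<eta> (snd z)) / 2 * ((p - 1) * 2 powr (- \<delta>) * ((\<bar>a z\<bar> + \<bar>b z\<bar>) powr (p - 2) * \<bar>a z - b z\<bar> powr (\<delta> + 1))))
        \<le> F z + e1 z"
        unfolding F_def D using True
        caccioppoli_pointwise[OF p(1) less_imp_le[OF p(2)] \<delta> ab sz \<eta>01(1) \<eta>01(1) k0 jQ]
        by (simp add: e1_def)
      moreover have "E z \<le> k2 z * ((\<eta> (fst z) + \<eta> (snd z)) / 2 * ((p - 1) * 2 powr (- \<delta>) * ((\<bar>a z\<bar> + \<bar>b z\<bar>) powr (p - 2) * \<bar>a z - b z\<bar> powr (\<delta> + 1))))"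
      proof (cases "fst z \<in> ball x0 r \<and> snd z \<in> ball x0 r")
        case True
        then have "\<eta> (fst z) = 1" "\<eta> (snd z) = 1" using \<eta>1 by blast+
        then have "(\<eta> (fst z) + \<eta> (snd z)) / 2 = 1" by simp
        then show ?thesis using True unfolding E_def c_def by (simp only: if_True mult_1 simp_thms order_refl)
      next
        case False
        then have "E z = 0" unfolding E_def by (rule if_not_P)
        moreover have "0 \<le> (\<eta> (fst z) + \<eta> (snd z)) / 2" using \<eta>01(1)[of "fst z"] \<eta>01(1)[of "snd z"] by simp
        ultimately show ?thesis
          unfolding c_def[symmetric] using k0(2)[of z] less_imp_le[OF c]
          by (simp only:) (intro mult_nonneg_nonneg powr_ge_zero, assumption+)
      qed
      ultimately show ?thesis using e0(2)[of z] by simp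
    next
      case False
      have "fst z \<notin> ball x0 r \<or> snd z \<notin> ball x0 r" using False d by (auto simp: B'_def)
      then have E: "E z = 0" by (auto simp: E_def simp del: mem_ball)
      have D: "\<bar>D\<phi> z\<bar> \<le> \<bar>\<phi> (fst z)\<bar> + \<bar>\<phi> (snd z)\<bar>" by (simp add: D\<phi>_def)
      have Z2: "\<bar>Zh z - Z z\<bar> \<le> 2"
        using in_sgn_abs_le[OF sz(1)] in_sgn_abs_le[OF sz(2)] by simp
      have "\<bar>F z\<bar> \<le> \<bar>(Zh z - Z z) * D\<phi> z * k1 z\<bar> + \<bar>(jp p (a z) - jp p (b z)) * D\<phi> z * k2 z\<bar>"
        unfolding F_def by (rule abs_triangle_ineq)
      also have "\<dots> = \<bar>Zh z - Z z\<bar> * \<bar>D\<phi> z\<bar> * k1 z + \<bar>jp p (a z) - jp p (b z)\<bar> * \<bar>D\<phi> z\<bar> * k2 z"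
        using k0[of z] by (simp add: abs_mult)
      also have "\<dots> \<le> 2 * (\<bar>\<phi> (fst z)\<bar> + \<bar>\<phi> (snd z)\<bar>) * k1 z
          + (\<bar>jp p (a z)\<bar> + \<bar>jp p (b z)\<bar>) * (\<bar>\<phi> (fst z)\<bar> + \<bar>\<phi> (snd z)\<bar>) * k2 z"
        using k0[of z] by (intro add_mono mult_right_mono mult_mono Z2 D) auto
      also have "\<dots> = e2 z" using False by (auto simp: e2_def algebra_simps)
      finally show ?thesis using E e0(1)[of z] by simp
    qed
  qed
  then have "(\<integral>\<^sup>+z. ennreal (E z) \<partial>leb2) \<le> (\<integral>\<^sup>+z. ennreal (e1 z + e2 z) \<partial>leb2)"
    using e0 by (intro nn_integral_le_of_integral_zero[OF F]) auto
  also have "\<dots> = (\<integral>\<^sup>+z. ennreal (e1 z) \<partial>leb2) + (\<integral>\<^sup>+z. ennreal (e2 z) \<partial>leb2)"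
    using e0 by (simp add: nn_integral_add)
  finally have main: "(\<integral>\<^sup>+z. ennreal (E z) \<partial>leb2) \<le> (\<integral>\<^sup>+z. ennreal (e1 z) \<partial>leb2) + (\<integral>\<^sup>+z. ennreal (e2 z) \<partial>leb2)" .
  define I where "I = pow_int \<delta> B' w"
  \<comment> \<open>The increment of the cutoff lowers both kernel exponents by one, which makes
    them integrable in the point that does not carry \<open>w\<close>. The summand with the other
    point is its mirror image.\<close>
  have int1: "(\<integral>\<^sup>+z. ennreal (e1 z) \<partial>leb2) \<le> ennreal (2 * (1 / d * (C1 + Q * C2))) * I"
  proof -
    define n where "n x y = indicator (ball x 2) y * (ennreal (1 / norm (x - y) powr (\<beta>1 - 1)) + ennreal Q * ennreal (1 / norm (x - y) powr (\<beta> - 1)))" for x y :: 'a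
    define W where "W x = indicator B' x * ennreal (\<bar>w x\<bar> powr \<delta>)" for x
    define T where "T z = W (fst z) * (ennreal (1 / d) * n (fst z) (snd z))" for z
    have nsym: "n x y = n y x" for x y
      by (simp add: n_def indicator_def dist_commute norm_minus_commute)
    have nm [measurable]: "(\<lambda>z. n (fst z) (snd z)) \<in> borel_measurable leb2"
    proof -
      have [measurable]: "Measurable.pred leb2 (\<lambda>z :: 'a \<times> 'a. snd z \<in> ball (fst z) 2)" unfolding mem_ball by measurable
      show ?thesis unfolding n_def by measurable
    qed
    have Wm [measurable]: "W \<in> borel_measurable lebesgue" unfolding W_def[abs_def] B'_def by measurable
    have Tm [measurable]: "T \<in> borel_measurable leb2" unfolding T_def[abs_def] by measurable
    have IW: "I = (\<integral>\<^sup>+x. W x \<partial>lebesgue)" unfolding I_def pow_int_def W_def ..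
    have le: "ennreal (e1 z) \<le> T z + T (snd z, fst z)" for z
    proof (cases "fst z \<in> B' \<and> snd z \<in> B'")
      case True
      define t where "t = norm (fst z - snd z)"
      have "dist (fst z) (snd z) < 2"
        using True r d R dist_triangle3[of "fst z" "snd z" x0] by (simp add: B'_def)
      then have n: "n (fst z) (snd z) = ennreal (1 / t powr (\<beta>1 - 1)) + ennreal Q * ennreal (1 / t powr (\<beta> - 1))"
        by (simp add: n_def t_def)
      have "(k1 z + Q * k2 z) * \<bar>\<eta> (fst z) - \<eta> (snd z)\<bar> \<le> (k1 z + Q * k2 z) * (t / d)"
        using k0[of z] Q \<eta>L[of "fst z" "snd z"] by (intro mult_left_mono) (auto simp: t_def)
      also have "\<dots> = 1 / d * (t * (1 / t powr \<beta>1) + Q * (t * (1 / t powr \<beta>)))"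
        using d by (simp add: k1_def k2_def t_def field_simps)
      also have "\<dots> \<le> 1 / d * (1 / t powr (\<beta>1 - 1) + Q * (1 / t powr (\<beta> - 1)))"
        using d Q by (intro mult_left_mono add_mono mult_kernel_le) (auto simp: t_def)
      finally have 1: "(k1 z + Q * k2 z) * \<bar>\<eta> (fst z) - \<eta> (snd z)\<bar> \<le> 1 / d * (1 / t powr (\<beta>1 - 1) + Q * (1 / t powr (\<beta> - 1)))" .
      have "e1 z \<le> 1 / d * (1 / t powr (\<beta>1 - 1) + Q * (1 / t powr (\<beta> - 1))) * (\<bar>w (fst z)\<bar> powr \<delta> + \<bar>w (snd z)\<bar> powr \<delta>)"
        using True mult_right_mono[OF 1, of "\<bar>w (fst z)\<bar> powr \<delta> + \<bar>w (snd z)\<bar> powr \<delta>"]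
        by (simp add: e1_def mult.assoc)
      then have "ennreal (e1 z) \<le> ennreal (1 / d * (1 / t powr (\<beta>1 - 1) + Q * (1 / t powr (\<beta> - 1))) * (\<bar>w (fst z)\<bar> powr \<delta> + \<bar>w (snd z)\<bar> powr \<delta>))"
        by (rule ennreal_leI)
      also have "\<dots> = ennreal (1 / d * (1 / t powr (\<beta>1 - 1) + Q * (1 / t powr (\<beta> - 1)))) * (ennreal (\<bar>w (fst z)\<bar> powr \<delta>) + ennreal (\<bar>w (snd z)\<bar> powr \<delta>))"
        using d Q by (subst ennreal_mult) auto
      also have "ennreal (1 / d * (1 / t powr (\<beta>1 - 1) + Q * (1 / t powr (\<beta> - 1)))) = ennreal (1 / d) * n (fst z) (snd z)"
        
        proof -
          have q: "ennreal Q * ennreal (1 / t powr (\<beta> - 1)) = ennreal (Q * (1 / t powr (\<beta> - 1)))"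
            by (rule ennreal_mult[symmetric]) (use Q in auto)
          have "n (fst z) (snd z) = ennreal (1 / t powr (\<beta>1 - 1) + Q * (1 / t powr (\<beta> - 1)))"
            unfolding n q by (rule ennreal_plus[symmetric]) (use Q in auto)
          then show ?thesis by (simp only:) (rule ennreal_mult, use d Q in auto)
        qed
      also have "ennreal (1 / d) * n (fst z) (snd z) * (ennreal (\<bar>w (fst z)\<bar> powr \<delta>) + ennreal (\<bar>w (snd z)\<bar> powr \<delta>)) = T z + T (snd z, fst z)"
        using True nsym[of "snd z" "fst z"] by (simp add: T_def W_def distrib_left mult.commute)
      finally show ?thesis .
    qed (auto simp: e1_def)
    have intT: "(\<integral>\<^sup>+z. T z \<partial>leb2) \<le> ennreal (1 / d * (C1 + Q * C2)) * I"
    proof -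
      have nx [measurable]: "n x \<in> borel_measurable lebesgue" for x
        using measurable_compose_Pair1[OF _ nm, of x] by simp
      have nint: "(\<integral>\<^sup>+y. n x y \<partial>lebesgue) \<le> ennreal (C1 + Q * C2)" for x
      proof -
        have "(\<integral>\<^sup>+y. n x y \<partial>lebesgue) = (\<integral>\<^sup>+ y. indicator (ball x 2) y * ennreal (1 / norm (x - y) powr (\<beta>1 - 1))
            + ennreal Q * (indicator (ball x 2) y * ennreal (1 / norm (x - y) powr (\<beta> - 1))) \<partial>lebesgue)"
          by (intro nn_integral_cong) (simp add: n_def distrib_left mult_ac)
        also have "\<dots> = (\<integral>\<^sup>+ y. indicator (ball x 2) y * ennreal (1 / norm (x - y) powr (\<beta>1 - 1)) \<partial>lebesgue)
            + ennreal Q * (\<integral>\<^sup>+ y. indicator (ball x 2) y * ennreal (1 / norm (x - y) powr (\<beta> - 1)) \<partial>lebesgue)"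
          by (subst nn_integral_add, measurable, subst nn_integral_cmult, measurable)
        also have "\<dots> \<le> ennreal C1 + ennreal Q * ennreal C2"
          by (intro add_mono mult_left_mono near1 near2) auto
        also have "\<dots> = ennreal (C1 + Q * C2)"
          using C Q by (subst ennreal_mult[symmetric]) auto
        finally show ?thesis .
      qed
      have "(\<integral>\<^sup>+z. T z \<partial>leb2) = (\<integral>\<^sup>+x. \<integral>\<^sup>+y. T (x, y) \<partial>lebesgue \<partial>lebesgue)"
        by (rule leb.nn_integral_fst[symmetric]) measurable
      also have "\<dots> \<le> (\<integral>\<^sup>+x. ennreal (1 / d * (C1 + Q * C2)) * W x \<partial>lebesgue)"
      proof (rule nn_integral_mono)
        fix x
        have "(\<integral>\<^sup>+y. T (x, y) \<partial>lebesgue) = W x * (ennreal (1 / d) * (\<integral>\<^sup>+y. n x y \<partial>lebesgue))"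
          unfolding T_def fst_conv snd_conv by (subst nn_integral_cmult, measurable, subst nn_integral_cmult, measurable)
        also have "\<dots> \<le> W x * (ennreal (1 / d) * ennreal (C1 + Q * C2))"
          by (intro mult_left_mono nint) auto
        also have "ennreal (1 / d) * ennreal (C1 + Q * C2) = ennreal (1 / d * (C1 + Q * C2))"
          using d C Q by (intro ennreal_mult[symmetric]) auto
        finally show "(\<integral>\<^sup>+y. T (x, y) \<partial>lebesgue) \<le> ennreal (1 / d * (C1 + Q * C2)) * W x"
          by (simp only: mult.commute)
      qed
      also have "\<dots> = ennreal (1 / d * (C1 + Q * C2)) * I"
        unfolding IW by (rule nn_integral_cmult) measurable
      finally show ?thesis .
    qed
    have Tsm [measurable]: "(\<lambda>z. T (snd z, fst z)) \<in> borel_measurable leb2"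
    proof -
      have "(\<lambda>z. n (snd z) (fst z)) \<in> borel_measurable leb2" using nm by (simp add: nsym)
      then show ?thesis unfolding T_def fst_conv snd_conv by measurable
    qed
    have "(\<integral>\<^sup>+z. T (snd z, fst z) \<partial>leb2) = (\<integral>\<^sup>+y. \<integral>\<^sup>+x. T (y, x) \<partial>lebesgue \<partial>lebesgue)"
      using leb_pair.nn_integral_snd[OF Tsm] by simp
    also have "\<dots> = (\<integral>\<^sup>+z. T z \<partial>leb2)" by (rule leb.nn_integral_fst) measurable
    finally have swap: "(\<integral>\<^sup>+z. T (snd z, fst z) \<partial>leb2) = (\<integral>\<^sup>+z. T z \<partial>leb2)" .
    have "(\<integral>\<^sup>+z. ennreal (e1 z) \<partial>leb2) \<le> (\<integral>\<^sup>+z. T z + T (snd z, fst z) \<partial>leb2)"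
      by (rule nn_integral_mono) (rule le)
    also have "\<dots> = 2 * (\<integral>\<^sup>+z. T z \<partial>leb2)"
      by (subst nn_integral_add, measurable) (simp add: swap mult_2)
    also have "\<dots> \<le> 2 * (ennreal (1 / d * (C1 + Q * C2)) * I)"
      by (rule mult_left_mono[OF intT]) simp
    also have "\<dots> = ennreal (2 * (1 / d * (C1 + Q * C2))) * I"
      using d C Q by (subst ennreal_mult) (auto simp: mult.assoc)
    finally show ?thesis .
  qed
  define D where "D = (C4 + vol + 1) * m / d powr (\<beta> + sp * p)"
  have D0: "0 \<le> D" using C vol_nonneg m by (simp add: D_def)
  \<comment> \<open>\<open>e2\<close> vanishes on \<open>B' \<times> B'\<close>, so only far pairs
    survive; there \<open>\<phi>\<close> is 0 at the outer point, and the coefficients are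
    integrated over it by means of the far kernel and the tail.\<close>
  have int2: "(\<integral>\<^sup>+z. ennreal (e2 z) \<partial>leb2) \<le> ennreal (2 * (2 * (C3 / d powr \<beta>1) + 2 * D)) * I"
  proof -
    have inner: "AE x in lebesgue. indicator B x * (\<integral>\<^sup>+y. indicator (- ball x d) y * ennreal (e2 (x, y)) \<partial>lebesgue)
        \<le> ennreal (2 * (C3 / d powr \<beta>1) + 2 * D) * (indicator B' x * ennreal (\<bar>w x\<bar> powr \<delta>))"
      using ux uxh
    proof eventually_elim
      case (elim x)
      show ?case
      proof (cases "x \<in> B")
        case True
        then have xB': "x \<in> B'" using d by (auto simp: B_def B'_def)
        have dx: "dist x0 x \<le> R - d" using True r d by (simp add: B_def)
        have dxh: "dist x0 (x + h) \<le> R - d"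
          using True dist_triangle[of x0 "x + h" x] h r d by (simp add: dist_norm B_def)
        define f1 where "f1 y = indicator (- ball x d) y * ennreal (1 / norm (x - y) powr \<beta>1)" for y
        define f2 where "f2 y = indicator (- ball x d) y * ennreal (\<bar>jp p (u (x + h) - u (y + h))\<bar> / norm (x - y) powr \<beta>)" for y
        define f3 where "f3 y = indicator (- ball x d) y * ennreal (\<bar>jp p (u x - u y)\<bar> / norm (x - y) powr \<beta>)" for y
        have [measurable]: "f1 \<in> borel_measurable lebesgue" "f2 \<in> borel_measurable lebesgue" "f3 \<in> borel_measurable lebesgue"
          unfolding f1_def[abs_def] f2_def[abs_def] f3_def[abs_def] by measurable
        have "(\<integral>\<^sup>+y. indicator (- ball x d) y * ennreal (e2 (x, y)) \<partial>lebesgue)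
          \<le> (\<integral>\<^sup>+y. ennreal (\<bar>w x\<bar> powr \<delta>) * (ennreal 2 * f1 y + (f2 y + f3 y)) \<partial>lebesgue)"
        proof (rule nn_integral_mono)
          fix y
          show "indicator (- ball x d) y * ennreal (e2 (x, y)) \<le> ennreal (\<bar>w x\<bar> powr \<delta>) * (ennreal 2 * f1 y + (f2 y + f3 y))"
          proof (cases "y \<in> B' \<or> y \<in> ball x d")
            case True
            then show ?thesis using xB' by (auto simp: e2_def simp del: mem_ball)
          next
            case False
            then have "\<phi> y = 0" using d by (intro \<phi>0) (auto simp: B_def B'_def)
            then have "e2 (x, y) = (2 * k1 (x, y) + (\<bar>jp p (a (x, y))\<bar> + \<bar>jp p (b (x, y))\<bar>) * k2 (x, y)) * \<bar>\<phi> x\<bar>"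
              using False by (simp add: e2_def)
            also have "\<dots> \<le> (2 * k1 (x, y) + (\<bar>jp p (a (x, y))\<bar> + \<bar>jp p (b (x, y))\<bar>) * k2 (x, y)) * \<bar>w x\<bar> powr \<delta>"
              using k0[of "(x, y)"] by (intro mult_left_mono \<phi>w) auto
            also have "\<dots> = \<bar>w x\<bar> powr \<delta> * (2 * k1 (x, y) + (\<bar>jp p (a (x, y))\<bar> * k2 (x, y) + \<bar>jp p (b (x, y))\<bar> * k2 (x, y)))"
              by (simp add: algebra_simps)
            finally have "ennreal (e2 (x, y)) \<le> ennreal (\<bar>w x\<bar> powr \<delta> * (2 * k1 (x, y) + (\<bar>jp p (a (x, y))\<bar> * k2 (x, y) + \<bar>jp p (b (x, y))\<bar> * k2 (x, y))))"
              by (rule ennreal_leI)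
            also have "\<dots> = ennreal (\<bar>w x\<bar> powr \<delta>) * (ennreal 2 * ennreal (k1 (x, y)) + (ennreal (\<bar>jp p (a (x, y))\<bar> * k2 (x, y)) + ennreal (\<bar>jp p (b (x, y))\<bar> * k2 (x, y))))"
              using k0[of "(x, y)"] by (subst ennreal_mult, auto) (subst ennreal_mult, auto)
            also have "\<dots> = ennreal (\<bar>w x\<bar> powr \<delta>) * (ennreal 2 * f1 y + (f2 y + f3 y))"
              using False by (simp add: f1_def f2_def f3_def k1_def k2_def a_def b_def)
            finally show ?thesis using False by simp
          qed
        qed
        also have "\<dots> = ennreal (\<bar>w x\<bar> powr \<delta>) * (ennreal 2 * (\<integral>\<^sup>+y. f1 y \<partial>lebesgue) + ((\<integral>\<^sup>+y. f2 y \<partial>lebesgue) + (\<integral>\<^sup>+y. f3 y \<partial>lebesgue)))"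
          by (subst nn_integral_cmult, measurable, subst nn_integral_add, measurable,
              subst nn_integral_cmult, measurable, subst nn_integral_add, measurable)
        also have "\<dots> \<le> ennreal (\<bar>w x\<bar> powr \<delta>) * (ennreal 2 * ennreal (C3 / d powr \<beta>1) + (ennreal D + ennreal D))"
        proof (intro mult_left_mono add_mono)
          show "(\<integral>\<^sup>+y. f1 y \<partial>lebesgue) \<le> ennreal (C3 / d powr \<beta>1)"
            unfolding f1_def using d d1 by (intro far1) auto
          show "(\<integral>\<^sup>+y. f2 y \<partial>lebesgue) \<le> ennreal D"
            unfolding f2_def D_def m_def C4_def using elim xB'
            by (intro far_flux_bound_translated d d1 dxh) auto
          show "(\<integral>\<^sup>+y. f3 y \<partial>lebesgue) \<le> ennreal D"
            unfolding f3_def D_def m_def C4_def using elim xB'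
            by (intro far_flux_bound d d1 dx) auto
        qed auto
        also have "ennreal 2 * ennreal (C3 / d powr \<beta>1) + (ennreal D + ennreal D) = ennreal (2 * (C3 / d powr \<beta>1) + 2 * D)"
          using C D0 by (subst ennreal_mult[symmetric]) (auto simp flip: ennreal_plus)
        finally show ?thesis using True xB' by (simp add: mult.commute)
      qed simp
    qed
    have "(\<integral>\<^sup>+z. ennreal (e2 z) \<partial>leb2)
      \<le> (\<integral>\<^sup>+z. indicator (ball x0 (r + d + d)) (fst z) * indicator (ball x0 (r + d + d)) (snd z) * ennreal (e2 z) \<partial>leb2)
      + 2 * (\<integral>\<^sup>+x. indicator (ball x0 (r + d)) x * (\<integral>\<^sup>+y. indicator (- ball x d) y * ennreal (e2 (x, y)) \<partial>lebesgue) \<partial>lebesgue)"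
    proof (rule nn_integral_near_far_le)
      show "ennreal (e2 (x, y)) = ennreal (e2 (y, x))" for x y
      proof -
        have "\<bar>jp p (a (x, y))\<bar> = \<bar>jp p (a (y, x))\<bar>" "\<bar>jp p (b (x, y))\<bar> = \<bar>jp p (b (y, x))\<bar>"
          unfolding abs_jp by (simp_all add: a_def b_def abs_minus_commute)
        moreover have "k1 (x, y) = k1 (y, x)" "k2 (x, y) = k2 (y, x)"
          by (simp_all add: k1_def k2_def norm_minus_commute)
        ultimately show ?thesis by (simp add: e2_def conj_commute add.commute)
      qed
      show "ennreal (e2 (x, y)) = 0" if "x \<notin> ball x0 (r + d)" "y \<notin> ball x0 (r + d)" for x y
        using that \<phi>0[of x] \<phi>0[of y] by (simp add: e2_def B_def)
    qed (use d in auto)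
    also have "(\<integral>\<^sup>+z. indicator (ball x0 (r + d + d)) (fst z) * indicator (ball x0 (r + d + d)) (snd z) * ennreal (e2 z) \<partial>leb2) = (\<integral>\<^sup>+z. 0 \<partial>(leb2 :: ('a \<times> 'a) measure))"
      by (intro nn_integral_cong) (auto simp: e2_def B'_def rd indicator_def)
    also have "(\<integral>\<^sup>+z. 0 \<partial>(leb2 :: ('a \<times> 'a) measure)) + 2 * (\<integral>\<^sup>+x. indicator (ball x0 (r + d)) x * (\<integral>\<^sup>+y. indicator (- ball x d) y * ennreal (e2 (x, y)) \<partial>lebesgue) \<partial>lebesgue)
        \<le> 2 * (\<integral>\<^sup>+x. ennreal (2 * (C3 / d powr \<beta>1) + 2 * D) * (indicator B' x * ennreal (\<bar>w x\<bar> powr \<delta>)) \<partial>lebesgue)"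
      using inner unfolding B_def nn_integral_const by (simp, intro mult_left_mono nn_integral_mono_AE) auto
    also have "\<dots> = 2 * (ennreal (2 * (C3 / d powr \<beta>1) + 2 * D) * I)"
      unfolding I_def pow_int_def B'_def by (subst nn_integral_cmult, measurable)
    also have "\<dots> = ennreal (2 * (2 * (C3 / d powr \<beta>1) + 2 * D)) * I"
    proof -
      have "2 * ennreal x = ennreal (2 * x)" for x by (subst ennreal_mult') auto
      then show ?thesis by (simp only: mult.assoc[symmetric])
    qed
    finally show ?thesis .
  qed
  define Ct where "Ct = 2 * C1 + 4 * C2 + 4 * C3 + 4 * C4 + 4 * vol + 4"
  define P where "P = coercive_int p (\<delta> + 1) \<beta> (ball x0 r) u h"
  have "ennreal c * P = (\<integral>\<^sup>+z. ennreal (E z) \<partial>leb2)"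
    unfolding P_def coercive_int_def
  proof (subst nn_integral_cmult[symmetric])
    show "(\<integral>\<^sup>+ z. ennreal c * (indicator (ball x0 r) (fst z) * indicator (ball x0 r) (snd z) *
      ennreal ((\<bar>u (fst z + h) - u (snd z + h)\<bar> + \<bar>u (fst z) - u (snd z)\<bar>) powr (p - 2)
        * \<bar>diff h u (fst z) - diff h u (snd z)\<bar> powr (\<delta> + 1) / norm (fst z - snd z) powr \<beta>)) \<partial>leb2) = (\<integral>\<^sup>+z. ennreal (E z) \<partial>leb2)"
    proof (rule nn_integral_cong)
      fix z :: "'a \<times> 'a"
      have "ennreal c * ennreal ((\<bar>a z\<bar> + \<bar>b z\<bar>) powr (p - 2) * \<bar>a z - b z\<bar> powr (\<delta> + 1) / norm (fst z - snd z) powr \<beta>)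
        = ennreal (k2 z * (c * ((\<bar>a z\<bar> + \<bar>b z\<bar>) powr (p - 2) * \<bar>a z - b z\<bar> powr (\<delta> + 1))))"
        using c by (subst ennreal_mult[symmetric]) (auto simp: k2_def)
      then show "ennreal c * (indicator (ball x0 r) (fst z) * indicator (ball x0 r) (snd z) *
        ennreal ((\<bar>u (fst z + h) - u (snd z + h)\<bar> + \<bar>u (fst z) - u (snd z)\<bar>) powr (p - 2)
        * \<bar>diff h u (fst z) - diff h u (snd z)\<bar> powr (\<delta> + 1) / norm (fst z - snd z) powr \<beta>)) = ennreal (E z)"
        using ab[of z] by (cases "fst z \<in> ball x0 r \<and> snd z \<in> ball x0 r") (auto simp: E_def a_def b_def w_def simp del: mem_ball)
    qed
  qed measurable
  also have "\<dots> \<le> ennreal (2 * (1 / d * (C1 + Q * C2))) * I + ennreal (2 * (2 * (C3 / d powr \<beta>1) + 2 * D)) * I"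
    by (rule order_trans[OF main add_mono[OF int1 int2]])
  also have "\<dots> = ennreal (2 * (1 / d * (C1 + Q * C2)) + 2 * (2 * (C3 / d powr \<beta>1) + 2 * D)) * I"
    using d C Q D0 by (subst ennreal_plus) (auto simp: distrib_right)
  also have "\<dots> \<le> ennreal (Ct * m / d powr (real DIM('a) + 2)) * I"
  proof (intro mult_right_mono ennreal_leI)
    \<comment> \<open>All powers of \<open>1 / d\<close> are raised to the common one since
      \<open>d < 1\<close>, and \<open>m \<ge> 1\<close> supplies the power of \<open>M\<close>
      missing in the \<open>Z\<close> terms.\<close>
    define e where "e = 1 / d powr (real DIM('a) + 2)"
    have e: "1 / d powr t \<le> e" if "t \<le> real DIM('a) + 2" for t
      unfolding e_def using d d1 that by (intro divide_left_mono powr_mono') auto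
    have e0: "0 \<le> e" by (simp add: e_def)
    have "1 / d = 1 / d powr 1" using d by simp
    also have "\<dots> \<le> e" by (rule e) simp
    finally have x1: "1 / d * (C1 + Q * C2) \<le> e * ((C1 + 2 * C2) * m)"
    proof (rule mult_mono)
      have "C1 \<le> C1 * m" using m C mult_left_mono[of 1 m C1] by simp
      moreover have "Q * C2 \<le> 2 * m * C2" using Q C by (intro mult_right_mono) auto
      ultimately show "C1 + Q * C2 \<le> (C1 + 2 * C2) * m" by (simp add: algebra_simps)
    qed (use e0 C Q in auto)
    have "C3 * (1 / d powr \<beta>1) \<le> C3 * m * e"
      using e[of \<beta>1] s1 C m mult_left_mono[of 1 m C3] by (intro mult_mono) (auto simp: \<beta>1_def)
    then have x2: "C3 / d powr \<beta>1 \<le> C3 * m * e" by simp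
    have "(C4 + vol + 1) * m * (1 / d powr (\<beta> + sp * p)) \<le> (C4 + vol + 1) * m * e"
    proof (intro mult_left_mono)
      show "1 / d powr (\<beta> + sp * p) \<le> e" using sp(2) by (intro e) (simp add: \<beta>_def mult.commute)
    qed (use C m vol_nonneg in auto)
    then have x3: "D \<le> (C4 + vol + 1) * m * e" by (simp add: D_def)
    have "2 * (1 / d * (C1 + Q * C2)) + 2 * (2 * (C3 / d powr \<beta>1) + 2 * D)
      \<le> 2 * (e * ((C1 + 2 * C2) * m)) + 2 * (2 * (C3 * m * e) + 2 * ((C4 + vol + 1) * m * e))"
      by (intro add_mono mult_left_mono x1 x2 x3) auto
    also have "\<dots> = Ct * m * e" by (simp add: Ct_def algebra_simps)
    finally show "2 * (1 / d * (C1 + Q * C2)) + 2 * (2 * (C3 / d powr \<beta>1) + 2 * D) \<le> Ct * m / d powr (real DIM('a) + 2)"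
      by (simp add: e_def)
  qed simp
  finally have "ennreal c * P \<le> ennreal (Ct * m / d powr (real DIM('a) + 2)) * I" .
  moreover have "0 \<le> Ct" using C vol_nonneg by (simp add: Ct_def)
  ultimately have "P \<le> ennreal (Ct * m / d powr (real DIM('a) + 2) / c) * I"
    using m by (intro ennreal_le_of_cmult_le[OF c]) auto
  also have "Ct * m / d powr (real DIM('a) + 2) / c = 2 powr \<delta> / (p - 1) * Ct * m / d powr (real DIM('a) + 2)"
    by (simp add: c_def powr_minus field_simps)
  also have "2 powr \<delta> / (p - 1) * Ct = cacc_const TYPE('a) s1 sp p \<delta>"
    by (simp add: cacc_const_def Ct_def C1_def C2_def C3_def C4_def \<beta>1_def \<beta>_def vol_def)
  finally show ?thesis unfolding P_def m_def I_def B'_def w_def .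
qed

end

section \<open>Improving the differentiability exponent\<close>

text \<open>A weighted geometric mean is at most the maximum. The parameter \<open>t\<close>
  balances two quantities of different size; being pointwise, the bound can be integrated
  directly.\<close>

lemma powr_interpolation_le:
  fixes X Y t l :: real
  assumes "0 \<le> X" "0 \<le> Y" "0 < t" "0 \<le> l" "l \<le> 1"
  shows "X powr l * Y powr (1 - l) \<le> t powr l * (X / t + Y)"
proof -
  define m where "m = max (X / t) Y"
  have m: "0 \<le> m" using assms by (simp add: m_def max_def)
  have "X powr l * Y powr (1 - l) = t powr l * ((X / t) powr l * Y powr (1 - l))"
    using assms by (simp add: powr_divide)
  also have "\<dots> \<le> t powr l * (m powr l * m powr (1 - l))"
    using assms by (intro mult_left_mono mult_mono powr_mono2) (auto simp: m_def)
  also have "m powr l * m powr (1 - l) = m" using m by (simp add: powr_add[symmetric])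
  also have "t powr l * m \<le> t powr l * (X / t + Y)"
    using assms by (intro mult_left_mono) (auto simp: m_def)
  finally show ?thesis .
qed

text \<open>Lowers the power from \<open>q\<close> to \<open>\<delta>\<close> by comparing
  \<open>\<bar>w x\<bar> / t\<close> with 1; the level \<open>t\<close> stands for the expected size
  of \<open>w\<close>, and points below it contribute at most the volume.\<close>

lemma pow_int_interpolation:
  fixes w :: "'a::euclidean_space \<Rightarrow> real"
  assumes [measurable]: "w \<in> borel_measurable lebesgue"
    and \<delta>: "0 < \<delta>" "\<delta> \<le> q" and t: "0 < t" and r: "0 \<le> r"
  shows "pow_int \<delta> (ball c r) w
    \<le> ennreal (t powr \<delta>) * (ennreal (1 / t powr q) * pow_int q (ball c r) w + emeasure lebesgue (ball c r))"
proof -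
  have le: "\<bar>w x\<bar> powr \<delta> \<le> t powr \<delta> * (1 / t powr q * \<bar>w x\<bar> powr q + 1)" for x
  proof -
    have "(\<bar>w x\<bar> / t) powr \<delta> \<le> (\<bar>w x\<bar> / t) powr q + 1"
    proof (cases "\<bar>w x\<bar> / t \<le> 1")
      case True
      then have "(\<bar>w x\<bar> / t) powr \<delta> \<le> 1" using \<delta> t by (intro powr_le1) auto
      then show ?thesis by (rule add_increasing[rotated]) simp
    next
      case False
      then have "(\<bar>w x\<bar> / t) powr \<delta> \<le> (\<bar>w x\<bar> / t) powr q" using \<delta> by (intro powr_mono) auto
      then show ?thesis by simp
    qed
    then have "t powr \<delta> * (\<bar>w x\<bar> / t) powr \<delta> \<le> t powr \<delta> * ((\<bar>w x\<bar> / t) powr q + 1)"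
      by (rule mult_left_mono) simp
    moreover have "t powr \<delta> * (\<bar>w x\<bar> / t) powr \<delta> = \<bar>w x\<bar> powr \<delta>"
      using t by (simp add: powr_divide)
    ultimately show ?thesis by (simp only: powr_divide abs_idempotent) simp
  qed
  have "pow_int \<delta> (ball c r) w \<le> (\<integral>\<^sup>+x. ennreal (t powr \<delta>) * (ennreal (1 / t powr q) * (indicator (ball c r) x * ennreal (\<bar>w x\<bar> powr q))
      + indicator (ball c r) x) \<partial>lebesgue)"
    unfolding pow_int_def
  proof (rule nn_integral_mono)
    fix x
    have "ennreal (\<bar>w x\<bar> powr \<delta>) \<le> ennreal (t powr \<delta> * (1 / t powr q * \<bar>w x\<bar> powr q + 1))"
      by (rule ennreal_leI) (rule le)
    also have "\<dots> = ennreal (t powr \<delta>) * ennreal (1 / t powr q * \<bar>w x\<bar> powr q + 1)"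
      by (rule ennreal_mult) auto
    also have "ennreal (1 / t powr q * \<bar>w x\<bar> powr q + 1) = ennreal (1 / t powr q * \<bar>w x\<bar> powr q) + 1"
      by (subst ennreal_plus) auto
    also have "ennreal (1 / t powr q * \<bar>w x\<bar> powr q) = ennreal (1 / t powr q) * ennreal (\<bar>w x\<bar> powr q)"
      by (rule ennreal_mult) auto
    finally show "indicator (ball c r) x * ennreal (\<bar>w x\<bar> powr \<delta>)
      \<le> ennreal (t powr \<delta>) * (ennreal (1 / t powr q) * (indicator (ball c r) x * ennreal (\<bar>w x\<bar> powr q)) + indicator (ball c r) x)"
      by (cases "x \<in> ball c r") simp_all
  qed
  also have "\<dots> = ennreal (t powr \<delta>) * (\<integral>\<^sup>+x. ennreal (1 / t powr q) * (indicator (ball c r) x * ennreal (\<bar>w x\<bar> powr q))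
      + indicator (ball c r) x \<partial>lebesgue)"
    by (rule nn_integral_cmult) measurable
  also have "(\<integral>\<^sup>+x. ennreal (1 / t powr q) * (indicator (ball c r) x * ennreal (\<bar>w x\<bar> powr q))
      + indicator (ball c r) x \<partial>lebesgue)
    = (\<integral>\<^sup>+x. ennreal (1 / t powr q) * (indicator (ball c r) x * ennreal (\<bar>w x\<bar> powr q)) \<partial>lebesgue)
      + (\<integral>\<^sup>+x. indicator (ball c r) x \<partial>lebesgue)"
    by (rule nn_integral_add) measurable
  also have "(\<integral>\<^sup>+x. ennreal (1 / t powr q) * (indicator (ball c r) x * ennreal (\<bar>w x\<bar> powr q)) \<partial>lebesgue)
    = ennreal (1 / t powr q) * pow_int q (ball c r) w"
    unfolding pow_int_def by (rule nn_integral_cmult) measurable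
  also have "(\<integral>\<^sup>+x. indicator (ball c r) x \<partial>lebesgue) = emeasure lebesgue (ball c r)"
    by (rule nn_integral_indicator) (rule ball_in_lebesgue)
  finally show ?thesis .
qed

text \<open>Pointwise Hoelder interpolation between the degenerate quantity
  \<open>(|a| + |b|)^(p-2) |a - b|^(\<delta>+1)\<close>, \<open>\<delta> = q + 1 - p\<close>, and \<open>(|a| + |b|)^q\<close>: the exponents are chosen
  such that the powers of \<open>|a| + |b|\<close> cancel.\<close>

lemma weighted_interpolation_le:
  fixes a b n q p l t \<sigma> N sp :: real
  assumes p: "1 < p" "p < 2" and q: "1 \<le> q" and l: "l = q / (q + 2 - p)" and t: "0 < t" and n: "0 < n"
  shows "\<bar>a - b\<bar> powr q / n powr (N + (l * (sp * p) + (1 - l) * (\<sigma> * q)))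
    \<le> t powr l * (((\<bar>a\<bar> + \<bar>b\<bar>) powr (p - 2) * \<bar>a - b\<bar> powr (q + 2 - p) / n powr (N + sp * p)) / t
        + (\<bar>a\<bar> + \<bar>b\<bar>) powr q / n powr (N + \<sigma> * q))"
proof (cases "a = b")
  case True
  then show ?thesis using q t by simp
next
  case False
  define s where "s = \<bar>a\<bar> + \<bar>b\<bar>"
  have s: "s > 0" using False by (auto simp: s_def)
  define X where "X = s powr (p - 2) * \<bar>a - b\<bar> powr (q + 2 - p) / n powr (N + sp * p)"
  define Y where "Y = s powr q / n powr (N + \<sigma> * q)"
  have l01: "0 \<le> l" "l \<le> 1" using p q by (auto simp: l)
  have l1: "(q + 2 - p) * l = q" using p q by (simp add: l)
  have l2: "(p - 2) * l + q * (1 - l) = 0" using l1 by (simp add: algebra_simps)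
  have "X powr l * Y powr (1 - l)
      = (s powr ((p - 2) * l) * s powr (q * (1 - l))) * \<bar>a - b\<bar> powr ((q + 2 - p) * l)
        / (n powr ((N + sp * p) * l) * n powr ((N + \<sigma> * q) * (1 - l)))"
    by (simp add: X_def Y_def powr_divide powr_mult powr_powr)
  also have "s powr ((p - 2) * l) * s powr (q * (1 - l)) = 1"
    unfolding powr_add[symmetric] l2 using s by simp
  also have "n powr ((N + sp * p) * l) * n powr ((N + \<sigma> * q) * (1 - l)) = n powr (N + (l * (sp * p) + (1 - l) * (\<sigma> * q)))"
    unfolding powr_add[symmetric] by (rule arg_cong[where f = "\<lambda>e. n powr e"]) (simp add: algebra_simps)
  finally have "\<bar>a - b\<bar> powr q / n powr (N + (l * (sp * p) + (1 - l) * (\<sigma> * q))) = X powr l * Y powr (1 - l)"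
    by (simp add: l1)
  also have "\<dots> \<le> t powr l * (X / t + Y)"
    by (rule powr_interpolation_le) (use l01 t in \<open>auto simp: X_def Y_def\<close>)
  finally show ?thesis unfolding X_def Y_def s_def .
qed

text \<open>The integrated form of \<open>weighted_interpolation_le\<close>; \<open>\<theta>\<close>
  is forced by the exponents of the kernels. The shifted ball appears because \<open>a\<close> is
  the increment of \<open>u\<close> over the translated pair.\<close>

lemma gagliardo_diff_interpolation:
  fixes u :: "'a::euclidean_space \<Rightarrow> real" and h :: 'a
  assumes [measurable]: "u \<in> borel_measurable lebesgue"
    and p: "1 < p" "p < 2" and q: "1 \<le> q" and l: "l = q / (q + 2 - p)" and t: "0 < t"
    and \<theta>: "\<theta> * q = l * (sp * p) + (1 - l) * (\<sigma> * q)"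
    and e: "0 \<le> e" "coercive_int p (q + 2 - p) (real DIM('a) + sp * p) (ball c r) u h \<le> ennreal e"
    and y: "0 \<le> y" "gagliardo_int \<sigma> q (ball (c + h) r) u \<le> ennreal y" "gagliardo_int \<sigma> q (ball c r) u \<le> ennreal y"
  shows "gagliardo_int \<theta> q (ball c r) (diff h u) \<le> ennreal (t powr l * (e / t + 2 powr q * (2 * y)))"
proof -
  define N where "N = real DIM('a)"
  define B where "B = ball c r"
  define a where "a z = u (fst z + h) - u (snd z + h)" for z :: "'a \<times> 'a"
  define b where "b z = u (fst z) - u (snd z)" for z :: "'a \<times> 'a"
  define n where "n z = norm (fst z - snd z)" for z :: "'a \<times> 'a"
  have [measurable]: "a \<in> borel_measurable leb2" "b \<in> borel_measurable leb2" "n \<in> borel_measurable leb2"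
    unfolding a_def[abs_def] b_def[abs_def] n_def[abs_def] by measurable
  have ab: "diff h u (fst z) - diff h u (snd z) = a z - b z" for z
    by (simp add: diff_def a_def b_def)
  define i where "i z = (indicator B (fst z) * indicator B (snd z) :: ennreal)" for z
  have im [measurable]: "i \<in> borel_measurable leb2" unfolding i_def[abs_def] B_def by measurable
  define X where "X z = i z * ennreal ((\<bar>a z\<bar> + \<bar>b z\<bar>) powr (p - 2) * \<bar>a z - b z\<bar> powr (q + 2 - p) / n z powr (N + sp * p))" for z
  define Ya where "Ya z = i z * ennreal (\<bar>a z\<bar> powr q / n z powr (N + \<sigma> * q))" for z
  define Yb where "Yb z = i z * ennreal (\<bar>b z\<bar> powr q / n z powr (N + \<sigma> * q))" for z
  have [measurable]: "X \<in> borel_measurable leb2" "Ya \<in> borel_measurable leb2" "Yb \<in> borel_measurable leb2"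
    unfolding X_def[abs_def] Ya_def[abs_def] Yb_def[abs_def] by measurable
  have le: "i z * ennreal (\<bar>a z - b z\<bar> powr q / n z powr (N + \<theta> * q))
    \<le> ennreal (t powr l) * (ennreal (1 / t) * X z + ennreal (2 powr q) * (Ya z + Yb z))" for z
  proof (cases "n z = 0")
    case True
    then have "a z = b z" by (simp add: n_def a_def b_def)
    then show ?thesis using q by simp
  next
    case False
    then have n0: "0 < n z" by (simp add: n_def)
    define x where "x = (\<bar>a z\<bar> + \<bar>b z\<bar>) powr (p - 2) * \<bar>a z - b z\<bar> powr (q + 2 - p) / n z powr (N + sp * p)"
    define ya where "ya = \<bar>a z\<bar> powr q / n z powr (N + \<sigma> * q)"
    define yb where "yb = \<bar>b z\<bar> powr q / n z powr (N + \<sigma> * q)"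
    have nn: "0 \<le> x" "0 \<le> ya" "0 \<le> yb" by (auto simp: x_def ya_def yb_def)
    have "\<bar>a z - b z\<bar> powr q / n z powr (N + \<theta> * q) \<le> t powr l * (x / t + (\<bar>a z\<bar> + \<bar>b z\<bar>) powr q / n z powr (N + \<sigma> * q))"
      unfolding \<theta> x_def by (rule weighted_interpolation_le[OF p q l t n0])
    also have "\<dots> \<le> t powr l * (1 / t * x + 2 powr q * (ya + yb))"
    proof (intro mult_left_mono add_mono)
      have "(\<bar>a z\<bar> + \<bar>b z\<bar>) powr q / n z powr (N + \<sigma> * q) \<le> 2 powr q * (\<bar>a z\<bar> powr q + \<bar>b z\<bar> powr q) / n z powr (N + \<sigma> * q)"
        using q by (intro divide_right_mono powr_add_le) auto
      then show "(\<bar>a z\<bar> + \<bar>b z\<bar>) powr q / n z powr (N + \<sigma> * q) \<le> 2 powr q * (ya + yb)"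
        by (simp add: ya_def yb_def add_divide_distrib[symmetric])
    qed simp_all
    finally have "ennreal (\<bar>a z - b z\<bar> powr q / n z powr (N + \<theta> * q)) \<le> ennreal (t powr l * (1 / t * x + 2 powr q * (ya + yb)))"
      by (rule ennreal_leI)
    also have "\<dots> = ennreal (t powr l) * ennreal (1 / t * x + 2 powr q * (ya + yb))"
      using nn t by (intro ennreal_mult) auto
    also have "ennreal (1 / t * x + 2 powr q * (ya + yb)) = ennreal (1 / t * x) + ennreal (2 powr q * (ya + yb))"
      using nn t by (intro ennreal_plus) auto
    also have "ennreal (1 / t * x) = ennreal (1 / t) * ennreal x"
      using nn t by (intro ennreal_mult) auto
    also have "ennreal (2 powr q * (ya + yb)) = ennreal (2 powr q) * ennreal (ya + yb)"
      using nn by (intro ennreal_mult) auto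
    also have "ennreal (ya + yb) = ennreal ya + ennreal yb"
      using nn by (intro ennreal_plus) auto
    finally show ?thesis
      by (cases "fst z \<in> B \<and> snd z \<in> B") (auto simp: i_def X_def Ya_def Yb_def x_def ya_def yb_def)
  qed
  have "gagliardo_int \<theta> q B (diff h u) = (\<integral>\<^sup>+z. i z * ennreal (\<bar>a z - b z\<bar> powr q / n z powr (N + \<theta> * q)) \<partial>leb2)"
    unfolding gagliardo_int_alt ab i_def n_def N_def ..
  also have "\<dots> \<le> (\<integral>\<^sup>+z. ennreal (t powr l) * (ennreal (1 / t) * X z + ennreal (2 powr q) * (Ya z + Yb z)) \<partial>leb2)"
    by (rule nn_integral_mono) (rule le)
  also have "\<dots> = ennreal (t powr l) * (ennreal (1 / t) * (\<integral>\<^sup>+z. X z \<partial>leb2)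
      + ennreal (2 powr q) * ((\<integral>\<^sup>+z. Ya z \<partial>leb2) + (\<integral>\<^sup>+z. Yb z \<partial>leb2)))"
    by (subst nn_integral_cmult, measurable, subst nn_integral_add, measurable, subst nn_integral_cmult, measurable,
        subst nn_integral_cmult, measurable, subst nn_integral_add, measurable)
  also have "\<dots> \<le> ennreal (t powr l) * (ennreal (1 / t) * ennreal e + ennreal (2 powr q) * (ennreal y + ennreal y))"
  proof (intro mult_left_mono add_mono)
    show "(\<integral>\<^sup>+z. X z \<partial>leb2) \<le> ennreal e"
      using e(2) unfolding coercive_int_def X_def i_def B_def N_def n_def ab a_def[symmetric] b_def[symmetric] .
    have "(\<integral>\<^sup>+z. Ya z \<partial>leb2) = gagliardo_int \<sigma> q (ball c r) (\<lambda>x. u (x + h))"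
      unfolding gagliardo_int_alt Ya_def i_def B_def N_def n_def a_def ..
    also have "\<dots> = gagliardo_int \<sigma> q (ball (c + h) r) u" by (rule gagliardo_int_translation) measurable
    finally show "(\<integral>\<^sup>+z. Ya z \<partial>leb2) \<le> ennreal y" using y(2) by simp
    have "(\<integral>\<^sup>+z. Yb z \<partial>leb2) = gagliardo_int \<sigma> q (ball c r) u"
      unfolding gagliardo_int_alt Yb_def i_def B_def N_def n_def b_def ..
    then show "(\<integral>\<^sup>+z. Yb z \<partial>leb2) \<le> ennreal y" using y(3) by simp
  qed auto
  also have "ennreal y + ennreal y = ennreal (2 * y)" using y(1) by (simp flip: ennreal_plus)
  also have "ennreal (2 powr q) * ennreal (2 * y) = ennreal (2 powr q * (2 * y))"
    using y(1) by (intro ennreal_mult[symmetric]) auto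
  also have "ennreal (1 / t) * ennreal e = ennreal (e / t)"
    using e(1) t by (subst ennreal_mult[symmetric]) auto
  also have "ennreal (e / t) + ennreal (2 powr q * (2 * y)) = ennreal (e / t + 2 powr q * (2 * y))"
    using e(1) t y(1) by (intro ennreal_plus[symmetric]) auto
  also have "ennreal (t powr l) * ennreal (e / t + 2 powr q * (2 * y)) = ennreal (t powr l * (e / t + 2 powr q * (2 * y)))"
    using e(1) t y(1) by (intro ennreal_mult[symmetric]) auto
  finally show ?thesis unfolding B_def .
qed

text \<open>At order \<open>sp * p / q\<close> and power \<open>q\<close> the kernel coincides with
  that of the seminorm of order \<open>sp\<close> and power \<open>p\<close>; the surplus power
  \<open>q - p\<close> of the increment is paid by the sup bound.\<close>

lemma (in local_solution) gagliardo_base: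
  assumes q: "p \<le> q"
  shows "gagliardo_int (sp * p / q) q (ball x0 R) u \<le> ennreal (2 powr q * M powr q)"
proof -
  define B where "B = ball x0 R"
  define g where "g z = indicator B (fst z) * indicator B (snd z) *
      ennreal (\<bar>u (fst z) - u (snd z)\<bar> powr p / norm (fst z - snd z) powr \<beta>)" for z
  have gm [measurable]: "g \<in> borel_measurable leb2" unfolding g_def[abs_def] B_def by measurable
  have k: "real DIM('a) + sp * p / q * q = \<beta>" using q p by (simp add: \<beta>_def)
  have "gagliardo_int (sp * p / q) q B u \<le> (\<integral>\<^sup>+z. ennreal ((2 * M) powr (q - p)) * g z \<partial>leb2)"
    unfolding gagliardo_int_alt k
  proof (rule nn_integral_mono_AE)
    show "AE z in leb2. indicator B (fst z) * indicator B (snd z) * ennreal (\<bar>u (fst z) - u (snd z)\<bar> powr q / norm (fst z - snd z) powr \<beta>)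
      \<le> ennreal ((2 * M) powr (q - p)) * g z"
      using AE_leb2_fst[OF u_bounded] AE_leb2_snd[OF u_bounded]
    proof eventually_elim
      case (elim z)
      show ?case
      proof (cases "fst z \<in> B \<and> snd z \<in> B")
        case True
        then have "\<bar>u (fst z) - u (snd z)\<bar> \<le> 2 * M" using elim by (auto simp: B_def)
        then have "\<bar>u (fst z) - u (snd z)\<bar> powr (q - p) * \<bar>u (fst z) - u (snd z)\<bar> powr p
          \<le> (2 * M) powr (q - p) * \<bar>u (fst z) - u (snd z)\<bar> powr p"
          using q by (intro mult_right_mono powr_mono2) auto
        then have "\<bar>u (fst z) - u (snd z)\<bar> powr q \<le> (2 * M) powr (q - p) * \<bar>u (fst z) - u (snd z)\<bar> powr p"
          by (simp add: powr_add[symmetric])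
        then have "\<bar>u (fst z) - u (snd z)\<bar> powr q / norm (fst z - snd z) powr \<beta>
           \<le> (2 * M) powr (q - p) * \<bar>u (fst z) - u (snd z)\<bar> powr p / norm (fst z - snd z) powr \<beta>"
          by (rule divide_right_mono) simp
        also have "\<dots> = (2 * M) powr (q - p) * (\<bar>u (fst z) - u (snd z)\<bar> powr p / norm (fst z - snd z) powr \<beta>)"
          by simp
        finally have "ennreal (\<bar>u (fst z) - u (snd z)\<bar> powr q / norm (fst z - snd z) powr \<beta>)
          \<le> ennreal ((2 * M) powr (q - p) * (\<bar>u (fst z) - u (snd z)\<bar> powr p / norm (fst z - snd z) powr \<beta>))"
          by (rule ennreal_leI)
        also have "\<dots> = ennreal ((2 * M) powr (q - p)) * ennreal (\<bar>u (fst z) - u (snd z)\<bar> powr p / norm (fst z - snd z) powr \<beta>)"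
          by (rule ennreal_mult) auto
        finally show ?thesis using True by (simp add: g_def)
      qed auto
    qed
  qed
  also have "\<dots> = ennreal ((2 * M) powr (q - p)) * gagliardo_int sp p B u"
    unfolding gagliardo_int_alt \<beta>_def[symmetric] g_def[symmetric] by (rule nn_integral_cmult) measurable
  also have "\<dots> \<le> ennreal ((2 * M) powr (q - p)) * ennreal (M powr p)"
    unfolding B_def by (rule mult_left_mono[OF gagliardo_p]) simp
  also have "\<dots> = ennreal ((2 * M) powr (q - p) * M powr p)"
    by (rule ennreal_mult[symmetric]) auto
  also have "\<dots> \<le> ennreal (2 powr q * M powr q)"
  proof (rule ennreal_leI)
    have "(2 * M) powr (q - p) * M powr p = 2 powr (q - p) * M powr q"
      by (simp add: powr_mult powr_add[symmetric])
    also have "\<dots> \<le> 2 powr q * M powr q" using p by (intro mult_right_mono powr_mono) auto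
    finally show "(2 * M) powr (q - p) * M powr p \<le> 2 powr q * M powr q" .
  qed
  finally show ?thesis unfolding B_def .
qed

context local_solution
begin

text \<open>One round of improvement, each passage spending \<open>2 * d\<close>: the known seminorm
  on radius \<open>r + 6 d\<close>, the size of \<open>w\<close> on \<open>r + 4 d\<close>,
  Caccioppoli and interpolation on \<open>r + 2 d\<close>, the difference of \<open>w\<close> on
  \<open>r\<close>.\<close>

lemma second_diff_bound:
  fixes h :: 'a
  assumes q: "p \<le> q" and \<sigma>: "0 < \<sigma>" and r: "0 < r" and d: "0 < d" and rd: "r + 8 * d = R"
    and h: "h \<noteq> 0" "norm h \<le> d"
    and \<delta>: "\<delta> = q + 1 - p" and l: "l = q / (q + 2 - p)"
    and \<theta>: "\<theta> = (l * (sp * p) + (1 - l) * (\<sigma> * q)) / q"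
    and s: "s = (sp * p + \<sigma> * (q + 3 - 2 * p)) / (q + 2 - p)"
    and Cac: "Cac = cacc_const TYPE('a) s1 sp p \<delta>" and CA: "CA = nik_const TYPE('a) \<sigma> q" and CB: "CB = nik_const TYPE('a) \<theta> q"
    and y: "0 \<le> y" "gagliardo_int \<sigma> q (ball x0 (r + 6 * d)) u \<le> ennreal y"
  shows "pow_int q (ball x0 r) (diff h (diff h u))
    \<le> ennreal (CB * (Cac / d powr (real DIM('a) + 2) * (CA * y + vol * M powr q) + 2 powr q * (2 * y)) * norm h powr (s * q))"
proof -
  define N where "N = real DIM('a)"
  define H where "H = norm h"
  have H: "0 < H" "H \<le> d" using h by (auto simp: H_def)
  have q1: "1 < q" using p q by simp
  have qp: "0 < q + 2 - p" using p q1 by simp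
  have \<delta>1: "1 \<le> \<delta>" "\<delta> \<le> q" using p q by (auto simp: \<delta>)
  have vol: "0 < vol" by (simp add: vol_def)
  have CA0: "0 \<le> CA" and CB0: "0 \<le> CB" by (simp_all add: CA CB)
  have Cac0: "0 \<le> Cac" using p by (simp add: Cac cacc_const_def)
  \<comment> \<open>The size of \<open>w\<close> that order \<open>\<sigma>\<close> predicts: at
    this level the two terms in the bracket of \<open>pow_int_interpolation\<close> are free of
    \<open>h\<close>.\<close>
  define \<tau> where "\<tau> = M * H powr \<sigma>"
  have \<tau>: "0 < \<tau>" using M H by (simp add: \<tau>_def)
  \<comment> \<open>The dependence of the Caccioppoli bound on \<open>h\<close>; as the balancing
    parameter it makes \<open>e / t\<close> free of \<open>h\<close>.\<close>
  define t where "t = H powr (\<sigma> * \<delta>)"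
  have t: "0 < t" using H by (simp add: t_def)
  define rr where "rr = r + 2 * d"
  have "pow_int q (ball x0 (r + 4 * d)) (diff h u)
    \<le> ennreal (CA * H powr (\<sigma> * q)) * gagliardo_int \<sigma> q (ball x0 (r + 6 * d)) u"
    unfolding CA H_def using q1 \<sigma> h by (intro pow_int_diff_le_gagliardo) auto
  also have "\<dots> \<le> ennreal (CA * H powr (\<sigma> * q)) * ennreal y"
    by (rule mult_left_mono[OF y(2)]) simp
  also have "\<dots> = ennreal (CA * H powr (\<sigma> * q) * y)"
    using CA0 y by (intro ennreal_mult[symmetric]) auto
  finally have nik: "pow_int q (ball x0 (r + 4 * d)) (diff h u) \<le> ennreal (CA * H powr (\<sigma> * q) * y)" .
  have "pow_int \<delta> (ball x0 (r + 4 * d)) (diff h u)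
    \<le> ennreal (\<tau> powr \<delta>) * (ennreal (1 / \<tau> powr q) * pow_int q (ball x0 (r + 4 * d)) (diff h u) + emeasure lebesgue (ball x0 (r + 4 * d)))"
    using \<delta>1 \<tau> r d by (intro pow_int_interpolation) auto
  also have "\<dots> \<le> ennreal (\<tau> powr \<delta>) * (ennreal (1 / \<tau> powr q) * ennreal (CA * H powr (\<sigma> * q) * y) + ennreal vol)"
  proof (intro mult_left_mono add_mono nik)
    have "(r + 4 * d) powr N \<le> 1" using r d rd R by (intro powr_le1) (auto simp: N_def)
    then have "vol * (r + 4 * d) powr N \<le> vol" using vol by (intro mult_left_le) auto
    then show "emeasure lebesgue (ball x0 (r + 4 * d)) \<le> ennreal vol"
      using emeasure_lebesgue_ball[of "r + 4 * d" x0] r d by (simp add: vol_def N_def ennreal_leI del: emeasure_completion)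
  qed auto
  also have "\<dots> = ennreal (\<tau> powr \<delta>) * (ennreal (1 / \<tau> powr q * (CA * H powr (\<sigma> * q) * y)) + ennreal vol)"
    using CA0 y by (subst ennreal_mult[symmetric]) auto
  also have "\<dots> = ennreal (\<tau> powr \<delta> * (1 / \<tau> powr q * (CA * H powr (\<sigma> * q) * y) + vol))"
    using CA0 y vol by (subst ennreal_plus[symmetric], simp, simp) (subst ennreal_mult[symmetric], auto)
  also have "\<tau> powr \<delta> * (1 / \<tau> powr q * (CA * H powr (\<sigma> * q) * y) + vol) = t * M powr \<delta> * (CA * y / M powr q + vol)"
    using H M by (simp add: \<tau>_def t_def powr_mult powr_powr)
  finally have pd: "pow_int \<delta> (ball x0 (r + 4 * d)) (diff h u) \<le> ennreal (t * M powr \<delta> * (CA * y / M powr q + vol))" .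
  define e where "e = Cac / d powr (N + 2) * t * (CA * y + vol * M powr q)"
  have e0: "0 \<le> e" using Cac0 t CA0 y vol by (simp add: e_def)
  have "coercive_int p (\<delta> + 1) \<beta> (ball x0 rr) u h
    \<le> ennreal (Cac * M powr (p - 1) / d powr (N + 2)) * pow_int \<delta> (ball x0 (rr + 2 * d)) (diff h u)"
    unfolding Cac N_def
    by (rule caccioppoli[OF \<delta>1(1) d _ _ h(2)]) (use r d rd in \<open>auto simp: rr_def\<close>)
  also have "rr + 2 * d = r + 4 * d" by (simp add: rr_def)
  also have "ennreal (Cac * M powr (p - 1) / d powr (N + 2)) * pow_int \<delta> (ball x0 (r + 4 * d)) (diff h u)
    \<le> ennreal (Cac * M powr (p - 1) / d powr (N + 2)) * ennreal (t * M powr \<delta> * (CA * y / M powr q + vol))"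
    by (rule mult_left_mono[OF pd]) simp
  also have "\<dots> = ennreal (Cac * M powr (p - 1) / d powr (N + 2) * (t * M powr \<delta> * (CA * y / M powr q + vol)))"
    using Cac0 t CA0 y vol by (intro ennreal_mult[symmetric]) auto
  also have "Cac * M powr (p - 1) / d powr (N + 2) * (t * M powr \<delta> * (CA * y / M powr q + vol)) = e"
  proof -
    have "M powr (p - 1) * M powr \<delta> = M powr q" unfolding powr_add[symmetric] \<delta> by simp
    then have "Cac * M powr (p - 1) / d powr (N + 2) * (t * M powr \<delta> * (CA * y / M powr q + vol))
      = Cac / d powr (N + 2) * t * (M powr q * (CA * y / M powr q + vol))"
      by (simp add: mult_ac)
    also have "M powr q * (CA * y / M powr q + vol) = CA * y + vol * M powr q"
      using M by (simp add: distrib_left)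
    finally show ?thesis by (simp add: e_def)
  qed
  finally have EE': "coercive_int p (\<delta> + 1) \<beta> (ball x0 rr) u h \<le> ennreal e" .
  have "\<delta> + 1 = q + 2 - p" by (simp add: \<delta>)
  with EE' have EE: "coercive_int p (q + 2 - p) (real DIM('a) + sp * p) (ball x0 rr) u h \<le> ennreal e"
    by (simp only: \<beta>_def)
  have sub1: "ball x0 rr \<subseteq> ball x0 (r + 6 * d)" using d by (intro subset_ball) (simp add: rr_def)
  have sub2: "ball (x0 + h) rr \<subseteq> ball x0 (r + 6 * d)"
  proof
    fix x assume "x \<in> ball (x0 + h) rr"
    then show "x \<in> ball x0 (r + 6 * d)"
      using dist_triangle[of x0 x "x0 + h"] h d by (simp add: dist_norm rr_def)
  qed
  have \<theta>q: "\<theta> * q = l * (sp * p) + (1 - l) * (\<sigma> * q)" using q1 by (simp add: \<theta>)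
  have G: "gagliardo_int \<theta> q (ball x0 rr) (diff h u) \<le> ennreal (t powr l * (e / t + 2 powr q * (2 * y)))"
    using order_trans[OF gagliardo_int_mono_set[OF sub1] y(2)] order_trans[OF gagliardo_int_mono_set[OF sub2] y(2)]
    by (intro gagliardo_diff_interpolation[OF u_measurable p less_imp_le[OF q1] l t \<theta>q e0 EE y(1)])
  define K where "K = Cac / d powr (N + 2) * (CA * y + vol * M powr q) + 2 powr q * (2 * y)"
  have K0: "0 \<le> K" using Cac0 CA0 y vol by (simp add: K_def)
  have eK: "e / t + 2 powr q * (2 * y) = K" using t by (simp add: e_def K_def)
  have l0: "0 \<le> l" "l \<le> 1" using q1 qp p by (auto simp: l)
  have \<theta>q0: "0 \<le> \<theta> * q" unfolding \<theta>q using l0 sp p \<sigma> q1 by simp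
  have "pow_int q (ball x0 r) (diff h (diff h u))
    \<le> ennreal (CB * H powr (\<theta> * q)) * gagliardo_int \<theta> q (ball x0 rr) (diff h u)"
    unfolding CB H_def using q1 \<theta>q0 h by (intro pow_int_diff_le_gagliardo) (auto simp: rr_def)
  also have "\<dots> \<le> ennreal (CB * H powr (\<theta> * q)) * ennreal (t powr l * K)"
    using G unfolding eK by (rule mult_left_mono) simp
  also have "\<dots> = ennreal (CB * H powr (\<theta> * q) * (t powr l * K))"
    using CB0 K0 by (intro ennreal_mult[symmetric]) auto
  also have "CB * H powr (\<theta> * q) * (t powr l * K) = CB * K * H powr (s * q)"
  proof -
    have "H powr (\<theta> * q) * t powr l = H powr (\<theta> * q + \<sigma> * \<delta> * l)"
      by (simp add: t_def powr_powr powr_add)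
    \<comment> \<open>The count of exponents: order \<open>\<theta>\<close> of \<open>w\<close>
      together with the factor \<open>t powr l\<close> gives exactly \<open>s\<close>, by
      \<open>l * (q + 2 - p) = q\<close>.\<close>
    also have "\<theta> * q + \<sigma> * \<delta> * l = s * q"
    proof -
      have lq: "l * (q + 2 - p) = q" using qp by (simp add: l)
      have "(1 - l) * q = l * (2 - p)"
      proof -
        have "(1 - l) * q = q - l * q" by (simp add: algebra_simps)
        also have "\<dots> = l * (q + 2 - p) - l * q" by (simp only: lq)
        finally show ?thesis by (simp add: algebra_simps)
      qed
      then have "(1 - l) * (\<sigma> * q) = \<sigma> * (l * (2 - p))" by (simp add: mult.left_commute)
      then have "\<theta> * q + \<sigma> * \<delta> * l = l * (sp * p + \<sigma> * (q + 3 - 2 * p))"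
        unfolding \<theta>q \<delta> by (simp add: algebra_simps)
      also have "\<dots> = s * q" by (simp add: l s)
      finally show ?thesis .
    qed
    finally show ?thesis by (simp add: mult_ac)
  qed
  finally show ?thesis by (simp add: K_def N_def H_def)
qed

text \<open>The crude bound from which the passage from second to first differences starts at the
  coarsest scale.\<close>

lemma first_diff_bound:
  fixes h :: 'a
  assumes q: "0 \<le> q" and r: "0 \<le> r" and h: "r + norm h \<le> R"
  shows "pow_int q (ball x0 r) (diff h u) \<le> ennreal (2 powr q * vol * M powr q)"
proof -
  have "pow_int q (ball x0 r) (diff h u) \<le> (\<integral>\<^sup>+x. ennreal ((2 * M) powr q) * indicator (ball x0 r) x \<partial>lebesgue)"
    unfolding pow_int_def
  proof (rule nn_integral_mono_AE)
    show "AE x in lebesgue. indicator (ball x0 r) x * ennreal (\<bar>diff h u x\<bar> powr q) \<le> ennreal ((2 * M) powr q) * indicator (ball x0 r) x"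
      using u_bounded AE_translation[OF u_bounded, of h]
    proof eventually_elim
      case (elim x)
      show ?case
      proof (cases "x \<in> ball x0 r")
        case True
        then have "x \<in> ball x0 R" "x + h \<in> ball x0 R"
          using h dist_triangle[of x0 "x + h" x] norm_ge_zero[of h] by (auto simp: dist_norm simp del: norm_ge_zero)
        then have "\<bar>diff h u x\<bar> \<le> 2 * M" using elim by (auto simp: diff_def)
        then have "\<bar>diff h u x\<bar> powr q \<le> (2 * M) powr q" using q by (intro powr_mono2) auto
        then show ?thesis using True by (simp add: ennreal_leI)
      qed simp
    qed
  qed
  also have "\<dots> = ennreal ((2 * M) powr q) * ennreal (vol * r powr real DIM('a))"
    unfolding vol_def emeasure_lebesgue_ball[OF r, of x0, symmetric] by (rule nn_integral_cmult_indicator) simp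
  also have "\<dots> = ennreal ((2 * M) powr q * (vol * r powr real DIM('a)))"
    using vol_nonneg by (intro ennreal_mult[symmetric]) auto
  also have "\<dots> \<le> ennreal (2 powr q * vol * M powr q)"
  proof (rule ennreal_leI)
    have "r \<le> 1" using h R norm_ge_zero[of h] by linarith
    then have "r powr real DIM('a) \<le> 1" using r by (intro powr_le1) auto
    then have "vol * r powr real DIM('a) \<le> vol" using vol_nonneg by (intro mult_left_le) auto
    then have "(2 * M) powr q * (vol * r powr real DIM('a)) \<le> (2 * M) powr q * vol" by (intro mult_left_mono) auto
    then show "(2 * M) powr q * (vol * r powr real DIM('a)) \<le> 2 powr q * vol * M powr q"
      by (simp add: powr_mult mult_ac)
  qed
  finally show ?thesis .
qed

end

section \<open>Iteration of the exponent, uniformly over solutions\<close>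

text \<open>\<open>C\<close> and \<open>\<kappa>\<close> precede the solution, the ball and
  \<open>M\<close>. This uniformity makes the estimate a property of the exponents alone, and so
  lets it be iterated.\<close>

definition gagliardo_estimate :: "'a::euclidean_space itself \<Rightarrow> real \<Rightarrow> real \<Rightarrow> real \<Rightarrow> real \<Rightarrow> real \<Rightarrow> bool" where
  "gagliardo_estimate T s1 sp p q \<sigma> \<longleftrightarrow> (\<exists>C \<kappa>. 0 \<le> C \<and> 0 \<le> \<kappa> \<and>
    (\<forall>(u :: 'a \<Rightarrow> real) x0 R M Z r. local_solution s1 sp p u x0 R M Z \<longrightarrow> 0 < r \<longrightarrow> r < R \<longrightarrow>
      gagliardo_int \<sigma> q (ball x0 r) u \<le> ennreal (C * M powr q / (R - r) powr \<kappa>)))"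

lemma gagliardo_estimate_base:
  assumes "p \<le> q"
  shows "gagliardo_estimate TYPE('a::euclidean_space) s1 sp p q (sp * p / q)"
  unfolding gagliardo_estimate_def
proof (rule exI[of _ "2 powr q"], rule exI[of _ 0], intro conjI allI impI)
  fix u :: "'a \<Rightarrow> real" and x0 R M Z r
  assume "local_solution s1 sp p u x0 R M Z" "0 < r" "r < R"
  then interpret local_solution s1 sp p u x0 R M Z by simp
  have "gagliardo_int (sp * p / q) q (ball x0 r) u \<le> gagliardo_int (sp * p / q) q (ball x0 R) u"
    using \<open>r < R\<close> by (intro gagliardo_int_mono_set subset_ball) simp
  also have "\<dots> \<le> ennreal (2 powr q * M powr q)" by (rule gagliardo_base[OF assms])
  finally show "gagliardo_int (sp * p / q) q (ball x0 r) u \<le> ennreal (2 powr q * M powr q / (R - r) powr 0)"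
    using \<open>r < R\<close> by simp
qed auto

text \<open>Second differences of order \<open>s\<close> give first differences of order
  \<open>s\<close>; only the return to the seminorm loses an arbitrarily small amount, hence
  \<open>\<sigma>' < s\<close>.\<close>

lemma gagliardo_estimate_step:
  fixes s1 sp p q \<sigma> \<sigma>' s :: real
  assumes s1: "0 < s1" "s1 < 1" and p: "1 < p" "p < 2" and sp: "0 < sp" "sp * p < 1" and q: "p \<le> q"
    and s: "s = (sp * p + \<sigma> * (q + 3 - 2 * p)) / (q + 2 - p)" "0 < s" "s < 1"
    and \<sigma>: "0 < \<sigma>" and \<sigma>': "0 < \<sigma>'" "\<sigma>' < s"
    and est: "gagliardo_estimate TYPE('a::euclidean_space) s1 sp p q \<sigma>"
  shows "gagliardo_estimate TYPE('a) s1 sp p q \<sigma>'"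
proof -
  define N where "N = real DIM('a)"
  have q1: "1 < q" using p q by simp
  obtain C \<kappa> where C: "0 \<le> C" "0 \<le> \<kappa>" and est':
    "\<And>(u :: 'a \<Rightarrow> real) x0 R M Z r. local_solution s1 sp p u x0 R M Z \<Longrightarrow> 0 < r \<Longrightarrow> r < R \<Longrightarrow>
      gagliardo_int \<sigma> q (ball x0 r) u \<le> ennreal (C * M powr q / (R - r) powr \<kappa>)"
    using est unfolding gagliardo_estimate_def by blast
  obtain CD where CD: "0 \<le> CD" and second:
    "\<And>(w :: 'a \<Rightarrow> real) x0 r d K K0 h. w \<in> borel_measurable lebesgue \<Longrightarrow> 0 < d \<Longrightarrow> 0 \<le> K \<Longrightarrow> 0 \<le> K0 \<Longrightarrow>
      (\<And>h. h \<noteq> 0 \<Longrightarrow> norm h \<le> d \<Longrightarrow> pow_int q (ball x0 r) (diff h (diff h w)) \<le> ennreal (K * norm h powr (s * q))) \<Longrightarrow>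
      (\<And>h. norm h \<le> 2 * d \<Longrightarrow> pow_int q (ball x0 r) (diff h w) \<le> ennreal K0) \<Longrightarrow>
      h \<noteq> 0 \<Longrightarrow> norm h \<le> 2 * d \<Longrightarrow>
      pow_int q (ball x0 r) (diff h w) \<le> ennreal (CD * (K + K0 / d powr (s * q)) * norm h powr (s * q))"
    by (rule pow_int_diff_le_of_second_diff[OF s(2,3) less_imp_le[OF q1], where 'a='a]) blast
  obtain CE where CE: "0 \<le> CE" and gag:
    "\<And>(w :: 'a \<Rightarrow> real) x0 r d L S. w \<in> borel_measurable lebesgue \<Longrightarrow> 0 < d \<Longrightarrow> d \<le> 1 \<Longrightarrow> 0 \<le> L \<Longrightarrow> 0 \<le> S \<Longrightarrow>
      0 \<le> r \<Longrightarrow> r < 1 \<Longrightarrow> (AE x in lebesgue. x \<in> ball x0 r \<longrightarrow> \<bar>w x\<bar> \<le> L) \<Longrightarrow>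
      (\<And>h. h \<noteq> 0 \<Longrightarrow> norm h < d \<Longrightarrow> pow_int q (ball x0 r) (diff h w) \<le> ennreal (S * norm h powr (s * q))) \<Longrightarrow>
      gagliardo_int \<sigma>' q (ball x0 r) w \<le> ennreal (CE * (S + L powr q / d powr (real DIM('a) + \<sigma>' * q)))"
    by (rule gagliardo_le_of_pow_int_diff[OF less_imp_le[OF q1] \<sigma>'(2,1), where 'a='a]) blast
  define V where "V = unit_ball_vol (real DIM('a))"
  have V: "0 < V" by (simp add: V_def)
  define \<delta> where "\<delta> = q + 1 - p"
  define l where "l = q / (q + 2 - p)"
  define \<theta> where "\<theta> = (l * (sp * p) + (1 - l) * (\<sigma> * q)) / q"
  define Cac where "Cac = cacc_const TYPE('a) s1 sp p \<delta>"
  define CA where "CA = nik_const TYPE('a) \<sigma> q"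
  define CB where "CB = nik_const TYPE('a) \<theta> q"
  have nn: "0 \<le> Cac" "0 \<le> CA" "0 \<le> CB" using p by (auto simp: Cac_def CA_def CB_def cacc_const_def)
  define KK where "KK = CB * (Cac * (CA * C + V) + 2 powr q * (2 * C))"
  have KK: "0 \<le> KK" using nn C V by (simp add: KK_def)
  define Ct where "Ct = CE * (CD * (KK + 2 powr q * V) + 1)"
  have Ct: "0 \<le> Ct" using CE CD KK V by (simp add: Ct_def)
  \<comment> \<open>\<open>N + 2\<close> from the Caccioppoli inequality and \<open>\<kappa>\<close>
    from the assumed estimate multiply; \<open>q\<close> covers \<open>s * q\<close> and
    \<open>\<sigma>' * q\<close>, since both orders are below 1.\<close>
  define \<kappa>' where "\<kappa>' = N + 2 + \<kappa> + q"
  have main: "gagliardo_int \<sigma>' q (ball x0 r) u \<le> ennreal (Ct * 8 powr \<kappa>' * M powr q / (R - r) powr \<kappa>')"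
    if sol: "local_solution s1 sp p u x0 R M Z" and r: "0 < r" "r < R" for u :: "'a \<Rightarrow> real" and x0 R M Z r
  proof -
    interpret local_solution s1 sp p u x0 R M Z by (rule sol)
    have volV: "vol = V" by (simp add: vol_def V_def)
    \<comment> \<open>Of the eight layers, six are spent by \<open>second_diff_bound\<close>; the
      last two separate the radius \<open>r + 6 d\<close> from \<open>R\<close>, as the estimate at
      \<open>\<sigma>\<close> requires. Rewriting \<open>d\<close> in terms of \<open>R - r\<close>
      yields \<open>8 powr \<kappa>'\<close>.\<close>
    define d where "d = (R - r) / 8"
    have "8 * d = R - r" by (simp add: d_def)
    then have d: "0 < d" "r + 8 * d = R" using r by auto
    have d1: "d \<le> 1" using d r R by simp
    define m where "m = M powr q"
    have m: "0 \<le> m" by (simp add: m_def)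
    define y where "y = C * m / d powr \<kappa>"
    have y0: "0 \<le> y" using C m by (simp add: y_def)
    have y: "gagliardo_int \<sigma> q (ball x0 (r + 6 * d)) u \<le> ennreal y"
    proof -
      have "gagliardo_int \<sigma> q (ball x0 (r + 6 * d)) u \<le> ennreal (C * M powr q / (R - (r + 6 * d)) powr \<kappa>)"
        by (rule est'[OF sol]) (use r d in auto)
      also have "\<dots> \<le> ennreal y"
        unfolding y_def m_def using C d by (intro ennreal_leI divide_left_mono powr_mono2) auto
      finally show ?thesis .
    qed
    define K where "K = CB * (Cac / d powr (real DIM('a) + 2) * (CA * y + V * M powr q) + 2 powr q * (2 * y))"
    have K0: "0 \<le> K" using nn y0 V by (simp add: K_def)
    define S where "S = CD * (K + 2 powr q * V * M powr q / d powr (s * q))"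
    have S0: "0 \<le> S" using CD K0 V by (simp add: S_def)
    have nik: "pow_int q (ball x0 r) (diff h u) \<le> ennreal (S * norm h powr (s * q))" if h: "h \<noteq> 0" "norm h < d" for h :: 'a
      unfolding S_def
    proof (rule second[OF u_measurable d(1) K0])
      show "pow_int q (ball x0 r) (diff h (diff h u)) \<le> ennreal (K * norm h powr (s * q))" if "h \<noteq> 0" "norm h \<le> d" for h :: 'a
        unfolding K_def volV[symmetric]
        by (rule second_diff_bound[OF q \<sigma> r(1) d that \<delta>_def l_def \<theta>_def s(1) Cac_def CA_def CB_def y0 y])
      show "pow_int q (ball x0 r) (diff h u) \<le> ennreal (2 powr q * V * M powr q)" if "norm h \<le> 2 * d" for h :: 'a
        unfolding volV[symmetric] by (rule first_diff_bound) (use that d r q1 in auto)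
    qed (use h d V in auto)
    have "gagliardo_int \<sigma>' q (ball x0 r) u \<le> ennreal (CE * (S + M powr q / d powr (real DIM('a) + \<sigma>' * q)))"
    proof (rule gag[OF u_measurable d(1) d1 _ S0])
      show "AE x in lebesgue. x \<in> ball x0 r \<longrightarrow> \<bar>u x\<bar> \<le> M"
        using u_bounded r by (auto elim!: eventually_mono)
    qed (use M r R nik in auto)
    also have "\<dots> \<le> ennreal (Ct * m * (1 / d powr \<kappa>'))"
    proof (rule ennreal_leI)
      define e where "e = 1 / d powr \<kappa>'"
      have e: "1 / d powr t \<le> e" if "t \<le> \<kappa>'" for t
        unfolding e_def using d d1 that by (intro divide_left_mono powr_mono') auto
      have x1: "Cac / d powr (N + 2) * (CA * y + V * m) \<le> e * (Cac * (CA * C + V) * m)"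
      proof -
        have "CA * y + V * m = (CA * C * (1 / d powr \<kappa>) + V * 1) * m" by (simp add: y_def algebra_simps)
        also have "\<dots> \<le> (CA * C * (1 / d powr \<kappa>) + V * (1 / d powr \<kappa>)) * m"
          using nn C V m d d1 powr_le1[of \<kappa> d] by (intro mult_right_mono add_mono mult_left_mono) (auto simp: field_simps)
        also have "\<dots> = (1 / d powr \<kappa>) * ((CA * C + V) * m)" by (simp add: algebra_simps add_divide_distrib)
        finally have "Cac / d powr (N + 2) * (CA * y + V * m) \<le> Cac / d powr (N + 2) * ((1 / d powr \<kappa>) * ((CA * C + V) * m))"
          using nn by (intro mult_left_mono) auto
        also have "\<dots> = 1 / d powr (N + 2 + \<kappa>) * (Cac * (CA * C + V) * m)" by (simp add: powr_add)
        also have "\<dots> \<le> e * (Cac * (CA * C + V) * m)"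
          using nn C V m q1 by (intro mult_right_mono e) (auto simp: \<kappa>'_def)
        finally show ?thesis .
      qed
      have x2: "2 powr q * (2 * y) \<le> e * (2 powr q * (2 * C) * m)"
      proof -
        have "2 powr q * (2 * y) = 1 / d powr \<kappa> * (2 powr q * (2 * C) * m)" by (simp add: y_def)
        also have "\<dots> \<le> e * (2 powr q * (2 * C) * m)"
          using C m q1 by (intro mult_right_mono e) (auto simp: \<kappa>'_def N_def)
        finally show ?thesis .
      qed
      have "CB * (Cac / d powr (N + 2) * (CA * y + V * m) + 2 powr q * (2 * y))
        \<le> CB * (e * (Cac * (CA * C + V) * m) + e * (2 powr q * (2 * C) * m))"
        by (intro mult_left_mono add_mono x1 x2 nn)
      also have "\<dots> = KK * m * e" by (simp add: KK_def algebra_simps)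
      finally have x3: "K \<le> KK * m * e" by (simp add: K_def N_def m_def)
      have x4: "2 powr q * V * m / d powr (s * q) \<le> 2 powr q * V * m * e"
      proof -
        have "s * q \<le> q" using s(2,3) q1 by (intro mult_left_le_one_le) auto
        then have "1 / d powr (s * q) \<le> e" using C by (intro e) (simp add: \<kappa>'_def N_def)
        from mult_left_mono[OF this, of "2 powr q * V * m"] show ?thesis using V m by simp
      qed
      have x5: "m / d powr (N + \<sigma>' * q) \<le> m * e"
      proof -
        have "\<sigma>' * q \<le> q" using \<sigma>' s(2,3) q1 by (intro mult_left_le_one_le) auto
        then have "1 / d powr (N + \<sigma>' * q) \<le> e" using C by (intro e) (simp add: \<kappa>'_def N_def)
        from mult_left_mono[OF this m] show ?thesis by simp
      qed
      have "CE * (S + M powr q / d powr (real DIM('a) + \<sigma>' * q))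
        = CE * (CD * (K + 2 powr q * V * m / d powr (s * q)) + m / d powr (N + \<sigma>' * q))"
        by (simp add: S_def m_def N_def)
      also have "\<dots> \<le> CE * (CD * (KK * m * e + 2 powr q * V * m * e) + m * e)"
        by (intro mult_left_mono add_mono x3 x4 x5 CE CD)
      also have "\<dots> = Ct * m * e" by (simp add: Ct_def algebra_simps)
      finally show "CE * (S + M powr q / d powr (real DIM('a) + \<sigma>' * q)) \<le> Ct * m * (1 / d powr \<kappa>')"
        by (simp add: e_def)
    qed
    also have "Ct * m * (1 / d powr \<kappa>') = Ct * 8 powr \<kappa>' * M powr q / (R - r) powr \<kappa>'"
      by (simp add: d_def powr_divide m_def)
    finally show ?thesis .
  qed
  show ?thesis
    unfolding gagliardo_estimate_def
    by (rule exI[of _ "Ct * 8 powr \<kappa>'"], rule exI[of _ \<kappa>'], intro conjI allI impI main)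
      (use Ct C q1 in \<open>auto simp: \<kappa>'_def N_def\<close>)
qed

text \<open>Distances in a ball of radius below 1 are below 2, so the kernels are comparable. It is
  used at the end, where the iteration passes the target exponent rather than hitting it.\<close>

lemma gagliardo_estimate_mono:
  fixes \<tau> \<sigma> :: real
  assumes est: "gagliardo_estimate TYPE('a::euclidean_space) s1 sp p q \<sigma>" and \<tau>: "\<tau> \<le> \<sigma>" and q: "0 \<le> q"
  shows "gagliardo_estimate TYPE('a) s1 sp p q \<tau>"
proof -
  obtain C \<kappa> where C: "0 \<le> C" "0 \<le> \<kappa>" and est':
    "\<And>(u :: 'a \<Rightarrow> real) x0 R M Z r. local_solution s1 sp p u x0 R M Z \<Longrightarrow> 0 < r \<Longrightarrow> r < R \<Longrightarrow>
      gagliardo_int \<sigma> q (ball x0 r) u \<le> ennreal (C * M powr q / (R - r) powr \<kappa>)"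
    using est unfolding gagliardo_estimate_def by blast
  define c where "c = 2 powr ((\<sigma> - \<tau>) * q)"
  have main: "gagliardo_int \<tau> q (ball x0 r) u \<le> ennreal (c * C * M powr q / (R - r) powr \<kappa>)"
    if sol: "local_solution s1 sp p u x0 R M Z" and r: "0 < r" "r < R" for u :: "'a \<Rightarrow> real" and x0 R M Z r
  proof -
    interpret local_solution s1 sp p u x0 R M Z by (rule sol)
    define B where "B = ball x0 r"
    define g where "g z = indicator B (fst z) * indicator B (snd z) *
        ennreal (\<bar>u (fst z) - u (snd z)\<bar> powr q / norm (fst z - snd z) powr (real DIM('a) + \<sigma> * q))" for z
    have [measurable]: "g \<in> borel_measurable leb2" unfolding g_def[abs_def] B_def by measurable
    have "gagliardo_int \<tau> q B u \<le> (\<integral>\<^sup>+z. ennreal c * g z \<partial>leb2)"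
      unfolding gagliardo_int_alt
    proof (rule nn_integral_mono)
      fix z :: "'a \<times> 'a"
      define n where "n = norm (fst z - snd z)"
      define a where "a = \<bar>u (fst z) - u (snd z)\<bar> powr q"
      show "indicator B (fst z) * indicator B (snd z) *
        ennreal (\<bar>u (fst z) - u (snd z)\<bar> powr q / norm (fst z - snd z) powr (real DIM('a) + \<tau> * q)) \<le> ennreal c * g z"
      proof (cases "fst z \<in> B \<and> snd z \<in> B")
        case True
        then have "n \<le> 2" using r R dist_triangle3[of "fst z" "snd z" x0] by (simp add: B_def n_def dist_norm)
        then have "n powr ((\<sigma> - \<tau>) * q) \<le> c"
          unfolding c_def using \<tau> q by (intro powr_mono2) (auto simp: n_def)
        then have "n powr ((\<sigma> - \<tau>) * q) * (a / n powr (real DIM('a) + \<sigma> * q)) \<le> c * (a / n powr (real DIM('a) + \<sigma> * q))"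
          by (rule mult_right_mono) (simp add: a_def)
        moreover have "a / n powr (real DIM('a) + \<tau> * q) = n powr ((\<sigma> - \<tau>) * q) * (a / n powr (real DIM('a) + \<sigma> * q))"
        proof (cases "n = 0")
          case False
          then have "0 < n" by (simp add: n_def)
          have "n powr (real DIM('a) + \<sigma> * q) = n powr ((\<sigma> - \<tau>) * q) * n powr (real DIM('a) + \<tau> * q)"
            unfolding powr_add[symmetric] by (rule arg_cong[where f = "\<lambda>e. n powr e"]) (simp add: algebra_simps)
          then show ?thesis using \<open>0 < n\<close> by simp
        qed simp
        ultimately have "ennreal (a / n powr (real DIM('a) + \<tau> * q)) \<le> ennreal (c * (a / n powr (real DIM('a) + \<sigma> * q)))"
          by (intro ennreal_leI) simp
        also have "\<dots> = ennreal c * ennreal (a / n powr (real DIM('a) + \<sigma> * q))"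
          by (rule ennreal_mult) (auto simp: c_def a_def)
        finally show ?thesis using True by (simp add: g_def a_def n_def)
      qed auto
    qed
    also have "\<dots> = ennreal c * gagliardo_int \<sigma> q B u"
      unfolding gagliardo_int_alt g_def[symmetric] by (rule nn_integral_cmult) measurable
    also have "\<dots> \<le> ennreal c * ennreal (C * M powr q / (R - r) powr \<kappa>)"
      unfolding B_def by (intro mult_left_mono est'[OF sol r]) auto
    also have "\<dots> = ennreal (c * (C * M powr q / (R - r) powr \<kappa>))"
      using C by (intro ennreal_mult[symmetric]) (auto simp: c_def)
    finally show ?thesis by (simp add: B_def mult.assoc)
  qed
  show ?thesis
    unfolding gagliardo_estimate_def
    by (rule exI[of _ "c * C"], rule exI[of _ \<kappa>], intro conjI allI impI main) (use C in \<open>auto simp: c_def\<close>)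
qed

text \<open>The map \<open>\<sigma> \<mapsto> (sp p + \<sigma> (q + 3 - 2p)) / (q + 2 - p)\<close> has the fixed point \<open>sp p / (p - 1)\<close>;
  it reduces the distance to it by the factor \<open>1 - c\<close>, \<open>c = (p - 1) / (q + 2 - p)\<close>.
  Half of that gain is kept.\<close>

lemma gagliardo_estimate_all:
  fixes s1 sp p q \<tau> :: real
  assumes s1: "0 < s1" "s1 < 1" and p: "1 < p" "p < 2" and sp: "0 < sp" "sp \<le> (p - 1) / p" and q: "p \<le> q"
    and \<tau>: "\<tau> < sp * p / (p - 1)"
  shows "gagliardo_estimate TYPE('a::euclidean_space) s1 sp p q \<tau>"
proof -
  define S where "S = sp * p / (p - 1)"
  define c where "c = (p - 1) / (q + 2 - p)"
  have spp: "sp * p \<le> p - 1" using sp p by (simp add: field_simps)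
  have spp1: "sp * p < 1" using spp p by simp
  \<comment> \<open>\<open>S \<le> 1\<close> is the hypothesis on \<open>sp\<close> in another form;
    it keeps the order \<open>s\<close> of every step below 1.\<close>
  have S: "0 < S" "S \<le> 1" using sp p spp by (auto simp: S_def)
  have qp: "0 < q + 2 - p" using p q by simp
  have c: "0 < c" "c < 1" using p q qp by (auto simp: c_def)
  define \<sigma>0 where "\<sigma>0 = sp * p / q"
  have \<sigma>0: "0 < \<sigma>0" "\<sigma>0 < S" using sp p q by (auto simp: \<sigma>0_def S_def intro!: divide_strict_left_mono)
  \<comment> \<open>Closed form of the recursion that adds \<open>c * (S - \<sigma> n) / 2\<close>
    to \<open>\<sigma> n\<close>. A full step would reach \<open>s\<close> itself, which
    \<open>gagliardo_estimate_step\<close> does not give.\<close>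
  define \<sigma> where "\<sigma> n = S - (1 - c / 2) ^ n * (S - \<sigma>0)" for n
  have pos: "0 < (1 - c / 2) ^ n" "(1 - c / 2) ^ n \<le> 1" for n using c by (auto intro: power_le_one)
  have \<sigma>b: "0 < \<sigma> n" "\<sigma> n < S" for n
  proof -
    show "\<sigma> n < S" using pos[of n] \<sigma>0 by (simp add: \<sigma>_def)
    have "(1 - c / 2) ^ n * (S - \<sigma>0) \<le> S - \<sigma>0" using pos[of n] \<sigma>0 by (intro mult_left_le_one_le) auto
    moreover have "0 < S - X" if "X \<le> S - \<sigma>0" for X using that \<sigma>0 by simp
    ultimately show "0 < \<sigma> n" unfolding \<sigma>_def by blast
  qed
  have est: "gagliardo_estimate TYPE('a) s1 sp p q (\<sigma> n)" for n
  proof (induction n)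
    case 0
    then show ?case using gagliardo_estimate_base[OF q, where 'a='a] by (simp add: \<sigma>_def \<sigma>0_def)
  next
    case (Suc n)
    define s where "s = (sp * p + \<sigma> n * (q + 3 - 2 * p)) / (q + 2 - p)"
    have "sp * p = S * (p - 1)" using p by (simp add: S_def)
    then have "sp * p + \<sigma> n * (q + 3 - 2 * p) = (q + 2 - p) * \<sigma> n + (p - 1) * (S - \<sigma> n)"
      by (simp add: algebra_simps)
    then have s: "s = \<sigma> n + c * (S - \<sigma> n)" using qp by (simp add: s_def c_def add_divide_distrib)
    have gap: "0 < c * (S - \<sigma> n)" "c * (S - \<sigma> n) < S - \<sigma> n" using c \<sigma>b[of n] by auto
    have suc: "\<sigma> (Suc n) = \<sigma> n + c * (S - \<sigma> n) / 2" by (simp add: \<sigma>_def field_simps)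
    show ?case
    proof (rule gagliardo_estimate_step[OF s1 p sp(1) spp1 q s_def _ _ \<sigma>b(1) _ _ Suc])
      show "0 < s" "s < 1" "0 < \<sigma> (Suc n)" "\<sigma> (Suc n) < s"
        using gap \<sigma>b[of n] S unfolding s suc by linarith+
    qed
  qed
  have "(\<lambda>n. S - (1 - c / 2) ^ n * (S - \<sigma>0)) \<longlonglongrightarrow> S - 0 * (S - \<sigma>0)"
    using c by (intro tendsto_intros LIMSEQ_power_zero) auto
  then have "eventually (\<lambda>n. \<tau> < \<sigma> n) sequentially"
    using \<tau> by (intro order_tendstoD(1)) (auto simp: \<sigma>_def[abs_def] S_def)
  then obtain n where "\<tau> < \<sigma> n" by (auto simp: eventually_sequentially)
  then show ?thesis using gagliardo_estimate_mono[OF est, of \<tau> n] p q by simp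
qed

section \<open>From weak solutions to the setting on a ball, and to arbitrary balls\<close>

text \<open>\<open>real_of_ereal\<close> returns 0 at infinity, so the essential supremum must be
  known to be finite before it serves as a bound. It is nonnegative because a negative bound on
  \<open>\<bar>u y\<bar>\<close> would make the ball a null set.\<close>

lemma Linf_norm_bound:
  fixes u :: "'a::euclidean_space \<Rightarrow> real"
  assumes u [measurable]: "u \<in> borel_measurable lebesgue" and r: "0 < r"
    and bd: "AE y in lebesgue. y \<in> ball c r \<longrightarrow> \<bar>u y\<bar> \<le> K"
  shows "AE y in lebesgue. y \<in> ball c r \<longrightarrow> \<bar>u y\<bar> \<le> Linf_norm (ball c r) u"
    and "0 \<le> Linf_norm (ball c r) u"
proof -
  define m where "m = restrict_space lebesgue (ball c r)"
  define e where "e = esssup m (\<lambda>x. ereal \<bar>u x\<bar>)"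
  have AEm: "(AE x in m. P x) \<longleftrightarrow> (AE x in lebesgue. x \<in> ball c r \<longrightarrow> P x)" for P
    unfolding m_def by (rule AE_restrict_space_iff) simp
  have "(\<lambda>x. ereal \<bar>u x\<bar>) \<in> borel_measurable m"
    unfolding m_def by (rule measurable_restrict_space1) measurable
  then have "e \<le> ereal K"
    unfolding e_def using bd AEm[of "\<lambda>x. ereal \<bar>u x\<bar> \<le> ereal K"] by (intro esssup_I) auto
  have L: "Linf_norm (ball c r) u = real_of_ereal e"
    by (simp add: Linf_norm_def e_def m_def)
  have "AE x in m. ereal \<bar>u x\<bar> \<le> e" unfolding e_def by (rule esssup_AE)
  then have "AE y in lebesgue. y \<in> ball c r \<longrightarrow> ereal \<bar>u y\<bar> \<le> e" unfolding AEm .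
  then show 1: "AE y in lebesgue. y \<in> ball c r \<longrightarrow> \<bar>u y\<bar> \<le> Linf_norm (ball c r) u"
    unfolding L
  proof eventually_elim
    case (elim y)
    show ?case using elim \<open>e \<le> ereal K\<close> by (cases e) auto
  qed
  show "0 \<le> Linf_norm (ball c r) u"
  proof (rule ccontr)
    assume "\<not> 0 \<le> Linf_norm (ball c r) u"
    then have "AE y in lebesgue. y \<notin> ball c r" using 1 by (auto elim!: eventually_mono)
    then have "ball c r \<in> null_sets lebesgue"
      by (subst (asm) AE_iff_null_sets[symmetric]) auto
    then have "emeasure lebesgue (ball c r) = 0" by (rule null_setsD1)
    then show False
      using emeasure_lebesgue_ball[of r c] r unit_ball_vol_pos[of "real DIM('a)"]
      by (simp del: emeasure_completion)
  qed
qed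

text \<open>\<open>Tail\<close> is built on a Bochner integral, which is 0 for a non-integrable
  function. Integrability follows from the tail space, since outside the ball
  \<open>1 + norm y\<close> is at most a multiple of \<open>norm (y - x0)\<close>.\<close>

lemma tail_integral_eq:
  fixes u :: "'a::euclidean_space \<Rightarrow> real"
  assumes ts: "in_tail_space p sp u" and R: "0 < R" and p: "1 < p" and sp: "0 < sp"
  shows "(\<integral>\<^sup>+y. indicator (- ball x0 R) y *
        ennreal (\<bar>u y\<bar> powr (p - 1) / norm (y - x0) powr (real DIM('a) + sp * p)) \<partial>lebesgue)
      = ennreal (Tail p sp u x0 R powr (p - 1) / R powr (sp * p))"
proof -
  define b where "b = real DIM('a) + sp * p"
  have b: "0 < b" using sp p by (simp add: b_def add_nonneg_pos)
  have u [measurable]: "u \<in> borel_measurable lebesgue"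
    and int: "integrable lebesgue (\<lambda>x. \<bar>u x\<bar> powr (p - 1) / (1 + norm x) powr b)"
    using ts by (auto simp: in_tail_space_def b_def)
  have [measurable]: "(\<lambda>y :: 'a. norm (y - x0) powr b) \<in> borel_measurable lebesgue"
    by (rule measurable_completion) measurable
  define f where "f y = indicat_real (- ball x0 R) y *\<^sub>R (\<bar>u y\<bar> powr (p - 1) / norm (y - x0) powr b)" for y
  have fm [measurable]: "f \<in> borel_measurable lebesgue" unfolding f_def[abs_def] by measurable
  have f0: "0 \<le> f y" for y by (simp add: f_def)
  \<comment> \<open>Outside the ball 1 is at most \<open>norm (y - x0) / R\<close>, so
    \<open>1 + norm x0\<close> is absorbed by a multiple of the distance to \<open>x0\<close>; the
    last 1 is for that distance itself.\<close>
  define c where "c = (1 + norm x0) / R + 1"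
  have c: "0 < c" using R by (simp add: c_def add_nonneg_pos)
  have "integrable lebesgue (\<lambda>x. c powr b * (\<bar>u x\<bar> powr (p - 1) / (1 + norm x) powr b))"
    using int by (rule integrable_mult_right)
  then have fi: "integrable lebesgue f"
  proof (rule Bochner_Integration.integrable_bound)
    show "AE y in lebesgue. norm (f y) \<le> norm (c powr b * (\<bar>u y\<bar> powr (p - 1) / (1 + norm y) powr b))"
    proof (rule AE_I2)
      fix y :: 'a
      show "norm (f y) \<le> norm (c powr b * (\<bar>u y\<bar> powr (p - 1) / (1 + norm y) powr b))"
      proof (cases "y \<in> ball x0 R")
        case False
        then have Ry: "R \<le> norm (y - x0)" by (simp add: dist_norm norm_minus_commute)
        have "1 + norm y \<le> (1 + norm x0) * 1 + norm (y - x0)"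
          using norm_triangle_ineq[of x0 "y - x0"] by simp
        also have "\<dots> \<le> (1 + norm x0) * (norm (y - x0) / R) + norm (y - x0)"
          using Ry R by (intro add_right_mono mult_left_mono) auto
        also have "\<dots> = c * norm (y - x0)" by (simp add: c_def distrib_right)
        finally have le: "1 + norm y \<le> c * norm (y - x0)" .
        have "\<bar>u y\<bar> powr (p - 1) / norm (y - x0) powr b = c powr b * \<bar>u y\<bar> powr (p - 1) / (c * norm (y - x0)) powr b"
          using c by (simp add: powr_mult)
        also have "\<dots> \<le> c powr b * \<bar>u y\<bar> powr (p - 1) / (1 + norm y) powr b"
        proof (intro divide_left_mono powr_mono2 mult_pos_pos)
          have "0 < norm (y - x0)" using Ry R by linarith
          then show "0 < (c * norm (y - x0)) powr b" using c by simp
          have "0 < 1 + norm y" by (simp add: add_pos_nonneg)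
          then show "0 < (1 + norm y) powr b" by simp
        qed (use le b in auto)
        finally show ?thesis using False by (simp add: f_def)
      qed (simp add: f_def)
    qed
  qed measurable
  define J where "J = (LINT x : (- ball x0 R) | lebesgue. \<bar>u x\<bar> powr (p - 1) / norm (x - x0) powr b)"
  have J: "J = (\<integral>x. f x \<partial>lebesgue)" by (simp add: J_def set_lebesgue_integral_def f_def)
  have J0: "0 \<le> J" unfolding J using f0 by (intro integral_nonneg_AE) auto
  have "Tail p sp u x0 R powr (p - 1) = R powr (sp * p) * J"
    using p J0 by (simp add: Tail_def J_def[symmetric] b_def[symmetric] powr_powr)
  then have T: "Tail p sp u x0 R powr (p - 1) / R powr (sp * p) = J" using R by simp
  have "(\<integral>\<^sup>+y. indicator (- ball x0 R) y * ennreal (\<bar>u y\<bar> powr (p - 1) / norm (y - x0) powr b) \<partial>lebesgue)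
    = (\<integral>\<^sup>+y. ennreal (f y) \<partial>lebesgue)"
    by (intro nn_integral_cong) (auto simp: f_def indicator_def)
  also have "\<dots> = ennreal J" unfolding J by (rule nn_integral_eq_integral[OF fi]) (use f0 in auto)
  finally show ?thesis unfolding T b_def .
qed

text \<open>All quantities in the sum are nonnegative, so it dominates each of them, and the summand
  1 provides the lower bound on \<open>M\<close>. A test function of the ball vanishes outside
  \<open>\<Omega>\<close> and is thus admissible there.\<close>

lemma local_solution_of_weak_solution:
  fixes u :: "'a::euclidean_space \<Rightarrow> real" and s1 sp p :: real
  assumes s1: "0 < s1" "s1 < 1" and p: "1 < p" "p < 2" and sp: "0 < sp" "sp \<le> (p - 1) / p"
    and sol: "weak_solution s1 sp p \<Omega> u" and lb: "locally_bounded \<Omega> u"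
    and R: "cball x0 R \<subseteq> \<Omega>" "0 < R" "R < 1"
  shows "\<exists>Z. local_solution s1 sp p u x0 R
    (Linf_norm (ball x0 R) u + Tail p sp u x0 R + gagliardo_seminorm sp p (ball x0 R) u + 1) Z"
proof -
  define L where "L = Linf_norm (ball x0 R) u"
  define T where "T = Tail p sp u x0 R"
  define G where "G = gagliardo_seminorm sp p (ball x0 R) u"
  define M where "M = L + T + G + 1"
  have W1: "in_W s1 1 (ball x0 R) u" and Wp: "in_W sp p (ball x0 R) u" and ts: "in_tail_space p sp u"
    using sol R by (auto simp: weak_solution_def in_W_loc_def)
  have u: "u \<in> borel_measurable lebesgue" using ts by (simp add: in_tail_space_def)
  obtain K where "AE y in lebesgue. y \<in> ball x0 R \<longrightarrow> \<bar>u y\<bar> \<le> K"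
    using lb R unfolding locally_bounded_def by blast
  note Lb = Linf_norm_bound[OF u R(2) this, folded L_def]
  have T0: "0 \<le> T" by (simp add: T_def Tail_def)
  have G0: "0 \<le> G" by (simp add: G_def gagliardo_seminorm_def)
  have MT: "L \<le> M" "T \<le> M" "G \<le> M" "1 \<le> M" using Lb(2) T0 G0 by (auto simp: M_def)
  obtain Z where Zm: "Z \<in> borel_measurable leb2"
    and Zs: "AE z in leb2. in_sgn (Z z) (u (fst z) - u (snd z))"
    and Zw: "\<And>\<phi>. in_W0 s1 1 \<Omega> \<phi> \<Longrightarrow> in_W0 sp p \<Omega> \<phi> \<Longrightarrow>
      integrable leb2 (pairing Z (real DIM('a) + s1) \<phi>) \<Longrightarrow>
      integrable leb2 (pairing (flux p u) (real DIM('a) + sp * p) \<phi>) \<Longrightarrow>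
      integral\<^sup>L leb2 (pairing Z (real DIM('a) + s1) \<phi>)
      + integral\<^sup>L leb2 (pairing (flux p u) (real DIM('a) + sp * p) \<phi>) = 0"
    using sol unfolding weak_solution_def pairing_def[abs_def] flux_def jp_def by blast
  have "local_solution s1 sp p u x0 R M Z"
  proof
    have "sp * p \<le> p - 1" using sp p by (simp add: field_simps)
    then show "sp * p < 1" using p by simp
    show "AE x in lebesgue. x \<in> ball x0 R \<longrightarrow> \<bar>u x\<bar> \<le> M"
      using Lb(1) MT(1) by (auto elim!: eventually_mono)
    show "gagliardo_int s1 1 (ball x0 R) u < \<infinity>" using W1 by (simp add: in_W_def)
    show "gagliardo_int sp p (ball x0 R) u \<le> ennreal (M powr p)"
    proof -
      have "gagliardo_int sp p (ball x0 R) u = ennreal (enn2real (gagliardo_int sp p (ball x0 R) u))"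
        using Wp by (simp add: in_W_def ennreal_enn2real)
      also have "enn2real (gagliardo_int sp p (ball x0 R) u) = G powr p"
        using p by (simp add: G_def gagliardo_seminorm_def powr_powr)
      also have "ennreal (G powr p) \<le> ennreal (M powr p)"
        using G0 MT p by (intro ennreal_leI powr_mono2) auto
      finally show ?thesis .
    qed
    show "(\<integral>\<^sup>+y. indicator (- ball x0 R) y *
        ennreal (\<bar>u y\<bar> powr (p - 1) / norm (y - x0) powr (real DIM('a) + sp * p)) \<partial>lebesgue)
      \<le> ennreal (M powr (p - 1) / R powr (sp * p))"
      unfolding tail_integral_eq[OF ts R(2) p(1) sp(1)]
      using T0 MT p by (intro ennreal_leI divide_right_mono powr_mono2) (auto simp: T_def)
    fix \<phi> :: "'a \<Rightarrow> real"
    assume \<phi>: "in_W s1 1 UNIV \<phi>" "in_W sp p UNIV \<phi>" and supp: "\<And>x. x \<notin> ball x0 R \<Longrightarrow> \<phi> x = 0"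
      and i: "integrable leb2 (pairing Z (real DIM('a) + s1) \<phi>)"
        "integrable leb2 (pairing (flux p u) (real DIM('a) + sp * p) \<phi>)"
    have "\<phi> x = 0" if "x \<notin> \<Omega>" for x
      using that R(1) ball_subset_cball[of x0 R] by (intro supp) blast
    then have "in_W0 s1 1 \<Omega> \<phi>" "in_W0 sp p \<Omega> \<phi>" using \<phi> by (auto simp: in_W0_def)
    from Zw[OF this i]
    show "integral\<^sup>L leb2 (pairing Z (real DIM('a) + s1) \<phi>)
      + integral\<^sup>L leb2 (pairing (flux p u) (real DIM('a) + sp * p) \<phi>) = 0" .
  qed (use s1 p sp u R MT Zm Zs in auto)
  then show ?thesis unfolding M_def L_def T_def G_def by blast
qed

text \<open>Near the diagonal, \<open>ball x r \<times> ball x r\<close> is covered by finitely many products of small balls.\<close>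

lemma gagliardo_int_finite_of_local:
  fixes u :: "'a::euclidean_space \<Rightarrow> real"
  assumes u [measurable]: "u \<in> borel_measurable lebesgue" and \<Omega>: "open \<Omega>" "cball x r \<subseteq> \<Omega>" and r: "0 < r"
    and bd: "AE y in lebesgue. y \<in> ball x r \<longrightarrow> \<bar>u y\<bar> \<le> K"
    and exps: "0 \<le> q" "0 \<le> real DIM('a) + \<sigma> * q"
    and loc: "\<And>y R s. cball y R \<subseteq> \<Omega> \<Longrightarrow> 0 < R \<Longrightarrow> R < 1 \<Longrightarrow> 0 < s \<Longrightarrow> s < R \<Longrightarrow> gagliardo_int \<sigma> q (ball y s) u < \<infinity>"
  shows "gagliardo_int \<sigma> q (ball x r) u < \<infinity>"
proof -
  define b where "b = real DIM('a) + \<sigma> * q"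
  define B where "B = ball x r"
  obtain e where e: "0 < e" "(\<Union>y\<in>cball x r. ball y e) \<subseteq> \<Omega>"
    using compact_subset_open_imp_ball_epsilon_subset[OF compact_cball \<Omega>] by blast
  \<comment> \<open>Radius \<open>d\<close> is for the cover, \<open>2 * d\<close> for balls that
    contain both points of a pair at distance below \<open>d\<close>, and \<open>3 * d\<close>,
    below \<open>e\<close> and 1, for the larger ball that the interior estimate requires.\<close>
  define d where "d = min e 1 / 4"
  have d: "0 < d" "3 * d < e" "3 * d < 1" using e by (auto simp: d_def min_def)
  have Gfin: "gagliardo_int \<sigma> q (ball y (2 * d)) u < \<infinity>" if "y \<in> cball x r" for y
  proof (rule loc[of y "3 * d"])
    have "cball y (3 * d) \<subseteq> ball y e" using d by auto
    then show "cball y (3 * d) \<subseteq> \<Omega>" using e(2) that by blast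
  qed (use d in auto)
  have "cball x r \<subseteq> (\<Union>y\<in>cball x r. ball y d)" using d by force
  then obtain F where F: "F \<subseteq> cball x r" "finite F" "cball x r \<subseteq> (\<Union>y\<in>F. ball y d)"
    using compactE_image[OF compact_cball, of "cball x r" "\<lambda>y. ball y d" x r] by (metis open_ball)
  define g where "g U z = indicator U (fst z) * indicator U (snd z) *
      ennreal (\<bar>u (fst z) - u (snd z)\<bar> powr q / norm (fst z - snd z) powr b)" for U z
  have gm [measurable]: "g (ball c s) \<in> borel_measurable leb2" for c s unfolding g_def[abs_def] by measurable
  have gi: "gagliardo_int \<sigma> q U u = (\<integral>\<^sup>+z. g U z \<partial>leb2)" for U
    unfolding gagliardo_int_alt g_def b_def ..
  define c where "c = (2 * K) powr q / d powr b"
  have K: "0 \<le> K \<or> (AE y in lebesgue. y \<notin> B)"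
    using bd by (cases "0 \<le> K") (auto elim!: eventually_mono simp: B_def)
  have [measurable]: "(\<lambda>z :: 'a \<times> 'a. indicator B (fst z) * indicator B (snd z) :: ennreal) \<in> borel_measurable leb2"
    unfolding B_def by measurable
  have "(\<integral>\<^sup>+z. g B z \<partial>leb2) \<le> (\<integral>\<^sup>+z. (\<Sum>y\<in>F. g (ball y (2 * d)) z) + ennreal c * (indicator B (fst z) * indicator B (snd z)) \<partial>leb2)"
  proof (rule nn_integral_mono_AE)
    show "AE z in leb2. g B z \<le> (\<Sum>y\<in>F. g (ball y (2 * d)) z) + ennreal c * (indicator B (fst z) * indicator B (snd z))"
      using AE_leb2_fst[OF bd] AE_leb2_snd[OF bd]
    proof eventually_elim
      case (elim z)
      show ?case
      proof (cases "fst z \<in> B \<and> snd z \<in> B")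
        case True
        show ?thesis
        proof (cases "dist (fst z) (snd z) < d")
          case near: True
          have "fst z \<in> cball x r" using True by (auto simp: B_def)
          then obtain y where y: "y \<in> F" "dist y (fst z) < d" using F(3) by auto
          then have "dist y (snd z) < 2 * d" using near dist_triangle[of y "snd z" "fst z"] by simp
          then have "g B z = g (ball y (2 * d)) z" using y d True by (simp add: g_def)
          also have "\<dots> \<le> (\<Sum>y\<in>F. g (ball y (2 * d)) z)"
            using F(2) y(1) by (intro member_le_sum) auto
          finally show ?thesis by (rule add_increasing2[rotated]) simp
        next
          case far: False
          have "\<bar>u (fst z) - u (snd z)\<bar> \<le> 2 * K" using elim True by (auto simp: B_def)
          then have "\<bar>u (fst z) - u (snd z)\<bar> powr q / norm (fst z - snd z) powr b \<le> c"
            unfolding c_def using far d exps by (intro frac_le powr_mono2) (auto simp: dist_norm b_def)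
          then have "g B z \<le> ennreal c * (indicator B (fst z) * indicator B (snd z))"
            using True by (simp add: g_def ennreal_leI)
          then show ?thesis by (rule add_increasing[rotated]) simp
        qed
      qed (auto simp: g_def)
    qed
  qed
  also have "\<dots> = (\<Sum>y\<in>F. \<integral>\<^sup>+z. g (ball y (2 * d)) z \<partial>leb2)
      + ennreal c * (\<integral>\<^sup>+z. indicator B (fst z) * indicator B (snd z) \<partial>(leb2 :: ('a \<times> 'a) measure))"
    by (subst nn_integral_add, measurable, subst nn_integral_sum, measurable, subst nn_integral_cmult, measurable)
  also have "\<dots> < \<infinity>"
  proof -
    have "(\<Sum>y\<in>F. \<integral>\<^sup>+z. g (ball y (2 * d)) z \<partial>leb2) < \<infinity>"
      using F(2,1)
    proof (induction F)
      case (insert y F)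
      then have "(\<integral>\<^sup>+z. g (ball y (2 * d)) z \<partial>leb2) < \<infinity>" using Gfin[of y] unfolding gi by blast
      then show ?case using insert by auto
    qed simp
    moreover have "(\<integral>\<^sup>+z. indicator B (fst z) * indicator B (snd z) \<partial>(leb2 :: ('a \<times> 'a) measure)) < \<infinity>"
    proof -
      have "(\<integral>\<^sup>+z. indicator B (fst z) * indicator B (snd z) \<partial>(leb2 :: ('a \<times> 'a) measure))
        = (\<integral>\<^sup>+x. \<integral>\<^sup>+y. indicator B x * indicator B y \<partial>lebesgue \<partial>lebesgue)"
        by (subst leb.nn_integral_fst[symmetric]) (simp_all)
      also have "\<dots> = (\<integral>\<^sup>+x. emeasure lebesgue B * indicator B x \<partial>lebesgue)"
        by (intro nn_integral_cong, subst nn_integral_cmult_indicator)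
          (auto simp: B_def mult.commute simp del: emeasure_completion)
      also have "\<dots> = emeasure lebesgue B * emeasure lebesgue B"
        by (rule nn_integral_cmult_indicator) (simp add: B_def)
      also have "\<dots> < \<infinity>"
        unfolding B_def emeasure_lebesgue_ball[OF less_imp_le[OF r]] by (intro ennreal_mult_less_infinity) auto
      finally show ?thesis .
    qed
    ultimately show ?thesis using ennreal_mult_less_top by auto
  qed
  finally show ?thesis unfolding gi B_def .
qed

theorem theorem1p3:
  fixes s1 p sp :: real
  assumes "DIM('a::euclidean_space) \<ge> 2"
    and "0 < s1" "s1 < 1"
    and "1 < p" "p < 2"
    and "0 < sp" "sp \<le> (p - 1) / p"
  shows "\<forall>q \<sigma>. q \<ge> p \<and> sp \<le> \<sigma> \<and> \<sigma> < sp * p / (p - 1) \<longrightarrow>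
    (\<exists>C \<kappa>. \<forall>(\<Omega> :: 'a set) (u :: 'a \<Rightarrow> real).
       open \<Omega> \<and> connected \<Omega> \<and> \<Omega> \<noteq> {} \<and> bounded \<Omega> \<and>
       weak_solution s1 sp p \<Omega> u \<and> locally_bounded \<Omega> u \<longrightarrow>
         in_W_loc \<sigma> q \<Omega> u \<and>
         (\<forall>x0 R r. cball x0 R \<subseteq> \<Omega> \<and> 0 < R \<and> R < 1 \<and> 0 < r \<and> r < R \<longrightarrow>
            gagliardo_seminorm \<sigma> q (ball x0 r) u powr q
              \<le> C * (Linf_norm (ball x0 R) u + Tail p sp u x0 R
                     + gagliardo_seminorm sp p (ball x0 R) u + 1) powr q
                / (R - r) powr \<kappa>))"
proof (intro allI impI, goal_cases)
  case (1 q \<sigma>)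
  then have q: "p \<le> q" and \<sigma>: "sp \<le> \<sigma>" "\<sigma> < sp * p / (p - 1)" by auto
  have q0: "0 < q" using q assms(4) by simp
  obtain C \<kappa> where C: "0 \<le> C" and est:
    "\<And>(u :: 'a \<Rightarrow> real) x0 R M Z r. local_solution s1 sp p u x0 R M Z \<Longrightarrow> 0 < r \<Longrightarrow> r < R \<Longrightarrow>
      gagliardo_int \<sigma> q (ball x0 r) u \<le> ennreal (C * M powr q / (R - r) powr \<kappa>)"
    using gagliardo_estimate_all[OF assms(2-7) q \<sigma>(2), where 'a='a]
    unfolding gagliardo_estimate_def by blast
  have main: "gagliardo_int \<sigma> q (ball x0 r) u \<le> ennreal (C * (Linf_norm (ball x0 R) u + Tail p sp u x0 R
                     + gagliardo_seminorm sp p (ball x0 R) u + 1) powr q / (R - r) powr \<kappa>)"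
    if "weak_solution s1 sp p \<Omega> u" "locally_bounded \<Omega> u" "cball x0 R \<subseteq> \<Omega>" "0 < R" "R < 1" "0 < r" "r < R"
    for \<Omega> and u :: "'a \<Rightarrow> real" and x0 R r
    using local_solution_of_weak_solution[OF assms(2-7) that(1-5)] est that(6,7) by blast
  show ?case
  proof (rule exI[of _ C], rule exI[of _ \<kappa>], intro allI impI, goal_cases)
    case (1 \<Omega> u)
    then have \<Omega>: "open \<Omega>" and sol: "weak_solution s1 sp p \<Omega> u" and lb: "locally_bounded \<Omega> u" by auto
    have u [measurable]: "u \<in> borel_measurable lebesgue" using lb by (simp add: locally_bounded_def)
    show ?case
    proof (intro conjI allI impI)
      show "in_W_loc \<sigma> q \<Omega> u"
        unfolding in_W_loc_def
      proof (intro allI impI)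
        fix x r assume "0 < r \<and> cball x r \<subseteq> \<Omega>"
        then have r: "0 < r" "cball x r \<subseteq> \<Omega>" by auto
        obtain K where bd: "AE y in lebesgue. y \<in> ball x r \<longrightarrow> \<bar>u y\<bar> \<le> K"
          using lb r unfolding locally_bounded_def by blast
        have "set_integrable lebesgue (ball x r) (\<lambda>x. \<bar>u x\<bar> powr q)"
          unfolding set_integrable_def
        proof (rule integrableI_bounded)
          have "(\<integral>\<^sup>+y. ennreal (norm (indicat_real (ball x r) y *\<^sub>R \<bar>u y\<bar> powr q)) \<partial>lebesgue)
            \<le> (\<integral>\<^sup>+y. ennreal (K powr q) * indicator (ball x r) y \<partial>lebesgue)"
          proof (rule nn_integral_mono_AE)
            show "AE y in lebesgue. ennreal (norm (indicat_real (ball x r) y *\<^sub>R \<bar>u y\<bar> powr q))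
              \<le> ennreal (K powr q) * indicator (ball x r) y"
              using bd by eventually_elim (use q0 in \<open>auto simp: indicator_def intro!: ennreal_leI powr_mono2\<close>)
          qed
          also have "\<dots> = ennreal (K powr q) * emeasure lebesgue (ball x r)"
            by (rule nn_integral_cmult_indicator) simp
          also have "\<dots> < \<infinity>"
            unfolding emeasure_lebesgue_ball[OF less_imp_le[OF r(1)]] by (intro ennreal_mult_less_infinity) auto
          finally show "(\<integral>\<^sup>+y. ennreal (norm (indicat_real (ball x r) y *\<^sub>R \<bar>u y\<bar> powr q)) \<partial>lebesgue) < \<infinity>" .
        qed measurable
        moreover have "gagliardo_int \<sigma> q (ball x r) u < \<infinity>"
        \<comment> \<open>The estimate concerns radii below 1 and a strictly larger ball inside
          \<open>\<Omega>\<close>. Finiteness on an arbitrary ball follows by covering, its closure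
          being compact in the open set.\<close>
        proof (rule gagliardo_int_finite_of_local[OF u \<Omega> r(2,1) bd])
          show "gagliardo_int \<sigma> q (ball y s) u < \<infinity>"
            if "cball y R \<subseteq> \<Omega>" "0 < R" "R < 1" "0 < s" "s < R" for y R s
            using main[OF sol lb that] by (rule le_less_trans) simp
        qed (use q0 \<sigma> assms in auto)
        ultimately show "in_W \<sigma> q (ball x r) u" using u by (simp add: in_W_def in_Lq_def)
      qed
    next
      fix x0 R r assume "cball x0 R \<subseteq> \<Omega> \<and> 0 < R \<and> R < 1 \<and> 0 < r \<and> r < R"
      then have R: "cball x0 R \<subseteq> \<Omega>" "0 < R" "R < 1" "0 < r" "r < R" by auto
      \<comment> \<open>The outer power \<open>q\<close> cancels the root. \<open>enn2real\<close>
        loses nothing, since \<open>main\<close> bounds the integral by a finite number.\<close>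
      have "gagliardo_seminorm \<sigma> q (ball x0 r) u powr q = enn2real (gagliardo_int \<sigma> q (ball x0 r) u)"
        using q0 by (simp add: gagliardo_seminorm_def powr_powr)
      also have "\<dots> \<le> C * (Linf_norm (ball x0 R) u + Tail p sp u x0 R
                     + gagliardo_seminorm sp p (ball x0 R) u + 1) powr q / (R - r) powr \<kappa>"
        using C by (intro enn2real_leI main[OF sol lb R]) auto
      finally show "gagliardo_seminorm \<sigma> q (ball x0 r) u powr q
          \<le> C * (Linf_norm (ball x0 R) u + Tail p sp u x0 R
                     + gagliardo_seminorm sp p (ball x0 R) u + 1) powr q / (R - r) powr \<kappa>" .
    qed
  qed
qed

end
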